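(* Let $(\Lambda V,d)$ be a minimal Sullivan algebra with $V$ finite-dimensional, with associated pure algebra $(\Lambda V,d_\sigma)$, and let $f$ represent the generating class of $\mathrm{Ext}_{(\Lambda V,d_\sigma)}(\mathbb{K},(\Lambda V,d_\sigma))$. Let $f^l$ be the element constructed from $f$ by the procedure described in the context. Then $[f^l]$ is the generating class of $\mathrm{Ext}_{(\Lambda V,d)}(\mathbb{K},(\Lambda V,d))$.
   Context: $\mathbb{K}$ is a field of characteristic zero; $(\Lambda V,d)$ is $1$-connected. Write $Q=V^{\rm even}$, $P=V^{\rm odd}$. The pure differential $d_\sigma$ on $\Lambda V$ is the part of $d$ with $d_\sigma(Q)=0$, $d_\sigma(P)\subset\Lambda Q$ and $dv-d_\sigma v\in\Lambda Q\otimes\Lambda^+P$ for all $v\in V$. Let $\Lambda V\otimes\Lambda sV$ be the semifree resolution (acyclic closure) of $\mathbb{K}$ over $(\Lambda V,d)$, with $|sv|=|v|-1$ and differential extending $d$ by $d(sv)=v-s(dv)$, where on products $s(v_1\cdots v_r)=v_1\cdots v_{r-1}\,sv_r$ up to sign. Let $A=\mathrm{Hom}_{\Lambda V}(\Lambda V\otimes\Lambda sV,\Lambda V)$ with $D(g)=d\circ g+(-1)^{|g|+1}g\circ d$, so $H(A,D)=\mathrm{Ext}_{(\Lambda V,d)}(\mathbb{K},(\Lambda V,d))$; using $d_\sigma$ instead of $d$ gives $D_\sigma$ and $\mathrm{Ext}_{(\Lambda V,d_\sigma)}(\mathbb{K},(\Lambda V,d_\sigma))$. As $\dim V<\infty$,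 both algebras are Gorenstein (their Ext spaces are one-dimensional) with the same formal dimension $N$ (the total degree of the generator); a nonzero element is called the generating class. Bigradings and filtrations: $(\Lambda V)^{n+q,-q}=(\Lambda Q\otimes\Lambda^qP)^n$, $F^p(\Lambda V)=(\Lambda V)^{\ge p,*}$, $$(\Lambda V\otimes\Lambda sV)^{r,s}=\bigoplus_{r=a_1+a_2+2a_3}(\Lambda Q\otimes\Lambda^{a_1}sQ\otimes\Lambda^{a_2}P\otimes\Lambda^{a_3}sP)^s,$$ and $F^pA^n=\{g\in A^n: g((\Lambda V\otimes\Lambda sV)^{r,s})\subset(F^{p+n+s+r}(\Lambda V))^{n+s}\ \text{for all } r,s\}$. This filtration induces a convergent spectral sequence $\mathrm{Ext}^{p,-q}_{(\Lambda V,d_\sigma)}(\mathbb{K},(\Lambda V,d_\sigma))\Rightarrow\mathrm{Ext}^{p-q}_{(\Lambda V,d)}(\mathbb{K},(\Lambda V,d))$. Let $(p,-q)$, $N=p-q$, be the unique bidegree in which $\mathrm{Ext}_{(\Lambda V,d_\sigma)}(\mathbb{K},(\Lambda V,d_\sigma))$ is nonzero. The representative $f\in A^N$ satisfies $f((\Lambda V\otimes\Lambda sV)^{r,s})\subset F^{p+N+r+s}(\Lambda V)$ and $Df((\Lambda V\otimes\Lambda sV)^{r,s})\subset F^{p+N+r+s+1}(\Lambda V)$. **Construction of $f^l$.** If $Df=0$, set $f^l:=f$. Otherwise write $Df=h_0^0+\cdots+h_l^0$, where $h_i^0$ sends $(\Lambda V\otimes\Lambda sV)^{r,s}$ to $(\Lambda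 V)^{p+N+s+r+i+1,*}$ and $h_l^0\ne0$. Put $f^0=f$ and, for $1\le j\le l$, $f^j=f^{j-1}-\beta_j$, where $\beta_j\in A^N$ is chosen with $D_\sigma\beta_j=h_{j-1}^{j-1}$ and $h_{j-1}^{j-1}$ is the component of $Df^{j-1}$ sending $(\Lambda V\otimes\Lambda sV)^{r,s}$ to $(\Lambda V)^{p+N+s+r+j,*}$. If $Df^l\ne0$, then $f^l$ is replaced by $f^l-\beta_{l+1}$, where $\beta_{l+1}\in A^N$ satisfies $D_\sigma\beta_{l+1}=Df^l$.
   Formalization: Each β_j is chosen in F^{p+j}A^N (an arbitrary β_j in A^N could cancel the class, e.g. β_1 = f), and the last replacement of f^l is repeated, with D_σβ equal to the leading component of Df^j or to all of Df^j, until the result is a cocycle. *)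

theory Defs
  imports Complex_Main "HOL-Library.Poly_Mapping"
begin

section \<open>Free graded commutative algebras\<close>

text \<open>
  A finite-dimensional graded vector space \<open>V\<close> is given by a homogeneous basis \<open>B\<close> with degree
  function \<open>deg\<close>. The free graded commutative algebra \<open>\<Lambda>V \<otimes> \<Lambda>sV = \<Lambda>(V \<oplus> sV)\<close> has as basis the
  monomials in the generators \<open>Inl v\<close> (for \<open>v\<close>) and \<open>Inr v\<close> (for \<open>sv\<close>) in which odd generators
  have exponent at most 1, and \<open>\<Lambda>V\<close> is the subalgebra of the elements involving only
  generators \<open>Inl v\<close>. A monomial stands for the product of its generators in increasing order
  (with respect to \<open>gen_less\<close>), which fixes all signs.

  The product is \<open>gmul\<close> below; the (unsigned) convolution product that the library puts on
  finitely supported functions is not used.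
\<close>

type_synonym 'v mon = "('v + 'v) \<Rightarrow>\<^sub>0 nat"
type_synonym ('v, 'k) elt = "'v mon \<Rightarrow>\<^sub>0 'k"

fun gdeg :: "('v \<Rightarrow> nat) \<Rightarrow> 'v + 'v \<Rightarrow> nat" where
  "gdeg deg (Inl v) = deg v"
| "gdeg deg (Inr v) = deg v - 1"

fun gen_less :: "'v::linorder + 'v \<Rightarrow> 'v + 'v \<Rightarrow> bool" where
  "gen_less (Inl a) (Inl b) = (a < b)"
| "gen_less (Inl a) (Inr b) = True"
| "gen_less (Inr a) (Inl b) = False"
| "gen_less (Inr a) (Inr b) = (a < b)"

definition weight :: "('v + 'v \<Rightarrow> nat) \<Rightarrow> 'v mon \<Rightarrow> nat" where
  "weight w m = (\<Sum>g\<in>Poly_Mapping.keys m. Poly_Mapping.lookup m g * w g)"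

definition mdeg :: "('v \<Rightarrow> nat) \<Rightarrow> 'v mon \<Rightarrow> nat" where
  "mdeg deg = weight (gdeg deg)"

definition wlen :: "'v mon \<Rightarrow> nat" where
  "wlen = weight (\<lambda>_. 1)"

text \<open>The number of factors from \<open>P = V\<^sup>o\<^sup>d\<^sup>d\<close>.\<close>

definition plen :: "('v \<Rightarrow> nat) \<Rightarrow> 'v mon \<Rightarrow> nat" where
  "plen deg = weight (\<lambda>g. case g of Inl v \<Rightarrow> if odd (deg v) then 1 else 0 | Inr v \<Rightarrow> 0)"

text \<open>The number \<open>r = a\<^sub>1 + a\<^sub>2 + 2a\<^sub>3\<close> for monomials in \<open>\<Lambda>Q \<otimes> \<Lambda>\<^sup>a\<^sup>1sQ \<otimes> \<Lambda>\<^sup>a\<^sup>2P \<otimes> \<Lambda>\<^sup>a\<^sup>3sP\<close>.\<close>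

definition rdeg :: "('v \<Rightarrow> nat) \<Rightarrow> 'v mon \<Rightarrow> nat" where
  "rdeg deg = weight (\<lambda>g. case g of Inl v \<Rightarrow> if odd (deg v) then 1 else 0
                                  | Inr v \<Rightarrow> if odd (deg v) then 2 else 1)"

text \<open>
  The Koszul sign of the product of two monomials: each odd generator of \<open>m'\<close> is moved past the
  larger odd generators of \<open>m\<close>.
\<close>

definition koszul :: "('v::linorder \<Rightarrow> nat) \<Rightarrow> 'v mon \<Rightarrow> 'v mon \<Rightarrow> 'k::field_char_0" where
  "koszul deg m m' =
     (if \<exists>g. odd (gdeg deg g) \<and> Poly_Mapping.lookup (m + m') g \<ge> 2 then 0
      else (- 1) ^ card {(g, h). g \<in> Poly_Mapping.keys m \<and> h \<in> Poly_Mapping.keys m' \<and>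
                           odd (gdeg deg g) \<and> odd (gdeg deg h) \<and> gen_less h g})"

definition gmul :: "('v::linorder \<Rightarrow> nat) \<Rightarrow> ('v, 'k::field_char_0) elt \<Rightarrow> ('v, 'k) elt \<Rightarrow> ('v, 'k) elt"
  where "gmul deg x y =
    (\<Sum>m\<in>Poly_Mapping.keys x. \<Sum>m'\<in>Poly_Mapping.keys y.
       Poly_Mapping.single (m + m')
         (koszul deg m m' * Poly_Mapping.lookup x m * Poly_Mapping.lookup y m'))"

definition smul :: "'k::field_char_0 \<Rightarrow> ('v, 'k) elt \<Rightarrow> ('v, 'k) elt" where
  "smul c x = Poly_Mapping.map ((*) c) x"

definition mon_elt :: "'v mon \<Rightarrow> ('v, 'k::field_char_0) elt" where
  "mon_elt m = Poly_Mapping.single m 1"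

definition vgen :: "'v \<Rightarrow> ('v, 'k::field_char_0) elt" where
  "vgen v = mon_elt (Poly_Mapping.single (Inl v) 1)"

definition sgen :: "'v \<Rightarrow> ('v, 'k::field_char_0) elt" where
  "sgen v = mon_elt (Poly_Mapping.single (Inr v) 1)"

definition LVsV :: "'v set \<Rightarrow> ('v \<Rightarrow> nat) \<Rightarrow> ('v, 'k::field_char_0) elt set" where
  "LVsV B deg = {x. \<forall>m\<in>Poly_Mapping.keys x. Poly_Mapping.keys m \<subseteq> Inl ` B \<union> Inr ` B \<and>
                     (\<forall>g. odd (gdeg deg g) \<longrightarrow> Poly_Mapping.lookup m g \<le> 1)}"

definition LV :: "'v set \<Rightarrow> ('v \<Rightarrow> nat) \<Rightarrow> ('v, 'k::field_char_0) elt set" where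
  "LV B deg = {x \<in> LVsV B deg. \<forall>m\<in>Poly_Mapping.keys x. Poly_Mapping.keys m \<subseteq> Inl ` B}"

definition homog :: "('v \<Rightarrow> nat) \<Rightarrow> int \<Rightarrow> ('v, 'k::field_char_0) elt \<Rightarrow> bool" where
  "homog deg n x \<longleftrightarrow> (\<forall>m\<in>Poly_Mapping.keys x. int (mdeg deg m) = n)"

definition psgn :: "int \<Rightarrow> 'k::field_char_0" where
  "psgn n = (if even n then 1 else - 1)"

definition linear_map_on ::
    "('v, 'k::field_char_0) elt set \<Rightarrow> (('v, 'k) elt \<Rightarrow> ('v, 'k) elt) \<Rightarrow> bool" where
  "linear_map_on X h \<longleftrightarrow> (\<forall>x\<in>X. \<forall>y\<in>X. h (x + y) = h x + h y) \<and> (\<forall>c. \<forall>x\<in>X. h (smul c x) = smul c (h x))"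


section \<open>Sullivan algebras and acyclic closures\<close>

definition differential_on ::
    "('v::linorder \<Rightarrow> nat) \<Rightarrow> ('v, 'k::field_char_0) elt set \<Rightarrow> (('v, 'k) elt \<Rightarrow> ('v, 'k) elt) \<Rightarrow> bool"
  where "differential_on deg X d \<longleftrightarrow>
    linear_map_on X d \<and> d ` X \<subseteq> X \<and>
    (\<forall>n. \<forall>x\<in>X. homog deg n x \<longrightarrow> homog deg (n + 1) (d x)) \<and>
    (\<forall>n. \<forall>x\<in>X. \<forall>y\<in>X. homog deg n x \<longrightarrow>
        d (gmul deg x y) = gmul deg (d x) y + smul (psgn n) (gmul deg x (d y))) \<and>
    (\<forall>x\<in>X. d (d x) = 0)"

text \<open>
  Since \<open>V = V\<^sup>\<ge>\<^sup>2\<close> and \<open>d\<close> is decomposable, \<open>dv\<close> only involves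
  generators of degree less than \<open>deg v\<close>; so the nilpotence condition in the definition of a
  Sullivan algebra holds automatically, with \<open>V(k) = V\<^sup>\<le>\<^sup>k\<close>.
\<close>

definition minimal_sullivan ::
    "'v::linorder set \<Rightarrow> ('v \<Rightarrow> nat) \<Rightarrow> (('v, 'k::field_char_0) elt \<Rightarrow> ('v, 'k) elt) \<Rightarrow> bool"
  where "minimal_sullivan B deg d \<longleftrightarrow>
    (\<forall>v\<in>B. deg v \<ge> 2) \<and>
    differential_on deg (LV B deg) d \<and>
    (\<forall>v\<in>B. \<forall>m\<in>Poly_Mapping.keys (d (vgen v)). wlen m \<ge> 2)"

definition pure_part ::
    "'v::linorder set \<Rightarrow> ('v \<Rightarrow> nat) \<Rightarrow> (('v, 'k::field_char_0) elt \<Rightarrow> ('v, 'k) elt) \<Rightarrow>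
     (('v, 'k) elt \<Rightarrow> ('v, 'k) elt) \<Rightarrow> bool"
  where "pure_part B deg d ds \<longleftrightarrow>
    differential_on deg (LV B deg) ds \<and>
    (\<forall>v\<in>B. even (deg v) \<longrightarrow> ds (vgen v) = 0) \<and>
    (\<forall>v\<in>B. odd (deg v) \<longrightarrow> (\<forall>m\<in>Poly_Mapping.keys (ds (vgen v)). plen deg m = 0)) \<and>
    (\<forall>v\<in>B. \<forall>m\<in>Poly_Mapping.keys (d (vgen v) - ds (vgen v)). plen deg m \<ge> 1)"

text \<open>
  The operator \<open>s\<close> on products, \<open>s(v\<^sub>1\<cdots>v\<^sub>r) = v\<^sub>1\<cdots>v\<^sub>r\<^sub>-\<^sub>1 sv\<^sub>r\<close> up to sign. As the factors of a product
  in \<open>\<Lambda>V\<close> commute up to sign, the formula depends on which factor is written last. All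
  choices, and linear combinations of them, are admitted: \<open>s\<close> is a linear map that sends a monomial
  into the span of the elements obtained from it by replacing one factor \<open>v\<close> by \<open>sv\<close>.
  Signs and coefficients are then constrained by \<open>d\<^sup>2 = 0\<close> on \<open>\<Lambda>V \<otimes> \<Lambda>sV\<close>.
\<close>

definition suspension ::
    "'v::linorder set \<Rightarrow> ('v \<Rightarrow> nat) \<Rightarrow> (('v, 'k::field_char_0) elt \<Rightarrow> ('v, 'k) elt) \<Rightarrow> bool"
  where "suspension B deg S \<longleftrightarrow>
    linear_map_on (LV B deg) S \<and>
    (\<forall>v\<in>B. S (vgen v) = sgen v) \<and>
    (\<forall>m. mon_elt m \<in> (LV B deg :: ('v, 'k) elt set) \<and> m \<noteq> 0 \<longrightarrow>
       (\<exists>c. S (mon_elt m) =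
          (\<Sum>v | Inl v \<in> Poly_Mapping.keys m.
             smul (c v) (gmul deg (mon_elt (m - Poly_Mapping.single (Inl v) 1)) (sgen v)))))"

text \<open>
  The last clause says that the augmentation \<open>\<Lambda>V \<otimes> \<Lambda>sV \<rightarrow> \<K>\<close>, \<open>x \<mapsto> lookup x 0\<close>, is a
  quasi-isomorphism.
\<close>

definition acyclic_closure ::
    "'v::linorder set \<Rightarrow> ('v \<Rightarrow> nat) \<Rightarrow> (('v, 'k::field_char_0) elt \<Rightarrow> ('v, 'k) elt) \<Rightarrow>
     (('v, 'k) elt \<Rightarrow> ('v, 'k) elt) \<Rightarrow> (('v, 'k) elt \<Rightarrow> ('v, 'k) elt) \<Rightarrow> bool"
  where "acyclic_closure B deg S d \<delta> \<longleftrightarrow>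
    differential_on deg (LVsV B deg) \<delta> \<and>
    (\<forall>x\<in>LV B deg. \<delta> x = d x) \<and>
    (\<forall>v\<in>B. \<delta> (sgen v) = vgen v - S (d (vgen v))) \<and>
    (\<forall>x\<in>LVsV B deg. \<delta> x = 0 \<longrightarrow> (Poly_Mapping.lookup x 0 = 0 \<longleftrightarrow> x \<in> \<delta> ` LVsV B deg))"


section \<open>The complex of \<open>\<Lambda>V\<close>-linear maps\<close>

text \<open>
  \<open>A\<^sup>n\<close>, the \<open>\<Lambda>V\<close>-linear maps \<open>\<Lambda>V \<otimes> \<Lambda>sV \<rightarrow> \<Lambda>V\<close> of degree \<open>n\<close>. Maps are set to zero outside of
  \<open>\<Lambda>V \<otimes> \<Lambda>sV\<close>, so that equality of elements of \<open>A\<close> is equality of functions.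
\<close>

definition homs ::
    "'v::linorder set \<Rightarrow> ('v \<Rightarrow> nat) \<Rightarrow> int \<Rightarrow> (('v, 'k::field_char_0) elt \<Rightarrow> ('v, 'k) elt) set"
  where "homs B deg n = {g.
    linear_map_on (LVsV B deg) g \<and>
    g ` LVsV B deg \<subseteq> LV B deg \<and>
    (\<forall>x. x \<notin> LVsV B deg \<longrightarrow> g x = 0) \<and>
    (\<forall>s. \<forall>x\<in>LVsV B deg. homog deg s x \<longrightarrow> homog deg (n + s) (g x)) \<and>
    (\<forall>k. \<forall>a\<in>LV B deg. \<forall>x\<in>LVsV B deg. homog deg k a \<longrightarrow>
        g (gmul deg a x) = smul (psgn (n * k)) (gmul deg a (g x)))}"

text \<open>\<open>D(g) = d \<circ> g + (-1)\<^sup>|\<^sup>g\<^sup>|\<^sup>+\<^sup>1 g \<circ> \<delta>\<close> for \<open>g\<close> of degree \<open>n\<close>\<close>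

definition hom_diff ::
    "'v::linorder set \<Rightarrow> ('v \<Rightarrow> nat) \<Rightarrow> (('v, 'k::field_char_0) elt \<Rightarrow> ('v, 'k) elt) \<Rightarrow>
     (('v, 'k) elt \<Rightarrow> ('v, 'k) elt) \<Rightarrow> int \<Rightarrow> (('v, 'k) elt \<Rightarrow> ('v, 'k) elt) \<Rightarrow>
     ('v, 'k) elt \<Rightarrow> ('v, 'k) elt"
  where "hom_diff B deg d \<delta> n g =
    (\<lambda>x. if x \<in> LVsV B deg then d (g x) + smul (psgn (n + 1)) (g (\<delta> x)) else 0)"

text \<open>
  \<open>g\<close> is a cocycle of degree \<open>n\<close> whose class generates (is a basis of) the one-dimensional space
  \<open>H(A, D) = Ext(\<K>, \<Lambda>V)\<close>.
\<close>

definition generating_class ::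
    "'v::linorder set \<Rightarrow> ('v \<Rightarrow> nat) \<Rightarrow> (('v, 'k::field_char_0) elt \<Rightarrow> ('v, 'k) elt) \<Rightarrow>
     (('v, 'k) elt \<Rightarrow> ('v, 'k) elt) \<Rightarrow> int \<Rightarrow> (('v, 'k) elt \<Rightarrow> ('v, 'k) elt) \<Rightarrow> bool"
  where "generating_class B deg d \<delta> n g \<longleftrightarrow>
    g \<in> homs B deg n \<and> hom_diff B deg d \<delta> n g = (\<lambda>_. 0) \<and>
    g \<notin> hom_diff B deg d \<delta> (n - 1) ` homs B deg (n - 1) \<and>
    (\<forall>k. \<forall>c\<in>homs B deg k. hom_diff B deg d \<delta> k c = (\<lambda>_. 0) \<longrightarrow>
       (\<exists>a. \<exists>b\<in>homs B deg (k - 1). c = (\<lambda>x. smul a (g x) + hom_diff B deg d \<delta> (k - 1) b x)))"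


section \<open>Bigradings and filtrations\<close>

text \<open>
  \<open>(\<Lambda>V)\<^sup>k\<^sup>,\<^sup>*\<close> and \<open>F\<^sup>k(\<Lambda>V) = (\<Lambda>V)\<^sup>\<ge>\<^sup>k\<^sup>,\<^sup>*\<close>: an element of \<open>(\<Lambda>Q \<otimes> \<Lambda>\<^sup>qP)\<^sup>n\<close> has first degree
  \<open>n + q\<close>.
\<close>

definition LV_bi :: "'v set \<Rightarrow> ('v \<Rightarrow> nat) \<Rightarrow> int \<Rightarrow> ('v, 'k::field_char_0) elt set" where
  "LV_bi B deg k = {x \<in> LV B deg. \<forall>m\<in>Poly_Mapping.keys x. int (mdeg deg m + plen deg m) = k}"

definition LV_fil :: "'v set \<Rightarrow> ('v \<Rightarrow> nat) \<Rightarrow> int \<Rightarrow> ('v, 'k::field_char_0) elt set" where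
  "LV_fil B deg k = {x \<in> LV B deg. \<forall>m\<in>Poly_Mapping.keys x. int (mdeg deg m + plen deg m) \<ge> k}"

definition LVsV_bi :: "'v set \<Rightarrow> ('v \<Rightarrow> nat) \<Rightarrow> nat \<Rightarrow> nat \<Rightarrow> ('v, 'k::field_char_0) elt set" where
  "LVsV_bi B deg r s = {x \<in> LVsV B deg. \<forall>m\<in>Poly_Mapping.keys x. rdeg deg m = r \<and> mdeg deg m = s}"

text \<open>\<open>F\<^sup>pA\<^sup>n\<close>, and the maps in \<open>A\<^sup>n\<close> that are homogeneous of first degree \<open>p\<close>\<close>

definition hom_fil ::
    "'v::linorder set \<Rightarrow> ('v \<Rightarrow> nat) \<Rightarrow> int \<Rightarrow> int \<Rightarrow> (('v, 'k::field_char_0) elt \<Rightarrow> ('v, 'k) elt) set"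
  where "hom_fil B deg p n =
    {g \<in> homs B deg n. \<forall>r s. g ` LVsV_bi B deg r s \<subseteq> LV_fil B deg (p + n + int s + int r)}"

definition hom_bi ::
    "'v::linorder set \<Rightarrow> ('v \<Rightarrow> nat) \<Rightarrow> int \<Rightarrow> int \<Rightarrow> (('v, 'k::field_char_0) elt \<Rightarrow> ('v, 'k) elt) set"
  where "hom_bi B deg p n =
    {g \<in> homs B deg n. \<forall>r s. g ` LVsV_bi B deg r s \<subseteq> LV_bi B deg (p + n + int s + int r)}"

text \<open>\<open>Ext\<^sup>p\<^sup>,\<^sup>n\<^sup>-\<^sup>p\<close> of a pure algebra is nonzero.\<close>

definition ext_nonzero_at ::
    "'v::linorder set \<Rightarrow> ('v \<Rightarrow> nat) \<Rightarrow> (('v, 'k::field_char_0) elt \<Rightarrow> ('v, 'k) elt) \<Rightarrow>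
     (('v, 'k) elt \<Rightarrow> ('v, 'k) elt) \<Rightarrow> int \<Rightarrow> int \<Rightarrow> bool"
  where "ext_nonzero_at B deg d \<delta> p n \<longleftrightarrow>
    (\<exists>g\<in>hom_bi B deg p n. hom_diff B deg d \<delta> n g = (\<lambda>_. 0) \<and>
        g \<notin> hom_diff B deg d \<delta> (n - 1) ` homs B deg (n - 1))"

text \<open>The component of \<open>g\<close> sending \<open>(\<Lambda>V \<otimes> \<Lambda>sV)\<^sup>r\<^sup>,\<^sup>s\<close> to \<open>(\<Lambda>V)\<^sup>k\<^sup>+\<^sup>s\<^sup>+\<^sup>r\<^sup>,\<^sup>*\<close>\<close>

definition LV_proj :: "('v \<Rightarrow> nat) \<Rightarrow> int \<Rightarrow> ('v, 'k::field_char_0) elt \<Rightarrow> ('v, 'k) elt" where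
  "LV_proj deg k y = (\<Sum>m | m \<in> Poly_Mapping.keys y \<and> int (mdeg deg m + plen deg m) = k.
                        Poly_Mapping.single m (Poly_Mapping.lookup y m))"

definition hom_comp ::
    "'v::linorder set \<Rightarrow> ('v \<Rightarrow> nat) \<Rightarrow> int \<Rightarrow> (('v, 'k::field_char_0) elt \<Rightarrow> ('v, 'k) elt) \<Rightarrow>
     ('v, 'k) elt \<Rightarrow> ('v, 'k) elt"
  where "hom_comp B deg k g =
    (\<lambda>x. if x \<in> LVsV B deg
         then \<Sum>m\<in>Poly_Mapping.keys x. LV_proj deg (k + int (mdeg deg m) + int (rdeg deg m))
                (g (Poly_Mapping.single m (Poly_Mapping.lookup x m)))
         else 0)"


section \<open>The construction\<close>

text \<open>
  One correction step, from \<open>g = f\<^sup>j\<close> to \<open>g' = f\<^sup>j\<^sup>+\<^sup>1 = f\<^sup>j - \<beta>\<^sub>j\<^sub>+\<^sub>1\<close> with \<open>D\<^sub>\<sigma>\<beta>\<^sub>j\<^sub>+\<^sub>1 = h\<close>. The correction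
  \<open>\<beta>\<^sub>j\<^sub>+\<^sub>1\<close> is chosen in \<open>F\<^sup>p\<^sup>+\<^sup>j\<^sup>+\<^sup>1A\<^sup>N\<close>, the filtration degree in which \<open>h\<close> lives: an unrestricted
  choice would be determined only up to multiples of \<open>f\<close> and could cancel the class of \<open>f\<close>.
\<close>

definition correction ::
    "'v::linorder set \<Rightarrow> ('v \<Rightarrow> nat) \<Rightarrow> (('v, 'k::field_char_0) elt \<Rightarrow> ('v, 'k) elt) \<Rightarrow>
     (('v, 'k) elt \<Rightarrow> ('v, 'k) elt) \<Rightarrow> int \<Rightarrow> int \<Rightarrow> nat \<Rightarrow> (('v, 'k) elt \<Rightarrow> ('v, 'k) elt) \<Rightarrow>
     (('v, 'k) elt \<Rightarrow> ('v, 'k) elt) \<Rightarrow> (('v, 'k) elt \<Rightarrow> ('v, 'k) elt) \<Rightarrow> bool"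
  where "correction B deg ds \<delta>s p N j h g g' \<longleftrightarrow>
    (\<exists>\<beta>\<in>hom_fil B deg (p + int j + 1) N.
        hom_diff B deg ds \<delta>s N \<beta> = h \<and> g' = (\<lambda>x. g x - \<beta> x))"

text \<open>
  \<open>fl\<close> is obtained from \<open>f\<close> by the correction procedure. Here \<open>h g j\<close> is the component of \<open>Dg\<close>
  sending \<open>(\<Lambda>V \<otimes> \<Lambda>sV)\<^sup>r\<^sup>,\<^sup>s\<close> to \<open>(\<Lambda>V)\<^sup>p\<^sup>+\<^sup>N\<^sup>+\<^sup>s\<^sup>+\<^sup>r\<^sup>+\<^sup>j\<^sup>+\<^sup>1\<^sup>,\<^sup>*\<close>, so \<open>h (F j) i\<close> is \<open>h\<^sub>i\<^sup>j\<close>. After the first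
  \<open>l\<close> corrections, where \<open>h\<^sub>l\<^sup>0\<close> is the last nonzero component of \<open>Df\<close>, further ones are made
  as long as the result is not a cocycle. The equation for such a later \<open>\<beta>\<^sub>j\<^sub>+\<^sub>1\<close> is
  \<open>D\<^sub>\<sigma>\<beta>\<^sub>j\<^sub>+\<^sub>1 = h\<^sub>j\<^sup>j\<close> or \<open>D\<^sub>\<sigma>\<beta>\<^sub>j\<^sub>+\<^sub>1 = Df\<^sup>j\<close>; the two coincide if \<open>Df\<^sup>j = h\<^sub>j\<^sup>j\<close>. A single one of these
  need not suffice, since \<open>(D - D\<^sub>\<sigma>)\<beta>\<^sub>j\<^sub>+\<^sub>1\<close> may have components beyond the \<open>l\<close>-th.
\<close>

definition constructed ::
    "'v::linorder set \<Rightarrow> ('v \<Rightarrow> nat) \<Rightarrow> (('v, 'k::field_char_0) elt \<Rightarrow> ('v, 'k) elt) \<Rightarrow>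
     (('v, 'k) elt \<Rightarrow> ('v, 'k) elt) \<Rightarrow> (('v, 'k) elt \<Rightarrow> ('v, 'k) elt) \<Rightarrow>
     (('v, 'k) elt \<Rightarrow> ('v, 'k) elt) \<Rightarrow> int \<Rightarrow> int \<Rightarrow>
     (('v, 'k) elt \<Rightarrow> ('v, 'k) elt) \<Rightarrow> (('v, 'k) elt \<Rightarrow> ('v, 'k) elt) \<Rightarrow> bool"
  where "constructed B deg d \<delta> ds \<delta>s p N f fl \<longleftrightarrow>
    (let D = hom_diff B deg d \<delta> N;
         h = (\<lambda>g j. hom_comp B deg (p + N + int j + 1) (D g));
         step = correction B deg ds \<delta>s p N
     in (D f = (\<lambda>_. 0) \<and> fl = f) \<or>
        (\<exists>l L F. D f = (\<lambda>x. \<Sum>i\<le>l. h f i x) \<and> h f l \<noteq> (\<lambda>_. 0) \<and>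
           l \<le> L \<and> F 0 = f \<and> F L = fl \<and>
           (\<forall>j<l. step j (h (F j) j) (F j) (F (Suc j))) \<and>
           (\<forall>j. l \<le> j \<and> j < L \<longrightarrow>
              D (F j) \<noteq> (\<lambda>_. 0) \<and>
              (step j (h (F j) j) (F j) (F (Suc j)) \<or> step j (D (F j)) (F j) (F (Suc j)))) \<and>
           D (F L) = (\<lambda>_. 0)))"

end

theory Submission
  imports Defs
begin

text \<open>
  The maps \<open>\<Lambda>V \<otimes> \<Lambda>sV \<rightarrow> \<Lambda>V\<close> are filtered by the amount by which they raise the total degree \<open>tau\<close>.
  As \<open>D - D\<^sub>\<sigma>\<close> raises the filtration, cocycles and primitives for \<open>D\<close> can be corrected one filtration
  degree at a time, using that \<open>H(D\<^sub>\<sigma>)\<close> vanishes outside the bidegree of \<open>f\<close>. In a fixed degree the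
  filtration is zero from some point on, but it is not exhaustive: the powers of \<open>sp\<close>, for \<open>p\<close>
  odd, are unbounded, so that a map can have components of arbitrarily low filtration degree and the
  induction has no start.

  The start is provided by the acyclicity of the quotient by a low filtration step. Contracting \<open>p\<close>
  in the values and multiplying the arguments by \<open>sp\<close>, summed over all odd \<open>p\<close>, gives an operator
  \<open>h\<close> for which \<open>Dh + hD\<close> is, up to terms of higher order for a second, complete filtration \<open>omega\<close>,
  diagonal on monomials. The eigenvalues are nonzero integers in low filtration degree, so \<open>Dh + hD\<close>
  is invertible there by a geometric series, in characteristic zero, although it is homotopic to zero.
\<close>

text \<open>The terms of \<delta> of lowest order for \<open>omega\<close> are sp \<mapsto> p, the
  differential of a Koszul complex. On maps it leaves classes only where every odd p divides the
  value and neither p nor sp, p odd, divides the argument; this is where the eigenvalue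
  \<open>int (card Podd) - (podd m - podd M)\<close> vanishes. In such an argument the factors sq, q
  even, are odd and number at most \<open>card B\<close>, so for a map of degree n the shift of
  \<open>tau\<close> lies between \<open>n - int (card B)\<close> and
  \<open>n + int (card B)\<close>. This is the origin of the threshold for invertibility. Above that
  band all maps vanish, so only finitely many filtration degrees remain to be treated one by one. As
  p and sp have equal \<open>tau\<close>, the operator h respects the filtration that is divided
  out, and a chain map Dh + hD invertible on the quotient kills its cohomology. A second filtration
  is unavoidable because Dh + hD has nondiagonal terms that do not change \<open>tau\<close>. The
  one by \<open>omega\<close> is bounded below in each degree and bounded above on each monomial, so
  that infinite sums make sense pointwise.\<close>

abbreviation keys :: "('a \<Rightarrow>\<^sub>0 'b::zero) \<Rightarrow> 'a set" where "keys \<equiv> Poly_Mapping.keys"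
abbreviation lookup :: "('a \<Rightarrow>\<^sub>0 'b::zero) \<Rightarrow> 'a \<Rightarrow> 'b" where "lookup \<equiv> Poly_Mapping.lookup"
abbreviation single :: "'a \<Rightarrow> 'b::zero \<Rightarrow> ('a \<Rightarrow>\<^sub>0 'b)" where "single \<equiv> Poly_Mapping.single"

declare One_nat_def [simp del]

section \<open>Linear algebra of finitely supported functions\<close>

lemma lookup_smul [simp]: "lookup (smul c x) m = c * lookup x m"
  by (cases "lookup x m = 0") (simp_all add: smul_def map.rep_eq)

interpretation smul: vector_space "smul :: 'k::field_char_0 \<Rightarrow> ('v, 'k) elt \<Rightarrow> ('v, 'k) elt"
  by unfold_locales (simp_all add: poly_mapping_eq_iff fun_eq_iff lookup_add algebra_simps)

lemma keys_smul: "keys (smul c x) \<subseteq> keys x"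
  by (auto simp: in_keys_iff)

lemma keys_smul_nonzero [simp]: "c \<noteq> 0 \<Longrightarrow> keys (smul c x) = keys x"
  by (auto simp: in_keys_iff)

lemma single_eq_smul: "single m c = smul c (mon_elt m)"
  by (simp add: poly_mapping_eq_iff fun_eq_iff mon_elt_def lookup_single when_def)

lemma lookup_mon_elt: "lookup (mon_elt m) m' = (if m = m' then 1 else 0)"
  by (simp add: mon_elt_def lookup_single when_def)

lemma keys_mon_elt [simp]: "keys (mon_elt m :: ('v, 'k::field_char_0) elt) = {m}"
  by (simp add: mon_elt_def)

lemma expand_superset:
  "finite S \<Longrightarrow> keys x \<subseteq> S \<Longrightarrow> x = (\<Sum>m\<in>S. smul (lookup x m) (mon_elt m))"
  by (rule poly_mapping_eqI) (auto simp: lookup_sum lookup_mon_elt sum.delta' in_keys_iff if_distrib cong: if_cong)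

lemma expand: "x = (\<Sum>m\<in>keys x. smul (lookup x m) (mon_elt m))"
  by (rule expand_superset) simp_all

definition lext :: "('v mon \<Rightarrow> ('v, 'k::field_char_0) elt) \<Rightarrow> ('v, 'k) elt \<Rightarrow> ('v, 'k) elt" where
  "lext F x = (\<Sum>m\<in>keys x. smul (lookup x m) (F m))"

lemma lext_superset:
  "finite S \<Longrightarrow> keys x \<subseteq> S \<Longrightarrow> lext F x = (\<Sum>m\<in>S. smul (lookup x m) (F m))"
  unfolding lext_def by (rule sum.mono_neutral_left) (auto simp: in_keys_iff)

lemma lext_add: "lext F (x + y) = lext F x + lext F y"
proof -
  have *: "keys (x + y) \<subseteq> keys x \<union> keys y" by (rule keys_add)
  show ?thesis
    using * by (simp add: lext_superset[of "keys x \<union> keys y"] lookup_add smul.scale_left_distrib sum.distrib)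
qed

lemma lext_smul: "lext F (smul c x) = smul c (lext F x)"
  by (simp add: lext_superset[of "keys x" "smul c x"] keys_smul lext_superset[of "keys x" x]
      smul.scale_sum_right)

lemma lext_mon_elt [simp]: "lext F (mon_elt m) = F m"
  by (simp add: lext_def lookup_mon_elt)

section \<open>Weights of monomials\<close>

lemma weight_superset:
  "finite S \<Longrightarrow> keys m \<subseteq> S \<Longrightarrow> weight w m = (\<Sum>g\<in>S. lookup m g * w g)"
  unfolding weight_def by (rule sum.mono_neutral_left) (auto simp: in_keys_iff)

lemma keys_add_nat: "keys (m + m' :: 'a \<Rightarrow>\<^sub>0 nat) = keys m \<union> keys m'"
  by (auto simp: in_keys_iff lookup_add)

lemma weight_add: "weight w (m + m') = weight w m + weight w m'"
  by (simp add: weight_superset[of "keys m \<union> keys m'"] keys_add_nat lookup_add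
      sum.distrib algebra_simps)

lemma weight_0 [simp]: "weight w 0 = 0"
  by (simp add: weight_def)

lemma weight_single [simp]: "weight w (single g k) = k * w g"
  by (simp add: weight_def)

lemma weight_mono: "(\<And>g. g \<in> keys m \<Longrightarrow> w g \<le> w' g) \<Longrightarrow> weight w m \<le> weight w' m"
  unfolding weight_def by (rule sum_mono) simp

lemma weight_cong: "(\<And>g. g \<in> keys m \<Longrightarrow> w g = w' g) \<Longrightarrow> weight w m = weight w' m"
  unfolding weight_def by (rule sum.cong) simp_all

lemma weight_fun_add: "weight (\<lambda>g. w g + w' g) m = weight w m + weight w' m"
  by (simp add: weight_def sum.distrib algebra_simps)

lemma weight_fun_mult: "weight (\<lambda>g. k * w g) m = k * weight w m"
  by (simp add: weight_def sum_distrib_left algebra_simps)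

lemma single_add_diff: "g \<in> keys m \<Longrightarrow> m = single g 1 + (m - single g (1::nat))"
  by (rule poly_mapping_eqI) (auto simp: lookup_add lookup_minus lookup_single when_def in_keys_iff)

lemma keys_diff_nat: "keys (m - m' :: 'a \<Rightarrow>\<^sub>0 nat) \<subseteq> keys m"
  by (auto simp: in_keys_iff lookup_minus)

lemma weight_diff_single: "g \<in> keys m \<Longrightarrow> weight w m = w g + weight w (m - single g 1)"
  by (subst single_add_diff[of g m]) (simp_all add: weight_add del: One_nat_def)

section \<open>The Koszul product\<close>

text \<open>Products of these signs over sets replace the count of inversions in
  \<open>koszul\<close>: splitting a set then splits the sign.\<close>

definition swap_sign :: "'v::linorder + 'v \<Rightarrow> 'v + 'v \<Rightarrow> 'k::field_char_0" where
  "swap_sign h g = (if gen_less h g then - 1 else 1)"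

lemma gen_less_irrefl [simp]: "\<not> gen_less g g"
  by (cases g) simp_all

lemma gen_less_total: "g \<noteq> h \<Longrightarrow> gen_less g h \<longleftrightarrow> \<not> gen_less h g"
  by (cases g; cases h) auto

lemma swap_sign_refl [simp]: "swap_sign g g = 1"
  by (simp add: swap_sign_def)

lemma swap_sign_sq [simp]: "swap_sign h g * swap_sign h g = 1"
  by (simp add: swap_sign_def)

lemma prod_swap_sign_sq: "(\<Prod>g\<in>A. swap_sign g p) * (\<Prod>g\<in>A. swap_sign g p) = (1::'k::field_char_0)"
  by (simp flip: prod.distrib)

lemma psgn_sq [simp]: "psgn a * psgn a = (1 :: 'k::field_char_0)"
  by (simp add: psgn_def)

lemma psgn_nonzero [simp]: "psgn a \<noteq> (0 :: 'k::field_char_0)"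
  by (simp add: psgn_def)

lemma psgn_even [simp]: "even a \<Longrightarrow> psgn a = 1"
  by (simp add: psgn_def)

lemma psgn_odd [simp]: "odd a \<Longrightarrow> psgn a = - 1"
  by (simp add: psgn_def)

lemma gmul_superset:
  assumes "finite S" "keys x \<subseteq> S" "finite T" "keys y \<subseteq> T"
  shows "gmul deg x y = (\<Sum>m\<in>S. \<Sum>m'\<in>T.
    smul (koszul deg m m' * lookup x m * lookup y m') (mon_elt (m + m')))"
proof -
  have "gmul deg x y = (\<Sum>m\<in>keys x. \<Sum>m'\<in>T.
      smul (koszul deg m m' * lookup x m * lookup y m') (mon_elt (m + m')))"
    unfolding gmul_def single_eq_smul
    by (intro sum.cong refl sum.mono_neutral_left assms) (auto simp: in_keys_iff)
  also have "\<dots> = (\<Sum>m\<in>S. \<Sum>m'\<in>T.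
      smul (koszul deg m m' * lookup x m * lookup y m') (mon_elt (m + m')))"
    by (intro sum.mono_neutral_left assms) (auto simp: in_keys_iff)
  finally show ?thesis .
qed

lemma gmul_add_left: "gmul deg (x + x') y = gmul deg x y + gmul deg x' y"
proof -
  have *: "keys (x + x') \<subseteq> keys x \<union> keys x'" by (rule keys_add)
  show ?thesis using *
    by (simp add: gmul_superset[of "keys x \<union> keys x'" _ "keys y"] lookup_add algebra_simps
        smul.scale_left_distrib sum.distrib)
qed

lemma gmul_add_right: "gmul deg x (y + y') = gmul deg x y + gmul deg x y'"
proof -
  have *: "keys (y + y') \<subseteq> keys y \<union> keys y'" by (rule keys_add)
  show ?thesis using *
    by (simp add: gmul_superset[of "keys x" _ "keys y \<union> keys y'"] lookup_add algebra_simps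
        smul.scale_left_distrib sum.distrib)
qed

lemma gmul_smul_left: "gmul deg (smul c x) y = smul c (gmul deg x y)"
  by (simp add: gmul_superset[of "keys x" _ "keys y"] keys_smul smul.scale_sum_right mult_ac)

lemma gmul_smul_right: "gmul deg x (smul c y) = smul c (gmul deg x y)"
  by (simp add: gmul_superset[of "keys x" _ "keys y"] keys_smul smul.scale_sum_right mult_ac)

lemma gmul_0_left [simp]: "gmul deg 0 y = 0"
  by (simp add: gmul_def)

lemma gmul_0_right [simp]: "gmul deg x 0 = 0"
  by (simp add: gmul_def)

lemma gmul_sum_left: "gmul deg (\<Sum>i\<in>I. f i) y = (\<Sum>i\<in>I. gmul deg (f i) y)"
  by (induct I rule: infinite_finite_induct) (simp_all add: gmul_add_left)

lemma gmul_sum_right: "gmul deg x (\<Sum>i\<in>I. f i) = (\<Sum>i\<in>I. gmul deg x (f i))"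
  by (induct I rule: infinite_finite_induct) (simp_all add: gmul_add_right)

lemma gmul_uminus_right: "gmul deg x (- y) = - gmul deg x y"
  using gmul_smul_right[of deg x "- 1" y] by simp

lemma gmul_diff_right: "gmul deg x (y - y') = gmul deg x y - gmul deg x y'"
  using gmul_add_right[of deg x y "- y'"] by (simp add: gmul_uminus_right)

lemma gmul_uminus_left: "gmul deg (- x) y = - gmul deg x y"
  using gmul_smul_left[of deg "- 1" x y] by simp

lemma gmul_diff_left: "gmul deg (x - x') y = gmul deg x y - gmul deg x' y"
  using gmul_add_left[of deg x "- x'" y] by (simp add: gmul_uminus_left)

lemma gmul_mon_elt:
  "gmul deg (mon_elt m) (mon_elt m') = smul (koszul deg m m') (mon_elt (m + m') :: ('v::linorder, 'k::field_char_0) elt)"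
  by (simp add: gmul_def single_eq_smul lookup_mon_elt)

lemma keys_gmul: "keys (gmul deg x y) \<subseteq> {m + m' |m m'. m \<in> keys x \<and> m' \<in> keys y \<and> koszul deg m m' \<noteq> (0::'k)}"
  for x y :: "('v::linorder, 'k::field_char_0) elt"
proof
  fix n assume "n \<in> keys (gmul deg x y)"
  then obtain m m' where "m \<in> keys x" "m' \<in> keys y"
      "n \<in> keys (single (m + m') (koszul deg m m' * lookup x m * lookup y m'))"
    unfolding gmul_def by (blast dest!: subsetD[OF keys_sum])
  then show "n \<in> {m + m' |m m'. m \<in> keys x \<and> m' \<in> keys y \<and> koszul deg m m' \<noteq> (0::'k)}"
    by (auto split: if_splits)
qed

lemma lookup_gmul_mon_elt:
  "lookup (gmul deg (mon_elt a) y) (a + m) = koszul deg a m * lookup y m"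
proof -
  have "lookup (gmul deg (mon_elt a) y) (a + m)
      = (\<Sum>m'\<in>keys y. if m' = m then koszul deg a m * lookup y m else 0)"
    by (simp add: gmul_def lookup_sum lookup_mon_elt lookup_single when_def)
  then show ?thesis by (auto simp: in_keys_iff)
qed

section \<open>Signs of products as products over odd generators\<close>

definition odd_keys :: "('v \<Rightarrow> nat) \<Rightarrow> 'v mon \<Rightarrow> ('v + 'v) set" where
  "odd_keys deg m = {g \<in> keys m. odd (gdeg deg g)}"

lemma finite_odd_keys [simp]: "finite (odd_keys deg m)"
  by (simp add: odd_keys_def)

lemma odd_keys_add: "odd_keys deg (m + m') = odd_keys deg m \<union> odd_keys deg m'"
  by (auto simp: odd_keys_def keys_add_nat)

definition reduced :: "('v \<Rightarrow> nat) \<Rightarrow> 'v mon \<Rightarrow> bool" where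
  "reduced deg m \<longleftrightarrow> (\<forall>g. odd (gdeg deg g) \<longrightarrow> lookup m g \<le> 1)"

text \<open>Odd exponents in reduced monomials are 0 or 1, so a repeated odd generator in the
  product is a common one. The inversions are counted row by row, which turns the sign into a double
  product.\<close>

lemma koszul_eq:
  assumes "reduced deg m" "reduced deg m'"
  shows "(koszul deg m m' :: 'k::field_char_0) = (if odd_keys deg m \<inter> odd_keys deg m' \<noteq> {} then 0
     else (\<Prod>g\<in>odd_keys deg m. \<Prod>h\<in>odd_keys deg m'. swap_sign h g))"
proof -
  have 1: "(\<exists>g. odd (gdeg deg g) \<and> lookup (m + m') g \<ge> 2) \<longleftrightarrow> odd_keys deg m \<inter> odd_keys deg m' \<noteq> {}"
  proof
    assume "\<exists>g. odd (gdeg deg g) \<and> lookup (m + m') g \<ge> 2"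
    then obtain g where g: "odd (gdeg deg g)" "lookup m g + lookup m' g \<ge> 2" by (auto simp: lookup_add)
    then have "lookup m g \<le> 1" "lookup m' g \<le> 1" using assms by (auto simp: reduced_def)
    then show "odd_keys deg m \<inter> odd_keys deg m' \<noteq> {}" using g
      by (intro ex_in_conv[THEN iffD1] exI[of _ g]) (auto simp: odd_keys_def in_keys_iff)
  next
    assume "odd_keys deg m \<inter> odd_keys deg m' \<noteq> {}"
    then obtain g where "odd (gdeg deg g)" "lookup m g \<noteq> 0" "lookup m' g \<noteq> 0"
      by (auto simp: odd_keys_def in_keys_iff)
    then show "\<exists>g. odd (gdeg deg g) \<and> lookup (m + m') g \<ge> 2"
      by (intro exI[of _ g]) (auto simp: lookup_add)
  qed
  let ?Z = "\<lambda>g. {h \<in> odd_keys deg m'. gen_less h g}"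
  have "{(g, h). g \<in> keys m \<and> h \<in> keys m' \<and> odd (gdeg deg g) \<and> odd (gdeg deg h) \<and> gen_less h g}
      = Sigma (odd_keys deg m) ?Z" by (auto simp: odd_keys_def)
  then have "(- 1 :: 'k) ^ card {(g, h). g \<in> keys m \<and> h \<in> keys m' \<and> odd (gdeg deg g) \<and> odd (gdeg deg h) \<and> gen_less h g}
     = (- 1) ^ (\<Sum>g\<in>odd_keys deg m. card (?Z g))" by (simp add: card_SigmaI)
  also have "\<dots> = (\<Prod>g\<in>odd_keys deg m. \<Prod>h\<in>odd_keys deg m'. swap_sign h g)"
  proof -
    have "(- 1 :: 'k) ^ card (?Z g) = (\<Prod>h\<in>odd_keys deg m'. swap_sign h g)" for g
      by (simp add: swap_sign_def prod.If_cases Int_def)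
    then show ?thesis by (simp add: power_sum)
  qed
  finally show ?thesis using 1 by (simp add: koszul_def)
qed

lemma swap_sign_nonzero [simp]: "swap_sign h g \<noteq> (0::'k::field_char_0)"
  by (simp add: swap_sign_def)

lemma koszul_nonzero_iff:
  "reduced deg m \<Longrightarrow> reduced deg m' \<Longrightarrow>
   (koszul deg m m' :: 'k::field_char_0) \<noteq> 0 \<longleftrightarrow> odd_keys deg m \<inter> odd_keys deg m' = {}"
  by (simp add: koszul_eq)

lemma reduced_add:
  assumes "reduced deg m" "reduced deg m'" "odd_keys deg m \<inter> odd_keys deg m' = {}"
  shows "reduced deg (m + m')"
  unfolding reduced_def
proof (intro allI impI)
  fix g assume g: "odd (gdeg deg g)"
  then have "lookup m g = 0 \<or> lookup m' g = 0" using assms(3) by (auto simp: odd_keys_def in_keys_iff)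
  then show "lookup (m + m') g \<le> 1" using assms g by (auto simp: reduced_def lookup_add)
qed

lemma reduced_0 [simp]: "reduced deg 0"
  by (simp add: reduced_def)

lemma odd_keys_0 [simp]: "odd_keys deg 0 = {}"
  by (simp add: odd_keys_def)

lemma koszul_0_left [simp]: "reduced deg m \<Longrightarrow> koszul deg 0 m = (1::'k::field_char_0)"
  by (simp add: koszul_eq)

lemma koszul_0_right [simp]: "reduced deg m \<Longrightarrow> koszul deg m 0 = (1::'k::field_char_0)"
  by (simp add: koszul_eq)

lemma reduced_diff: "reduced deg m \<Longrightarrow> reduced deg (m - m')"
  unfolding reduced_def lookup_minus by (meson diff_le_self le_trans)

lemma reduced_single: "reduced deg (single g 1)"
  by (simp add: reduced_def lookup_single when_def)

text \<open>Modulo 2 only odd generators contribute to the degree, each with exponent 1.\<close>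

lemma psgn_mdeg:
  assumes "reduced deg m"
  shows "psgn (int (mdeg deg m)) = (\<Prod>g\<in>odd_keys deg m. - 1 :: 'k::field_char_0)"
proof -
  have "even (\<Sum>g\<in>keys m. lookup m g * gdeg deg g) = even (card (odd_keys deg m))"
  proof -
    have "(\<Sum>g\<in>keys m. lookup m g * gdeg deg g) mod 2 = (\<Sum>g\<in>keys m. (lookup m g * gdeg deg g) mod 2) mod 2"
      by (simp add: mod_sum_eq)
    also have "(\<Sum>g\<in>keys m. (lookup m g * gdeg deg g) mod 2) = (\<Sum>g\<in>keys m. if odd (gdeg deg g) then 1 else 0)"
    proof (rule sum.cong[OF refl])
      fix g assume g: "g \<in> keys m"
      show "(lookup m g * gdeg deg g) mod 2 = (if odd (gdeg deg g) then 1 else 0)"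
      proof (cases "odd (gdeg deg g)")
        case True
        then have "lookup m g \<le> 1" using assms by (simp add: reduced_def)
        moreover have "lookup m g \<noteq> 0" using g by (simp add: in_keys_iff)
        ultimately have "lookup m g = 1" by linarith
        then show ?thesis using True by (simp add: odd_iff_mod_2_eq_one)
      qed simp
    qed
    also have "\<dots> = card (odd_keys deg m)"
      by (simp add: odd_keys_def sum.If_cases Int_def)
    finally show ?thesis by (simp add: even_iff_mod_2_eq_zero)
  qed
  then show ?thesis
    unfolding psgn_def mdeg_def weight_def even_of_nat by (auto simp: minus_one_power_iff)
qed

section \<open>Linear maps and derivations\<close>

locale gca =
  fixes B :: "'v::linorder set" and deg :: "'v \<Rightarrow> nat"
  assumes finite_B: "finite B" and deg_ge: "v \<in> B \<Longrightarrow> deg v \<ge> 2"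
begin

section \<open>Monomial bases of \<Lambda>V \<otimes> \<Lambda>sV, \<Lambda>V and
  \<Lambda>sV\<close>

definition mons :: "'v mon set" where
  "mons = {m. keys m \<subseteq> Inl ` B \<union> Inr ` B \<and> reduced deg m}"

definition vmons :: "'v mon set" where
  "vmons = {m \<in> mons. keys m \<subseteq> Inl ` B}"

definition smons :: "'v mon set" where
  "smons = {m \<in> mons. keys m \<subseteq> Inr ` B}"

abbreviation X :: "('v, 'k::field_char_0) elt set" where "X \<equiv> LVsV B deg"
abbreviation Y :: "('v, 'k::field_char_0) elt set" where "Y \<equiv> LV B deg"

lemma X_iff: "x \<in> X \<longleftrightarrow> keys x \<subseteq> mons"
  by (auto simp: LVsV_def mons_def reduced_def subset_iff)

lemma Y_iff: "x \<in> Y \<longleftrightarrow> keys x \<subseteq> vmons"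
  by (auto simp: LV_def X_iff vmons_def)

lemma vmons_mons: "m \<in> vmons \<Longrightarrow> m \<in> mons" by (simp add: vmons_def)
lemma smons_mons: "m \<in> smons \<Longrightarrow> m \<in> mons" by (simp add: smons_def)
lemma Y_X: "x \<in> Y \<Longrightarrow> x \<in> X" by (auto simp: X_iff Y_iff vmons_def)
lemma mon_elt_X [simp]: "mon_elt m \<in> X \<longleftrightarrow> m \<in> mons" by (simp add: X_iff)
lemma mon_elt_Y [simp]: "mon_elt m \<in> Y \<longleftrightarrow> m \<in> vmons" by (simp add: Y_iff)

lemma X_closed [simp, intro]:
  "0 \<in> X" "x \<in> X \<Longrightarrow> y \<in> X \<Longrightarrow> x + y \<in> X" "x \<in> X \<Longrightarrow> smul c x \<in> X"
  "x \<in> X \<Longrightarrow> - x \<in> X" "x \<in> X \<Longrightarrow> y \<in> X \<Longrightarrow> x - y \<in> X"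
  using keys_add[of x y] keys_smul[of c x] keys_diff[of x y] unfolding X_iff by (simp, blast+, simp, blast)

lemma Y_closed [simp, intro]:
  "0 \<in> Y" "x \<in> Y \<Longrightarrow> y \<in> Y \<Longrightarrow> x + y \<in> Y" "x \<in> Y \<Longrightarrow> smul c x \<in> Y"
  "x \<in> Y \<Longrightarrow> - x \<in> Y" "x \<in> Y \<Longrightarrow> y \<in> Y \<Longrightarrow> x - y \<in> Y"
  using keys_add[of x y] keys_smul[of c x] keys_diff[of x y] unfolding Y_iff by (simp, blast+, simp, blast)

lemma X_sum [intro]: "(\<And>i. i \<in> I \<Longrightarrow> f i \<in> X) \<Longrightarrow> sum f I \<in> X"
  by (induct I rule: infinite_finite_induct) auto

lemma Y_sum [intro]: "(\<And>i. i \<in> I \<Longrightarrow> f i \<in> Y) \<Longrightarrow> sum f I \<in> Y"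
  by (induct I rule: infinite_finite_induct) auto

lemma mons_0 [simp]: "0 \<in> mons" "0 \<in> vmons" "0 \<in> smons" by (simp_all add: mons_def vmons_def smons_def)

lemma mons_add:
  "m \<in> mons \<Longrightarrow> m' \<in> mons \<Longrightarrow> (koszul deg m m' :: 'k::field_char_0) \<noteq> 0 \<Longrightarrow> m + m' \<in> mons"
  by (auto simp: mons_def keys_add_nat koszul_nonzero_iff intro: reduced_add)

lemma mons_diff: "m \<in> mons \<Longrightarrow> m - m' \<in> mons"
  using keys_diff_nat[of m m'] by (auto simp: mons_def intro: reduced_diff)

lemma vmons_diff: "m \<in> vmons \<Longrightarrow> m - m' \<in> vmons"
  using keys_diff_nat[of m m'] by (auto simp: vmons_def intro: mons_diff)

lemma gmul_X [intro]: "x \<in> X \<Longrightarrow> y \<in> X \<Longrightarrow> gmul deg x y \<in> X"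
  for x y :: "('v, 'k::field_char_0) elt"
  using keys_gmul[of deg x y] mons_add[where 'k='k] by (fastforce simp: X_iff)

lemma single_mons: "g \<in> Inl ` B \<union> Inr ` B \<Longrightarrow> single g 1 \<in> mons"
  using reduced_single[of deg g] by (simp add: mons_def)

lemma vgen_Y: "v \<in> B \<Longrightarrow> vgen v \<in> Y"
  using single_mons[of "Inl v"] by (simp add: vgen_def vmons_def)

lemma sgen_X: "v \<in> B \<Longrightarrow> sgen v \<in> X"
  using single_mons[of "Inr v"] by (simp add: sgen_def)

lemma gmul_1_left: "x \<in> X \<Longrightarrow> gmul deg (mon_elt 0) x = x"
proof -
  assume x: "x \<in> X"
  have "gmul deg (mon_elt 0) x = (\<Sum>m\<in>keys x. smul (lookup x m) (gmul deg (mon_elt 0) (mon_elt m)))"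
    by (subst expand[of x]) (simp add: gmul_sum_right gmul_smul_right)
  also have "\<dots> = (\<Sum>m\<in>keys x. smul (lookup x m) (mon_elt m))"
    using x by (intro sum.cong refl) (auto simp: gmul_mon_elt X_iff mons_def)
  finally show ?thesis using expand[of x] by simp
qed

lemma gmul_1_right: "x \<in> X \<Longrightarrow> gmul deg x (mon_elt 0) = x"
proof -
  assume x: "x \<in> X"
  have "gmul deg x (mon_elt 0) = (\<Sum>m\<in>keys x. smul (lookup x m) (gmul deg (mon_elt m) (mon_elt 0)))"
    by (subst expand[of x]) (simp add: gmul_sum_left gmul_smul_left)
  also have "\<dots> = (\<Sum>m\<in>keys x. smul (lookup x m) (mon_elt m))"
    using x by (intro sum.cong refl) (auto simp: gmul_mon_elt X_iff mons_def)
  finally show ?thesis using expand[of x] by simp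
qed

lemma koszul_split:
  assumes "m \<in> mons" "g \<in> keys m"
  shows "(koszul deg (single g 1) (m - single g 1) :: 'k::field_char_0) \<noteq> 0"
proof (cases "odd (gdeg deg g)")
  case True
  then have "lookup m g \<le> 1" using assms by (auto simp: mons_def reduced_def)
  then have "g \<notin> keys (m - single g 1)" by (simp add: in_keys_iff lookup_minus)
  then show ?thesis using assms
    by (subst koszul_nonzero_iff) (auto simp: reduced_single mons_def intro: reduced_diff, auto simp: odd_keys_def)
next
  case False
  then show ?thesis using assms
    by (subst koszul_nonzero_iff) (auto simp: reduced_single mons_def intro: reduced_diff, auto simp: odd_keys_def)
qed

text \<open>Reordering the factors costs only a sign, so any generator can be split off in front.
  That the sign is nonzero is passed on because \<open>mon_elt_add\<close> needs it to write the
  monomial as a product. The type \<open>'k\<close> enters only through this sign.\<close>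

lemma mon_induct [consumes 1, case_names zero add]:
  assumes "m \<in> mons" "P 0"
    and "\<And>g m. g \<in> Inl ` B \<union> Inr ` B \<Longrightarrow> m \<in> mons \<Longrightarrow> single g 1 + m \<in> mons \<Longrightarrow>
           (koszul deg (single g 1) m :: 'k::field_char_0) \<noteq> 0 \<Longrightarrow> P m \<Longrightarrow> P (single g 1 + m)"
  shows "P m"
  using assms(1)
proof (induct "weight (\<lambda>_. 1) m" arbitrary: m rule: less_induct)
  case less
  show ?case
  proof (cases "keys m = {}")
    case True
    then show ?thesis using assms(2) by (simp add: keys_eq_empty)
  next
    case False
    then obtain g where g: "g \<in> keys m" by blast
    have "P (m - single g 1)"
      using less(2) weight_diff_single[OF g, of "\<lambda>_. 1"] by (intro less(1) mons_diff) simp_all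
    moreover have "g \<in> Inl ` B \<union> Inr ` B" using g less(2) by (auto simp: mons_def)
    ultimately have "P (single g 1 + (m - single g 1))"
      using less(2) koszul_split[OF less(2) g] by (intro assms(3) mons_diff) (simp_all add: single_add_diff[OF g, symmetric])
    then show ?thesis by (simp add: single_add_diff[OF g, symmetric])
  qed
qed

lemma mon_elt_add:
  "(koszul deg m m' :: 'k::field_char_0) \<noteq> 0 \<Longrightarrow>
   mon_elt (m + m') = smul (inverse (koszul deg m m')) (gmul deg (mon_elt m) (mon_elt m' :: ('v, 'k) elt))"
  by (simp add: gmul_mon_elt)

subsection \<open>Linear maps\<close>

lemma lin_add: "linear_map_on X T \<Longrightarrow> x \<in> X \<Longrightarrow> y \<in> X \<Longrightarrow> T (x + y) = T x + T y"
  by (simp add: linear_map_on_def)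

lemma lin_smul: "linear_map_on X T \<Longrightarrow> x \<in> X \<Longrightarrow> T (smul c x) = smul c (T x)"
  by (simp add: linear_map_on_def)

lemma lin_0: "linear_map_on X T \<Longrightarrow> T 0 = 0"
  using lin_smul[of T 0 0] by simp

lemma lin_uminus: "linear_map_on X T \<Longrightarrow> x \<in> X \<Longrightarrow> T (- x) = - T x"
  using lin_smul[of T x "- 1"] by simp

lemma lin_diff: "linear_map_on X T \<Longrightarrow> x \<in> X \<Longrightarrow> y \<in> X \<Longrightarrow> T (x - y) = T x - T y"
  using lin_add[of T x "- y"] by (simp add: lin_uminus)

lemma lin_sum: "linear_map_on X T \<Longrightarrow> (\<And>i. i \<in> I \<Longrightarrow> f i \<in> X) \<Longrightarrow> T (sum f I) = (\<Sum>i\<in>I. T (f i))"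
proof (induct I rule: infinite_finite_induct)
  case (insert i I)
  have "sum f I \<in> X" using insert by blast
  then show ?case using insert by (simp add: lin_add)
qed (simp_all add: lin_0)

lemma lin_expand:
  assumes "linear_map_on X T" "x \<in> X"
  shows "T x = (\<Sum>m\<in>keys x. smul (lookup x m) (T (mon_elt m)))"
proof -
  have *: "m \<in> mons" if "m \<in> keys x" for m using assms(2) that by (auto simp: X_iff)
  have "T x = T (\<Sum>m\<in>keys x. smul (lookup x m) (mon_elt m))" using expand[of x] by simp
  also have "\<dots> = (\<Sum>m\<in>keys x. smul (lookup x m) (T (mon_elt m)))"
    by (subst lin_sum[OF assms(1)]) (use * in \<open>simp_all add: lin_smul[OF assms(1)] cong: sum.cong\<close>)
  finally show ?thesis .
qed

lemma lin_eqI: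
  assumes "linear_map_on X T" "linear_map_on X U" "\<And>m. m \<in> mons \<Longrightarrow> T (mon_elt m) = U (mon_elt m)" "x \<in> X"
  shows "T x = U x"
  using assms(3,4) unfolding lin_expand[OF assms(1,4)] lin_expand[OF assms(2,4)]
  by (intro sum.cong refl) (auto simp: X_iff)

lemma lin_into:
  assumes "linear_map_on X T" "\<And>m. m \<in> mons \<Longrightarrow> T (mon_elt m) \<in> X" "x \<in> X"
  shows "T x \<in> X"
  unfolding lin_expand[OF assms(1,3)] using assms(2,3) by (auto simp: X_iff[of x])

lemma lin_into_Y:
  assumes "linear_map_on X T" "\<And>m. m \<in> mons \<Longrightarrow> T (mon_elt m) \<in> Y" "x \<in> X"
  shows "T x \<in> Y"
  unfolding lin_expand[OF assms(1,3)] using assms(2,3) by (auto simp: X_iff[of x])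

lemma lin_lext: "linear_map_on X (lext F)"
  by (simp add: linear_map_on_def lext_add lext_smul)

lemma lin_plus: "linear_map_on X T \<Longrightarrow> linear_map_on X U \<Longrightarrow> linear_map_on X (\<lambda>x. T x + U x)"
  by (simp add: linear_map_on_def smul.scale_right_distrib)

lemma lin_minus: "linear_map_on X T \<Longrightarrow> linear_map_on X U \<Longrightarrow> linear_map_on X (\<lambda>x. T x - U x)"
  by (simp add: linear_map_on_def smul.scale_right_diff_distrib)

lemma lin_scale: "linear_map_on X T \<Longrightarrow> linear_map_on X (\<lambda>x. smul c (T x))"
  by (simp add: linear_map_on_def smul.scale_right_distrib mult.commute)

lemma lin_comp:
  "linear_map_on X T \<Longrightarrow> linear_map_on X U \<Longrightarrow> (\<And>x. x \<in> X \<Longrightarrow> U x \<in> X) \<Longrightarrow> linear_map_on X (\<lambda>x. T (U x))"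
  by (simp add: linear_map_on_def)

lemma lin_gmul: "linear_map_on X (gmul deg a)"
  by (simp add: linear_map_on_def gmul_add_right gmul_smul_right)

subsection \<open>Shifts of a weight\<close>

text \<open>With \<open>J = {e}\<close> this says that T is homogeneous for W, with
  \<open>J = {w..}\<close> that it raises the filtration by w. One calculus of sets of shifts serves
  degrees, bigradings and both filtrations.\<close>

definition shifts :: "('v mon \<Rightarrow> int) \<Rightarrow> int set \<Rightarrow> (('v, 'k::field_char_0) elt \<Rightarrow> ('v, 'k) elt) \<Rightarrow> bool" where
  "shifts W J T \<longleftrightarrow> (\<forall>M\<in>mons. \<forall>m\<in>keys (T (mon_elt M)). W m - W M \<in> J)"

definition additive :: "('v mon \<Rightarrow> int) \<Rightarrow> bool" where
  "additive W \<longleftrightarrow> (\<forall>m m'. W (m + m') = W m + W m')"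

lemma additiveD: "additive W \<Longrightarrow> W (m + m') = W m + W m'"
  by (simp add: additive_def)

lemma additive_0: "additive W \<Longrightarrow> W 0 = 0"
  using additiveD[of W 0 0] by simp

lemma additive_weight: "additive (\<lambda>m. int (weight w m))"
  by (simp add: additive_def weight_add)

lemma shiftsD: "shifts W J T \<Longrightarrow> M \<in> mons \<Longrightarrow> m \<in> keys (T (mon_elt M)) \<Longrightarrow> W m - W M \<in> J"
  by (simp add: shifts_def)

lemma shifts_elt:
  assumes "shifts W J T" "linear_map_on X T" "x \<in> X" "m \<in> keys (T x)"
  shows "\<exists>M\<in>keys x. W m - W M \<in> J \<and> m \<in> keys (T (mon_elt M))"
proof -
  have "m \<in> keys (\<Sum>m\<in>keys x. smul (lookup x m) (T (mon_elt m)))"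
    using assms(4) lin_expand[OF assms(2,3)] by simp
  then obtain M where M: "M \<in> keys x" "m \<in> keys (smul (lookup x M) (T (mon_elt M)))"
    by (blast dest!: subsetD[OF keys_sum])
  then have "m \<in> keys (T (mon_elt M))" using keys_smul by blast
  then show ?thesis using M(1) shiftsD[OF assms(1)] assms(3) by (auto simp: X_iff)
qed

lemma shifts_mono: "shifts W J T \<Longrightarrow> J \<subseteq> J' \<Longrightarrow> shifts W J' T"
  by (auto simp: shifts_def)

lemma shifts_comp:
  assumes "shifts W J T" "shifts W K U" "linear_map_on X T" "\<And>x. x \<in> X \<Longrightarrow> U x \<in> X"
    and "\<And>j k. j \<in> J \<Longrightarrow> k \<in> K \<Longrightarrow> j + k \<in> L"
  shows "shifts W L (\<lambda>x. T (U x))"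
  unfolding shifts_def
proof (intro ballI)
  fix M m assume M: "M \<in> mons" "m \<in> keys (T (U (mon_elt M)))"
  then obtain m' where m': "m' \<in> keys (U (mon_elt M))" "W m - W m' \<in> J"
    using shifts_elt[OF assms(1,3) assms(4), of "mon_elt M" m] by auto
  have "W m' - W M \<in> K" using assms(2) M(1) m'(1) by (rule shiftsD)
  from assms(5)[OF m'(2) this] show "W m - W M \<in> L" by simp
qed

lemma shifts_plus: "shifts W J T \<Longrightarrow> shifts W J U \<Longrightarrow> shifts W J (\<lambda>x. T x + U x)"
  unfolding shifts_def by (auto dest!: subsetD[OF keys_add])

lemma shifts_minus: "shifts W J T \<Longrightarrow> shifts W J U \<Longrightarrow> shifts W J (\<lambda>x. T x - U x)"
  unfolding shifts_def by (auto dest!: subsetD[OF keys_diff])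

lemma shifts_scale: "shifts W J T \<Longrightarrow> shifts W J (\<lambda>x. smul c (T x))"
  unfolding shifts_def by (auto dest!: subsetD[OF keys_smul])

lemma shifts_zero: "shifts W J (\<lambda>x. 0)"
  by (simp add: shifts_def)

lemma shifts_Sum: "(\<And>i. i \<in> I \<Longrightarrow> shifts W J (T i)) \<Longrightarrow> shifts W J (\<lambda>x. \<Sum>i\<in>I. T i x)"
  by (induct I rule: infinite_finite_induct) (simp_all add: shifts_zero shifts_plus)

lemma shifts_gmul:
  assumes "additive W" "\<And>m. m \<in> keys a \<Longrightarrow> W m \<in> J"
  shows "shifts W J (gmul deg a)"
  unfolding shifts_def
proof (intro ballI)
  fix M m assume "M \<in> mons" "m \<in> keys (gmul deg a (mon_elt M))"
  then obtain m' where "m' \<in> keys a" "m = m' + M" using keys_gmul[of deg a "mon_elt M"] by auto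
  then show "W m - W M \<in> J" using assms by (simp add: additive_def)
qed

definition gweight :: "'v mon \<Rightarrow> int" where
  "gweight m = int (mdeg deg m)"

lemma additive_gweight: "additive gweight"
  unfolding gweight_def mdeg_def by (rule additive_weight)

lemma homog_iff: "homog deg n x \<longleftrightarrow> (\<forall>m\<in>keys x. gweight m = n)"
  by (simp add: homog_def gweight_def)

lemma homog_mon_elt [simp]: "homog deg n (mon_elt m) \<longleftrightarrow> gweight m = n"
  by (simp add: homog_iff)

lemma shifts_homog:
  assumes "shifts gweight {e} T" "linear_map_on X T" "x \<in> X" "homog deg n x"
  shows "homog deg (n + e) (T x)"
  unfolding homog_iff
proof
  fix m assume "m \<in> keys (T x)"
  from shifts_elt[OF assms(1-3) this] obtain M where "M \<in> keys x" "gweight m - gweight M = e" by blast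
  then show "gweight m = n + e" using assms(4) by (auto simp: homog_iff)
qed

lemma shifts_homogI:
  assumes "\<And>n x. x \<in> X \<Longrightarrow> homog deg n x \<Longrightarrow> homog deg (n + e) (T x)"
  shows "shifts gweight {e} T"
  unfolding shifts_def
proof (intro ballI)
  fix M m assume "M \<in> mons" "m \<in> keys (T (mon_elt M))"
  then show "gweight m - gweight M \<in> {e}"
    using assms[of "mon_elt M" "gweight M"] by (simp add: homog_iff)
qed

subsection \<open>Derivations\<close>

text \<open>Degrees are integers since contractions have negative degree. The Leibniz rule is
  imposed on monomials, which are homogeneous, and \<open>deriv_gmul\<close> extends it.\<close>

definition deriv :: "int \<Rightarrow> (('v, 'k::field_char_0) elt \<Rightarrow> ('v, 'k) elt) \<Rightarrow> bool" where
  "deriv k T \<longleftrightarrow> linear_map_on X T \<and> (\<forall>x\<in>X. T x \<in> X) \<and> shifts gweight {k} T \<and>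
     (\<forall>m\<in>mons. \<forall>m'\<in>mons. T (gmul deg (mon_elt m) (mon_elt m')) =
        gmul deg (T (mon_elt m)) (mon_elt m') +
        smul (psgn (k * gweight m)) (gmul deg (mon_elt m) (T (mon_elt m'))))"

lemma derivD:
  assumes "deriv k T"
  shows "linear_map_on X T" "\<And>x. x \<in> X \<Longrightarrow> T x \<in> X" "shifts gweight {k} T"
  using assms by (auto simp: deriv_def)

lemma deriv_homog: "deriv k T \<Longrightarrow> x \<in> X \<Longrightarrow> homog deg n x \<Longrightarrow> homog deg (n + k) (T x)"
  by (rule shifts_homog) (auto simp: deriv_def)

lemma deriv_gmul:
  assumes T: "deriv k T" and x: "x \<in> X" "homog deg n x" and y: "y \<in> X"
  shows "T (gmul deg x y) = gmul deg (T x) y + smul (psgn (k * n)) (gmul deg x (T y))"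
proof -
  note lin = derivD(1)[OF T]
  have mx: "m \<in> mons" "gweight m = n" if "m \<in> keys x" for m using x that by (auto simp: X_iff homog_iff)
  have my: "m \<in> mons" if "m \<in> keys y" for m using y that by (auto simp: X_iff)
  have A: "T (gmul deg (mon_elt m) y) = gmul deg (T (mon_elt m)) y
      + smul (psgn (k * n)) (gmul deg (mon_elt m) (T y))" if m: "m \<in> mons" "gweight m = n" for m
  proof -
    have "T (gmul deg (mon_elt m) y)
        = T (\<Sum>m'\<in>keys y. smul (lookup y m') (gmul deg (mon_elt m) (mon_elt m')))"
      by (subst expand[of y]) (simp add: gmul_sum_right gmul_smul_right)
    also have "\<dots> = (\<Sum>m'\<in>keys y. smul (lookup y m') (T (gmul deg (mon_elt m) (mon_elt m'))))"
      using m my by (subst lin_sum[OF lin]) (auto simp: gmul_X lin_smul[OF lin])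
    also have "\<dots> = (\<Sum>m'\<in>keys y. smul (lookup y m') (gmul deg (T (mon_elt m)) (mon_elt m'))
        + smul (psgn (k * n)) (smul (lookup y m') (gmul deg (mon_elt m) (T (mon_elt m')))))"
      using T m my by (intro sum.cong refl) (auto simp: deriv_def smul.scale_right_distrib mult.commute)
    also have "\<dots> = gmul deg (T (mon_elt m)) (\<Sum>m'\<in>keys y. smul (lookup y m') (mon_elt m'))
      + smul (psgn (k * n)) (gmul deg (mon_elt m) (\<Sum>m'\<in>keys y. smul (lookup y m') (T (mon_elt m'))))"
      by (simp only: sum.distrib gmul_sum_right gmul_smul_right smul.scale_sum_right)
    finally show ?thesis by (simp only: expand[symmetric] lin_expand[OF lin y, symmetric])
  qed
  have "T (gmul deg x y) = T (\<Sum>m\<in>keys x. smul (lookup x m) (gmul deg (mon_elt m) y))"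
    by (subst expand[of x]) (simp add: gmul_sum_left gmul_smul_left)
  also have "\<dots> = (\<Sum>m\<in>keys x. smul (lookup x m) (T (gmul deg (mon_elt m) y)))"
    using mx y by (subst lin_sum[OF lin]) (auto simp: gmul_X lin_smul[OF lin])
  also have "\<dots> = (\<Sum>m\<in>keys x. smul (lookup x m) (gmul deg (T (mon_elt m)) y)
      + smul (psgn (k * n)) (smul (lookup x m) (gmul deg (mon_elt m) (T y))))"
    using A mx by (intro sum.cong refl) (auto simp: smul.scale_right_distrib mult.commute)
  also have "\<dots> = gmul deg (\<Sum>m\<in>keys x. smul (lookup x m) (T (mon_elt m))) y
    + smul (psgn (k * n)) (gmul deg (\<Sum>m\<in>keys x. smul (lookup x m) (mon_elt m)) (T y))"
    by (simp only: sum.distrib gmul_sum_left gmul_smul_left smul.scale_sum_right)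
  finally show ?thesis by (simp only: expand[symmetric] lin_expand[OF lin x(1), symmetric])
qed

lemma deriv_1:
  assumes T: "deriv k T"
  shows "T (mon_elt 0) = 0"
proof -
  have "T (gmul deg (mon_elt 0) (mon_elt 0)) = gmul deg (T (mon_elt 0)) (mon_elt 0)
      + smul (psgn (k * 0)) (gmul deg (mon_elt 0) (T (mon_elt 0)))"
    by (rule deriv_gmul[OF T]) (simp_all add: additive_0[OF additive_gweight])
  then show ?thesis using derivD(2)[OF T, of "mon_elt 0"] by (simp add: gmul_1_left gmul_1_right)
qed

text \<open>Each term of the Leibniz rule changes one factor only, so an additive weight moves by as
  much as it does on a single generator.\<close>

lemma deriv_shifts:
  fixes T :: "('v, 'k::field_char_0) elt \<Rightarrow> ('v, 'k) elt"
  assumes T: "deriv k T" and W: "additive W"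
    and gen: "\<And>g m. g \<in> Inl ` B \<union> Inr ` B \<Longrightarrow> m \<in> keys (T (mon_elt (single g 1))) \<Longrightarrow> W m - W (single g 1) \<in> J"
  shows "shifts W J T"
  unfolding shifts_def
proof
  fix M assume "M \<in> mons"
  then show "\<forall>m\<in>keys (T (mon_elt M)). W m - W M \<in> J"
  proof (induct rule: mon_induct[where 'k='k])
    case zero
    then show ?case by (simp add: deriv_1[OF T])
  next
    case (add g M)
    let ?g = "mon_elt (single g 1) :: ('v, 'k) elt" and ?M = "mon_elt M :: ('v, 'k) elt"
    have g: "?g \<in> X" using add(1) single_mons by simp
    show ?case
    proof
      fix m assume "m \<in> keys (T (mon_elt (single g 1 + M)))"
      then have "m \<in> keys (T (gmul deg ?g ?M))"
        using add g keys_smul by (subst (asm) mon_elt_add) (auto simp: lin_smul[OF derivD(1)[OF T]] gmul_X simp del: One_nat_def)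
      then have "m \<in> keys (gmul deg (T ?g) ?M) \<or> m \<in> keys (gmul deg ?g (T ?M))"
        using deriv_gmul[OF T g, of "gweight (single g 1)" ?M] add(2) keys_add keys_smul by fastforce
      then show "W m - W (single g 1 + M) \<in> J"
      proof
        assume "m \<in> keys (gmul deg (T ?g) ?M)"
        then obtain m' where "m' \<in> keys (T ?g)" "m = m' + M" using keys_gmul by fastforce
        then show ?thesis using gen[OF add(1)] by (simp add: additiveD[OF W])
      next
        assume "m \<in> keys (gmul deg ?g (T ?M))"
        then obtain m' where "m' \<in> keys (T ?M)" "m = single g 1 + m'"
          using keys_gmul[of deg ?g "T ?M"] by auto
        then show ?thesis using add(5) by (simp add: additiveD[OF W])
      qed
    qed
  qed
qed

lemma deriv_minus:
  assumes "deriv k T" "deriv k U"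
  shows "deriv k (\<lambda>x. T x - U x)"
  using assms unfolding deriv_def
  by (auto intro: lin_minus shifts_minus simp: gmul_diff_left gmul_diff_right smul.scale_right_diff_distrib)

lemma differential_deriv:
  assumes "differential_on deg X T"
  shows "deriv 1 T"
  using assms unfolding deriv_def differential_on_def
  by (auto intro!: shifts_homogI )

text \<open>The mixed terms \<open>T x * U y\<close> and \<open>U x * T y\<close> cancel: the second
  odd derivation picks up an extra sign when it passes the odd image of x under the first.\<close>

lemma anticommutator_deriv:
  assumes T: "deriv j T" and U: "deriv k U" and odd: "odd j" "odd k"
  shows "deriv (j + k) (\<lambda>x. T (U x) + U (T x))"
proof -
  have [simp]: "T x \<in> X" "U x \<in> X" if "x \<in> X" for x
    using derivD(2)[OF T] derivD(2)[OF U] that by blast+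
  have ev: "even (j + k)" using odd by simp
  have "T (U (gmul deg (mon_elt m) (mon_elt m'))) + U (T (gmul deg (mon_elt m) (mon_elt m'))) =
      gmul deg (T (U (mon_elt m)) + U (T (mon_elt m))) (mon_elt m') +
      smul (psgn ((j + k) * gweight m)) (gmul deg (mon_elt m) (T (U (mon_elt m')) + U (T (mon_elt m'))))"
    if m: "m \<in> mons" "m' \<in> mons" for m m'
  proof -
    let ?x = "mon_elt m :: ('v, 'a) elt" and ?y = "mon_elt m' :: ('v, 'a) elt" and ?n = "gweight m"
    have X: "?x \<in> X" "?y \<in> X" using m by simp_all
    have h: "homog deg ?n ?x" "homog deg (?n + j) (T ?x)" "homog deg (?n + k) (U ?x)"
      using deriv_homog[OF T X(1)] deriv_homog[OF U X(1)] by auto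
    have s: "psgn (k * ?n) = (psgn ?n :: 'a)" "psgn (j * ?n) = (psgn ?n :: 'a)"
      "psgn (j * (?n + k)) = - (psgn ?n :: 'a)" "psgn (k * (?n + j)) = - (psgn ?n :: 'a)"
      "psgn ((j + k) * ?n) = (1::'a)"
      using odd by (auto simp: psgn_def)
    have "T (U (gmul deg ?x ?y)) = gmul deg (T (U ?x)) ?y - smul (psgn ?n) (gmul deg (U ?x) (T ?y))
       + smul (psgn ?n) (gmul deg (T ?x) (U ?y) + smul (psgn ?n) (gmul deg ?x (T (U ?y))))"
      using X
      by (simp add: deriv_gmul[OF U X(1) h(1)] lin_add[OF derivD(1)[OF T]] lin_smul[OF derivD(1)[OF T]]
          gmul_X deriv_gmul[OF T _ h(3)] deriv_gmul[OF T _ h(1)] s(1-4) del: smul.scale_scale)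
    moreover have "U (T (gmul deg ?x ?y)) = gmul deg (U (T ?x)) ?y - smul (psgn ?n) (gmul deg (T ?x) (U ?y))
       + smul (psgn ?n) (gmul deg (U ?x) (T ?y) + smul (psgn ?n) (gmul deg ?x (U (T ?y))))"
      using X
      by (simp add: deriv_gmul[OF T X(1) h(1)] lin_add[OF derivD(1)[OF U]] lin_smul[OF derivD(1)[OF U]]
          gmul_X deriv_gmul[OF U _ h(2)] deriv_gmul[OF U _ h(1)] s(1-4) del: smul.scale_scale)
    ultimately show ?thesis
      by (simp add: s(5) gmul_add_left gmul_add_right smul.scale_right_distrib)
  qed
  moreover have "shifts gweight {j + k} (\<lambda>x. T (U x) + U (T x))"
    by (intro shifts_plus shifts_comp[OF derivD(3)[OF T] derivD(3)[OF U] derivD(1)[OF T]]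
        shifts_comp[OF derivD(3)[OF U] derivD(3)[OF T] derivD(1)[OF U]]) simp_all
  moreover have "linear_map_on X (\<lambda>x. T (U x) + U (T x))"
    by (rule lin_plus[OF lin_comp[OF derivD(1)[OF T] derivD(1)[OF U]] lin_comp[OF derivD(1)[OF U] derivD(1)[OF T]]]) simp_all
  ultimately show ?thesis unfolding deriv_def by simp
qed

section \<open>The complex of linear maps\<close>

abbreviation A :: "int \<Rightarrow> (('v, 'k::field_char_0) elt \<Rightarrow> ('v, 'k) elt) set" where
  "A n \<equiv> homs B deg n"

lemma homsD:
  assumes "g \<in> A n"
  shows "linear_map_on X g" "\<And>x. g x \<in> Y" "\<And>x. g x \<in> X" "\<And>x. x \<notin> X \<Longrightarrow> g x = 0"
    "shifts gweight {n} g"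
    "\<And>k a x. a \<in> Y \<Longrightarrow> x \<in> X \<Longrightarrow> homog deg k a \<Longrightarrow>
        g (gmul deg a x) = smul (psgn (n * k)) (gmul deg a (g x))"
proof -
  show "linear_map_on X g" "\<And>x. x \<notin> X \<Longrightarrow> g x = 0" using assms by (simp_all add: homs_def)
  show Y: "g x \<in> Y" for x using assms by (cases "x \<in> X") (auto simp: homs_def)
  show "g x \<in> X" for x using Y by (rule Y_X)
  show "shifts gweight {n} g"
    using assms by (intro shifts_homogI) (auto simp: homs_def add.commute)
  show "g (gmul deg a x) = smul (psgn (n * k)) (gmul deg a (g x))"
    if "a \<in> Y" "x \<in> X" "homog deg k a" for k a x using assms that by (simp add: homs_def)
qed

lemma homsI:
  assumes lin: "linear_map_on X g" and out: "\<And>x. x \<notin> X \<Longrightarrow> g x = 0"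
    and Y: "\<And>M. M \<in> mons \<Longrightarrow> g (mon_elt M) \<in> Y" and deg: "shifts gweight {n} g"
    and gmul: "\<And>a M. a \<in> vmons \<Longrightarrow> M \<in> mons \<Longrightarrow>
      g (gmul deg (mon_elt a) (mon_elt M)) = smul (psgn (n * gweight a)) (gmul deg (mon_elt a) (g (mon_elt M)))"
  shows "g \<in> A n"
proof -
  have "g (gmul deg a x) = smul (psgn (n * k)) (gmul deg a (g x))"
    if a: "a \<in> Y" "homog deg k a" and x: "x \<in> X" for k a x
  proof -
    have ma: "m \<in> vmons" "m \<in> mons" "gweight m = k" if "m \<in> keys a" for m
      using a that by (auto simp: Y_iff homog_iff vmons_mons)
    have mx: "m \<in> mons" if "m \<in> keys x" for m using x that by (auto simp: X_iff)
    have *: "g (gmul deg (mon_elt m) x) = smul (psgn (n * k)) (gmul deg (mon_elt m) (g x))"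
      if m: "m \<in> keys a" for m
    proof -
      have "g (gmul deg (mon_elt m) x) = g (\<Sum>m'\<in>keys x. smul (lookup x m') (gmul deg (mon_elt m) (mon_elt m')))"
        by (subst expand[of x]) (simp add: gmul_sum_right gmul_smul_right)
      also have "\<dots> = (\<Sum>m'\<in>keys x. smul (lookup x m') (g (gmul deg (mon_elt m) (mon_elt m'))))"
        using ma[OF m] mx by (subst lin_sum[OF lin]) (auto simp: gmul_X lin_smul[OF lin])
      also have "\<dots> = (\<Sum>m'\<in>keys x. smul (psgn (n * k)) (smul (lookup x m') (gmul deg (mon_elt m) (g (mon_elt m')))))"
        using ma[OF m] mx by (intro sum.cong refl) (auto simp: gmul mult.commute)
      also have "\<dots> = smul (psgn (n * k)) (gmul deg (mon_elt m) (\<Sum>m'\<in>keys x. smul (lookup x m') (g (mon_elt m'))))"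
        by (simp only: gmul_sum_right gmul_smul_right smul.scale_sum_right)
      finally show ?thesis by (simp only: lin_expand[OF lin x, symmetric])
    qed
    have "g (gmul deg a x) = g (\<Sum>m\<in>keys a. smul (lookup a m) (gmul deg (mon_elt m) x))"
      by (subst expand[of a]) (simp add: gmul_sum_left gmul_smul_left)
    also have "\<dots> = (\<Sum>m\<in>keys a. smul (lookup a m) (g (gmul deg (mon_elt m) x)))"
      using ma x by (subst lin_sum[OF lin]) (auto simp: gmul_X lin_smul[OF lin])
    also have "\<dots> = (\<Sum>m\<in>keys a. smul (psgn (n * k)) (smul (lookup a m) (gmul deg (mon_elt m) (g x))))"
      using * by (intro sum.cong refl) (auto simp: mult.commute)
    also have "\<dots> = smul (psgn (n * k)) (gmul deg (\<Sum>m\<in>keys a. smul (lookup a m) (mon_elt m)) (g x))"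
      by (simp only: gmul_sum_left gmul_smul_left smul.scale_sum_right)
    finally show ?thesis by (simp only: expand[symmetric])
  qed
  moreover have "homog deg (n + s) (g x)" if "x \<in> X" "homog deg s x" for s x
    using shifts_homog[OF deg lin that] by (simp add: add.commute)
  moreover have "g x \<in> Y" if "x \<in> X" for x using lin_into_Y[OF lin Y that] .
  ultimately show ?thesis using lin out by (auto simp: homs_def)
qed

lemma homs_eqI:
  assumes "g \<in> A n" "h \<in> A n'" "\<And>M. M \<in> mons \<Longrightarrow> g (mon_elt M) = h (mon_elt M)"
  shows "g = h"
proof
  fix x show "g x = h x"
    using lin_eqI[OF homsD(1)[OF assms(1)] homsD(1)[OF assms(2)] assms(3)]
      homsD(4)[OF assms(1)] homsD(4)[OF assms(2)] by (cases "x \<in> X") auto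
qed

lemma homs_zero: "(\<lambda>x. 0) \<in> A n"
  by (simp add: homs_def linear_map_on_def homog_iff image_subset_iff)

lemma homs_add: "g \<in> A n \<Longrightarrow> h \<in> A n \<Longrightarrow> (\<lambda>x. g x + h x) \<in> A n"
  by (rule homsI)
    (simp_all add: homsD lin_plus shifts_plus smul.scale_right_distrib gmul_add_right vmons_mons)

lemma homs_smul: "g \<in> A n \<Longrightarrow> (\<lambda>x. smul c (g x)) \<in> A n"
  by (rule homsI)
    (simp_all add: homsD lin_scale shifts_scale gmul_smul_right vmons_mons mult.commute)

lemma homs_uminus: "g \<in> A n \<Longrightarrow> (\<lambda>x. - g x) \<in> A n"
  using homs_smul[of g n "- 1"] by simp

lemma homs_diff: "g \<in> A n \<Longrightarrow> h \<in> A n \<Longrightarrow> (\<lambda>x. g x - h x) \<in> A n"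
  using homs_add[OF _ homs_uminus, of g n h] by simp

lemma homs_sum: "(\<And>i. i \<in> I \<Longrightarrow> g i \<in> A n) \<Longrightarrow> (\<lambda>x. \<Sum>i\<in>I. g i x) \<in> A n"
  by (induct I rule: infinite_finite_induct) (simp_all add: homs_zero homs_add)

text \<open>For maps with values in \<open>\<Lambda>V\<close>, the differential of \<open>\<Lambda>V\<close> is the restriction of the one of
  \<open>\<Lambda>V \<otimes> \<Lambda>sV\<close>, so a single derivation \<open>T\<close> suffices; \<open>T\<close> may also be a contraction.\<close>

abbreviation D :: "(('v, 'k::field_char_0) elt \<Rightarrow> ('v, 'k) elt) \<Rightarrow> int \<Rightarrow> (('v, 'k) elt \<Rightarrow> ('v, 'k) elt) \<Rightarrow> ('v, 'k) elt \<Rightarrow> ('v, 'k) elt"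
  where "D T \<equiv> hom_diff B deg T T"

lemma D_apply: "x \<in> X \<Longrightarrow> D T n g x = T (g x) + smul (psgn (n + 1)) (g (T x))"
  by (simp add: hom_diff_def)

text \<open>The only obstruction to \<Lambda>V-linearity is the term \<open>T a * g x\<close>. It
  occurs once with sign \<open>psgn (n * k)\<close> and once with
  \<open>psgn (n + 1) * psgn (n * (k + e))\<close>, k being the degree of a; for e odd these are
  opposite.\<close>

lemma D_homs:
  assumes T: "deriv e T" and TY: "\<And>y. y \<in> Y \<Longrightarrow> T y \<in> Y" and odd: "odd e" and g: "g \<in> A n"
  shows "D T n g \<in> A (n + e)"
proof -
  note lT = derivD(1)[OF T] and XT = derivD(2)[OF T] and lg = homsD(1)[OF g]
  have lin: "linear_map_on X (D T n g)"
    using lin_plus[OF lin_comp[OF lT lg] lin_scale[OF lin_comp[OF lg lT]], of "psgn (n + 1)"] homsD(3)[OF g] XT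
    unfolding linear_map_on_def by (simp add: D_apply)
  show ?thesis
  proof (rule homsI)
    show "linear_map_on X (D T n g)" by (rule lin)
    show "D T n g x = 0" if "x \<notin> X" for x using that by (simp add: hom_diff_def)
    show "D T n g (mon_elt M) \<in> Y" if "M \<in> mons" for M
      using that homsD(2)[OF g] TY by (simp add: D_apply)
    have "shifts gweight {n + e} (\<lambda>x. T (g x) + smul (psgn (n + 1)) (g (T x)))"
      by (rule shifts_plus[OF shifts_comp[OF derivD(3)[OF T] homsD(5)[OF g] lT]
            shifts_scale[OF shifts_comp[OF homsD(5)[OF g] derivD(3)[OF T] lg]]])
        (simp_all add: homsD[OF g] XT)
    then show "shifts gweight {n + e} (D T n g)" by (simp add: shifts_def D_apply)
    show "D T n g (gmul deg (mon_elt a) (mon_elt M)) = smul (psgn ((n + e) * gweight a)) (gmul deg (mon_elt a) (D T n g (mon_elt M)))"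
      if a: "a \<in> vmons" and M: "M \<in> mons" for a M
    proof -
      let ?a = "mon_elt a :: ('v, 'a) elt" and ?M = "mon_elt M :: ('v, 'a) elt" and ?k = "gweight a"
      have aX: "?a \<in> X" "?a \<in> Y" "?M \<in> X" and h: "homog deg ?k ?a" using a M by (simp_all add: vmons_mons)
      have hT: "homog deg (?k + e) (T ?a)" by (rule deriv_homog[OF T aX(1) h])
      have s1: "psgn (e * ?k) = (psgn ?k :: 'a)" "psgn (n * (?k + e)) = (psgn (n * ?k) * psgn n :: 'a)"
        "psgn ((n + e) * ?k) = (psgn (n * ?k) * psgn ?k :: 'a)" "psgn (n + 1) = (- psgn n :: 'a)"
        using odd by (auto simp: psgn_def)
      have "T (g (gmul deg ?a ?M)) = smul (psgn (n * ?k)) (gmul deg (T ?a) (g ?M)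
          + smul (psgn ?k) (gmul deg ?a (T (g ?M))))"
        using aX by (simp add: homsD(6)[OF g aX(2,3) h] lin_smul[OF lT] gmul_X homsD[OF g] deriv_gmul[OF T aX(1) h] s1)
      moreover have "g (T (gmul deg ?a ?M)) = smul (psgn (n * ?k) * psgn n) (gmul deg (T ?a) (g ?M))
          + smul (psgn ?k) (smul (psgn (n * ?k)) (gmul deg ?a (g (T ?M))))"
        using aX by (simp add: deriv_gmul[OF T aX(1) h] lin_add[OF lg] lin_smul[OF lg] gmul_X XT
            homsD(6)[OF g _ _ h] homsD(6)[OF g _ _ hT] TY s1 del: smul.scale_scale)
      ultimately have "D T n g (gmul deg ?a ?M)
          = smul (psgn (n * ?k)) (gmul deg (T ?a) (g ?M)) - smul (psgn n * (psgn (n * ?k) * psgn n)) (gmul deg (T ?a) (g ?M))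
            + smul (psgn ((n + e) * ?k)) (gmul deg ?a (T (g ?M)) + smul (psgn (n + 1)) (gmul deg ?a (g (T ?M))))"
        using aX by (simp add: D_apply gmul_X smul.scale_right_distrib smul.scale_right_diff_distrib s1 mult_ac)
      moreover have "psgn n * (psgn (n * ?k) * psgn n) = (psgn (n * ?k) :: 'a)"
        using psgn_sq[of n, where 'k='a] by (simp add: mult.left_commute)
      ultimately show ?thesis using aX by (simp add: D_apply gmul_add_right gmul_smul_right)
    qed
  qed
qed

text \<open>Allows \<open>D (contr p) n\<close> to be applied to \<open>premult p g\<close>, whose
  true degree \<open>n + int (deg p) - 1\<close> differs from n by an even number for p odd.\<close>

lemma D_parity: "even (n - n') \<Longrightarrow> D T n = D T n'"
proof -
  assume "even (n - n')"
  then have "psgn (n + 1) = (psgn (n' + 1) :: 'a)" by (auto simp: psgn_def)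
  then show ?thesis by (simp add: hom_diff_def fun_eq_iff)
qed

lemma D_add:
  assumes T: "deriv e T" and "g \<in> A k" "h \<in> A k"
  shows "D T n (\<lambda>x. g x + h x) = (\<lambda>x. D T n g x + D T n h x)"
  using assms by (auto simp: hom_diff_def fun_eq_iff lin_add[OF derivD(1)[OF T]] homsD smul.scale_right_distrib)

lemma D_smul:
  assumes T: "deriv e T" and "g \<in> A k"
  shows "D T n (\<lambda>x. smul c (g x)) = (\<lambda>x. smul c (D T n g x))"
  using assms by (auto simp: hom_diff_def fun_eq_iff lin_smul[OF derivD(1)[OF T]] homsD smul.scale_right_distrib mult.commute)

lemma D_zero: "deriv e T \<Longrightarrow> D T n (\<lambda>x. 0) = (\<lambda>x. 0)"
  by (auto simp: hom_diff_def fun_eq_iff lin_0[OF derivD(1)])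

lemma D_uminus:
  assumes T: "deriv e T" and "g \<in> A k"
  shows "D T n (\<lambda>x. - g x) = (\<lambda>x. - D T n g x)"
  using D_smul[OF assms, of n "- 1"] by simp

lemma D_diff:
  assumes T: "deriv e T" and g: "g \<in> A k" and h: "h \<in> A k"
  shows "D T n (\<lambda>x. g x - h x) = (\<lambda>x. D T n g x - D T n h x)"
  using D_add[OF T g homs_uminus[OF h], of n] by (simp add: D_uminus[OF T h])

lemma D_D:
  assumes T: "deriv e T" and TT: "\<And>x. x \<in> X \<Longrightarrow> T (T x) = 0" and g: "g \<in> A n"
  shows "D T (n + 1) (D T n g) = (\<lambda>x. 0)"
proof
  fix x :: "('v, 'a) elt"
  have "psgn (n + 1 + 1) = (- psgn (n + 1) :: 'a)" by (auto simp: psgn_def)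
  then show "D T (n + 1) (D T n g) x = 0"
    using TT derivD(2)[OF T] homsD[OF g]
    by (simp add: hom_diff_def lin_add[OF derivD(1)[OF T]] lin_smul[OF derivD(1)[OF T]] lin_0[OF homsD(1)[OF g]])
qed

lemma D_shifts:
  assumes T: "deriv e T" "shifts W J T" and g: "g \<in> A k" "shifts W K g"
    and L: "\<And>j k. j \<in> J \<Longrightarrow> k \<in> K \<Longrightarrow> j + k \<in> L"
  shows "shifts W L (D T n g)"
proof -
  have L': "k + j \<in> L" if "k \<in> K" "j \<in> J" for j k using L[OF that(2,1)] by (simp add: add.commute)
  have "shifts W L (\<lambda>x. T (g x) + smul (psgn (n + 1)) (g (T x)))"
    by (rule shifts_plus[OF shifts_comp[OF T(2) g(2) derivD(1)[OF T(1)]]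
          shifts_scale[OF shifts_comp[OF g(2) T(2) homsD(1)[OF g(1)]]]])
      (use homsD(3)[OF g(1)] derivD(2)[OF T(1)] L L' in auto)
  then show ?thesis by (simp add: shifts_def D_apply)
qed

subsection \<open>Rescaling by a weight\<close>

definition scale :: "('v mon \<Rightarrow> 'k) \<Rightarrow> ('v, 'k::field_char_0) elt \<Rightarrow> ('v, 'k) elt" where
  "scale \<psi> y = Poly_Mapping.mapp (\<lambda>m c. \<psi> m * c) y"

lemma lookup_scale [simp]: "lookup (scale \<psi> y) m = \<psi> m * lookup y m"
  by (simp add: scale_def lookup_mapp when_def in_keys_iff)

lemma keys_scale: "keys (scale \<psi> y) \<subseteq> keys y"
  by (auto simp: in_keys_iff)

lemma scale_smul: "scale \<psi> (smul c y) = smul c (scale \<psi> y)"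
  by (rule poly_mapping_eqI) (simp add: mult_ac)

lemma scale_gmul:
  assumes "\<And>m. \<psi>' (a + m) = \<psi> m"
  shows "scale \<psi>' (gmul deg (mon_elt a) y) = gmul deg (mon_elt a) (scale \<psi> y)"
proof (rule poly_mapping_eqI)
  fix n
  show "lookup (scale \<psi>' (gmul deg (mon_elt a) y)) n = lookup (gmul deg (mon_elt a) (scale \<psi> y)) n"
  proof (cases "\<exists>m. n = a + m")
    case True
    then show ?thesis using assms by (auto simp: lookup_gmul_mon_elt)
  next
    case False
    then have "n \<notin> keys (gmul deg (mon_elt a) y)" "n \<notin> keys (gmul deg (mon_elt a) (scale \<psi> y))"
      using keys_gmul[of deg "mon_elt a" y] keys_gmul[of deg "mon_elt a" "scale \<psi> y"] by auto
    then show ?thesis by (simp add: in_keys_iff)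
  qed
qed

text \<open>The factor depends only on \<open>W m - W M\<close>, which does not change if \<open>m\<close> and \<open>M\<close> are multiplied by
  the same monomial; this is why rescaling preserves \<open>\<Lambda>V\<close>-linearity.\<close>

definition rescale :: "('v mon \<Rightarrow> int) \<Rightarrow> (int \<Rightarrow> 'k) \<Rightarrow> (('v, 'k::field_char_0) elt \<Rightarrow> ('v, 'k) elt) \<Rightarrow> ('v, 'k) elt \<Rightarrow> ('v, 'k) elt"
  where "rescale W \<phi> g x = (if x \<in> X then lext (\<lambda>M. scale (\<lambda>m. \<phi> (W m - W M)) (g (mon_elt M))) x else 0)"

lemma rescale_mon: "M \<in> mons \<Longrightarrow> rescale W \<phi> g (mon_elt M) = scale (\<lambda>m. \<phi> (W m - W M)) (g (mon_elt M))"
  by (simp add: rescale_def)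

lemma rescale_lin: "linear_map_on X (rescale W \<phi> g)"
  using lin_lext[of "\<lambda>M. scale (\<lambda>m. \<phi> (W m - W M)) (g (mon_elt M))"]
  unfolding linear_map_on_def by (simp add: rescale_def)

lemma rescale_shifts: "shifts V J g \<Longrightarrow> shifts V J (rescale W \<phi> g)"
  unfolding shifts_def using keys_scale by (fastforce simp: rescale_mon)

lemma rescale_shifts_supp:
  assumes "\<And>z. z \<notin> J \<Longrightarrow> \<phi> z = 0"
  shows "shifts W J (rescale W \<phi> g)"
  unfolding shifts_def using assms by (force simp: rescale_mon in_keys_iff)

lemma rescale_homs:
  assumes W: "additive W" and g: "g \<in> A n"
  shows "rescale W \<phi> g \<in> A n"
proof (rule homsI[OF rescale_lin])
  show "rescale W \<phi> g x = 0" if "x \<notin> X" for x using that by (simp add: rescale_def)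
  show "rescale W \<phi> g (mon_elt M) \<in> Y" if "M \<in> mons" for M
    using that homsD(2)[OF g, of "mon_elt M"] keys_scale by (force simp: rescale_mon Y_iff)
  show "shifts gweight {n} (rescale W \<phi> g)" by (rule rescale_shifts[OF homsD(5)[OF g]])
  fix a M assume a: "a \<in> vmons" and M: "M \<in> mons"
  let ?a = "mon_elt a :: ('v, 'a) elt" and ?M = "mon_elt M :: ('v, 'a) elt"
    and ?s = "psgn (n * gweight a) :: 'a" and ?c = "koszul deg a M :: 'a"
    and ?\<psi>' = "\<lambda>m. \<phi> (W m - W (a + M))"
  have aM: "?c \<noteq> 0 \<Longrightarrow> a + M \<in> mons" using a M vmons_mons mons_add[where 'k='a] by blast
  have "smul ?s (gmul deg ?a (rescale W \<phi> g ?M)) = smul ?s (scale ?\<psi>' (gmul deg ?a (g ?M)))"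
    using M by (simp add: rescale_mon scale_gmul[where \<psi> = "\<lambda>m. \<phi> (W m - W M)"] additiveD[OF W])
  also have "\<dots> = scale ?\<psi>' (g (gmul deg ?a ?M))"
    using a M by (simp add: homsD(6)[OF g] scale_smul)
  also have "\<dots> = rescale W \<phi> g (gmul deg ?a ?M)"
  proof (cases "?c = 0")
    case True
    have "scale ?\<psi>' 0 = 0" by (rule poly_mapping_eqI) simp
    then show ?thesis using True by (simp add: gmul_mon_elt lin_0[OF homsD(1)[OF g]] lin_0[OF rescale_lin])
  next
    case False
    then show ?thesis using aM
      by (simp add: gmul_mon_elt lin_smul[OF homsD(1)[OF g]] lin_smul[OF rescale_lin] scale_smul rescale_mon)
  qed
  finally show "rescale W \<phi> g (gmul deg ?a ?M) = smul ?s (gmul deg ?a (rescale W \<phi> g ?M))" ..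
qed

lemma rescale_eqI:
  assumes "g \<in> A n" "additive W" "shifts W J g" "\<And>z. z \<in> J \<Longrightarrow> \<phi> z = \<psi> z"
  shows "rescale W \<phi> g = rescale W \<psi> g"
proof (rule homs_eqI[OF rescale_homs[OF assms(2,1)] rescale_homs[OF assms(2,1)]])
  fix M assume M: "M \<in> mons"
  have "\<phi> (W m - W M) * lookup (g (mon_elt M)) m = \<psi> (W m - W M) * lookup (g (mon_elt M)) m" for m
    using shiftsD[OF assms(3) M, of m] assms(4)
    by (cases "m \<in> keys (g (mon_elt M))") (auto simp: in_keys_iff)
  then show "rescale W \<phi> g (mon_elt M) = rescale W \<psi> g (mon_elt M)"
    using M by (intro poly_mapping_eqI) (simp add: rescale_mon)
qed

lemma rescale_1:
  assumes "g \<in> A n" "additive W"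
  shows "rescale W (\<lambda>z. 1) g = g"
  by (rule homs_eqI[OF rescale_homs[OF assms(2,1)] assms(1)])
    (auto intro: poly_mapping_eqI simp: rescale_mon)

lemma rescale_0:
  assumes "g \<in> A n" "additive W"
  shows "rescale W (\<lambda>z. 0) g = (\<lambda>x. 0)"
  by (rule homs_eqI[OF rescale_homs[OF assms(2,1)] homs_zero])
    (auto intro: poly_mapping_eqI simp: rescale_mon)

lemma rescale_rescale:
  assumes "g \<in> A n" "additive W"
  shows "rescale W \<phi> (rescale W \<psi> g) = rescale W (\<lambda>z. \<phi> z * \<psi> z) g"
  by (rule homs_eqI[OF rescale_homs[OF assms(2) rescale_homs[OF assms(2,1)]] rescale_homs[OF assms(2,1)]])
    (auto intro: poly_mapping_eqI simp: rescale_mon mult.assoc)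

lemma rescale_add:
  assumes "g \<in> A n" "h \<in> A n" "additive W"
  shows "rescale W \<phi> (\<lambda>x. g x + h x) = (\<lambda>x. rescale W \<phi> g x + rescale W \<phi> h x)"
  by (rule homs_eqI[OF rescale_homs[OF assms(3) homs_add[OF assms(1,2)]]
        homs_add[OF rescale_homs[OF assms(3,1)] rescale_homs[OF assms(3,2)]]])
    (auto intro: poly_mapping_eqI simp: rescale_mon lookup_add algebra_simps)

lemma rescale_smul:
  assumes "g \<in> A n" "additive W"
  shows "rescale W \<phi> (\<lambda>x. smul c (g x)) = (\<lambda>x. smul c (rescale W \<phi> g x))"
  by (rule homs_eqI[OF rescale_homs[OF assms(2) homs_smul[OF assms(1)]]
        homs_smul[OF rescale_homs[OF assms(2,1)]]])
    (auto intro: poly_mapping_eqI simp: rescale_mon algebra_simps)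

abbreviation part :: "('v mon \<Rightarrow> int) \<Rightarrow> int set \<Rightarrow> (('v, 'k::field_char_0) elt \<Rightarrow> ('v, 'k) elt) \<Rightarrow> ('v, 'k) elt \<Rightarrow> ('v, 'k) elt"
  where "part W J \<equiv> rescale W (\<lambda>z. if z \<in> J then 1 else 0)"

lemma part_shifts: "shifts W J (part W J g)"
  by (rule rescale_shifts_supp) simp

lemma part_id:
  assumes "g \<in> A n" "additive W" "shifts W J g"
  shows "part W J g = g"
  using rescale_eqI[OF assms, of "\<lambda>z. if z \<in> J then 1 else 0" "\<lambda>z. 1"] rescale_1[OF assms(1,2)] by simp

lemma part_disjoint:
  assumes "g \<in> A n" "additive W" "shifts W K g" "J \<inter> K = {}"
  shows "part W J g = (\<lambda>x. 0)"
proof -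
  have "rescale W (\<lambda>z. if z \<in> J then 1 else 0) g = rescale W (\<lambda>z. 0) g"
    using assms(4) by (intro rescale_eqI[OF assms(1-3)]) auto
  then show ?thesis using rescale_0[OF assms(1,2)] by simp
qed

lemma part_Un_disjoint:
  assumes "g \<in> A n" "additive W" "J \<inter> K = {}"
  shows "part W (J \<union> K) g = (\<lambda>x. part W J g x + part W K g x)"
  by (rule homs_eqI[OF rescale_homs[OF assms(2,1)] homs_add[OF rescale_homs[OF assms(2,1)] rescale_homs[OF assms(2,1)]]])
    (use assms(3) in \<open>auto intro!: poly_mapping_eqI simp: rescale_mon lookup_add\<close>)

lemma part_split:
  assumes "g \<in> A n" "additive W" "shifts W (J \<union> K) g" "J \<inter> K = {}"
  shows "g = (\<lambda>x. part W J g x + part W K g x)"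
  using part_id[OF assms(1-3)] part_Un_disjoint[OF assms(1,2,4)] by simp

lemma shifts_by_part:
  assumes "g \<in> A n" "additive W" "part W (- J) g = (\<lambda>x. 0)"
  shows "shifts W J g"
  unfolding shifts_def
proof (intro ballI)
  fix M m assume M: "M \<in> mons" "m \<in> keys (g (mon_elt M))"
  have "lookup (part W (- J) g (mon_elt M)) m = 0" using assms(3) by simp
  then show "W m - W M \<in> J" using M by (auto simp: rescale_mon in_keys_iff split: if_splits)
qed

text \<open>If T preserves W then D respects the decomposition of a map by shifts of W, as for a
  differential of bidegree type.\<close>

lemma part_D:
  assumes T: "deriv e T" "shifts W {0} T" "\<And>y. y \<in> Y \<Longrightarrow> T y \<in> Y" "odd e"
    and W: "additive W" and g: "g \<in> A n"
  shows "part W J (D T n g) = D T n (part W J g)"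
proof -
  note A = rescale_homs[OF W g]
  have "D T n g = (\<lambda>x. D T n (part W J g) x + D T n (part W (- J) g) x)"
    unfolding D_add[OF T(1) A A, of n, symmetric]
    by (rule arg_cong[of _ _ "D T n"], rule part_split[OF g W, of J "- J"]) (simp_all add: shifts_def)
  then have "part W J (D T n g) = (\<lambda>x. part W J (D T n (part W J g)) x + part W J (D T n (part W (- J) g)) x)"
    by (simp add: rescale_add[OF D_homs[OF T(1,3,4) A] D_homs[OF T(1,3,4) A] W])
  moreover have "part W J (D T n (part W J g)) = D T n (part W J g)"
    by (rule part_id[OF D_homs[OF T(1,3,4) A] W D_shifts[OF T(1,2) A part_shifts]]) auto
  moreover have "part W J (D T n (part W (- J) g)) = (\<lambda>x. 0)"
    by (rule part_disjoint[OF D_homs[OF T(1,3,4) A] W D_shifts[OF T(1,2) A part_shifts], of _ "- J"]) auto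
  ultimately show ?thesis by simp
qed

subsection \<open>Reduction to the suspended generators and infinite sums\<close>

text \<open>A factor from V can be pulled out of the argument and multiplies the value as well, so
  it leaves the difference of weights unchanged. What remains is an argument in \<Lambda>sV, where
  estimates such as \<open>omega_smons\<close> hold.\<close>

lemma homs_shiftsI:
  assumes g: "g \<in> A n" and W: "additive W"
    and s: "\<And>M m. M \<in> smons \<Longrightarrow> m \<in> keys (g (mon_elt M)) \<Longrightarrow> W m - W M \<in> J"
  shows "shifts W J g"
  unfolding shifts_def
proof
  fix M assume "M \<in> mons"
  then show "\<forall>m\<in>keys (g (mon_elt M)). W m - W M \<in> J"
  proof (induct "weight (\<lambda>_. 1) M" arbitrary: M rule: less_induct)
    case less
    show ?case
    proof (cases "keys M \<subseteq> Inr ` B")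
      case True
      then show ?thesis using s less(2) by (simp add: smons_def)
    next
      case False
      then obtain h where h: "h \<in> keys M" "h \<notin> Inr ` B" by blast
      then have hB: "h \<in> Inl ` B" using less(2) by (auto simp: mons_def)
      let ?M = "M - single h 1" and ?a = "mon_elt (single h 1) :: ('v, 'a) elt"
      have IH: "\<forall>m\<in>keys (g (mon_elt ?M)). W m - W ?M \<in> J"
        using less(2) weight_diff_single[OF h(1), of "\<lambda>_. 1"] by (intro less(1) mons_diff) simp_all
      have a: "single h 1 \<in> vmons" using hB single_mons[of h] by (auto simp: vmons_def)
      have M: "?M \<in> mons" using less(2) by (rule mons_diff)
      have c: "(koszul deg (single h 1) ?M :: 'a) \<noteq> 0" by (rule koszul_split[OF less(2) h(1)])
      have eq: "M = single h 1 + ?M" by (rule single_add_diff[OF h(1)])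
      have "keys (g (mon_elt (single h 1 + ?M))) = keys (g (gmul deg ?a (mon_elt ?M)))"
        using c a M by (subst mon_elt_add[OF c]) (simp add: lin_smul[OF homsD(1)[OF g]] gmul_X vmons_mons)
      also have "\<dots> = keys (gmul deg ?a (g (mon_elt ?M)))"
        using a M by (simp add: homsD(6)[OF g])
      finally have k: "keys (g (mon_elt M)) = keys (gmul deg ?a (g (mon_elt ?M)))" using eq by simp
      show ?thesis
      proof
        fix m assume "m \<in> keys (g (mon_elt M))"
        then obtain m' where m': "m' \<in> keys (g (mon_elt ?M))" "m = single h 1 + m'"
          using k keys_gmul[of deg ?a "g (mon_elt ?M)"] by auto
        have "W M = W (single h 1) + W ?M" using eq additiveD[OF W] by metis
        then show "W m - W M \<in> J" using m' IH by (simp add: additiveD[OF W])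
      qed
    qed
  qed
qed

text \<open>The sum is finite on each monomial, although no finite stage need be valid on all of
  them.\<close>

lemma homs_infinite_sum:
  fixes e :: "nat \<Rightarrow> ('v, 'k::field_char_0) elt \<Rightarrow> ('v, 'k) elt"
  assumes e: "\<And>k. e k \<in> A n" and fin: "\<And>M. M \<in> mons \<Longrightarrow> \<exists>K. \<forall>k\<ge>K. e k (mon_elt M) = 0"
  obtains s where "s \<in> A n"
    "\<And>M K. M \<in> mons \<Longrightarrow> (\<And>k. k \<ge> K \<Longrightarrow> e k (mon_elt M) = 0) \<Longrightarrow> s (mon_elt M) = (\<Sum>k<K. e k (mon_elt M))"
proof -
  define s where "s x = (if x \<in> X then lext (\<lambda>M. \<Sum>k | e k (mon_elt M) \<noteq> 0. e k (mon_elt M)) x else 0)" for x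
  have lin: "linear_map_on X s"
    using lin_lext[of "\<lambda>M. \<Sum>k | e k (mon_elt M) \<noteq> 0. e k (mon_elt M)"]
    unfolding linear_map_on_def by (simp add: s_def)
  have sK: "s (mon_elt M) = (\<Sum>k<K. e k (mon_elt M))"
    if M: "M \<in> mons" and K: "\<And>k. k \<ge> K \<Longrightarrow> e k (mon_elt M) = 0" for M K
  proof -
    have "s (mon_elt M) = (\<Sum>k | e k (mon_elt M) \<noteq> 0. e k (mon_elt M))" using M by (simp add: s_def)
    also have "\<dots> = (\<Sum>k<K. e k (mon_elt M))"
      by (rule sum.mono_neutral_left) (use K in \<open>force simp: not_le[symmetric]\<close>)+
    finally show ?thesis .
  qed
  \<comment> \<open>Linearity over \<Lambda>V compares the values at M and at a + M. It is therefore
    inherited from finite sums that agree with s at two monomials simultaneously.\<close>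
  have agree: "\<exists>E \<in> A n. s (mon_elt M) = E (mon_elt M) \<and> s (mon_elt M') = E (mon_elt M')"
    if M: "M \<in> mons" "M' \<in> mons" for M M'
  proof -
    obtain K K' where "\<forall>k\<ge>K. e k (mon_elt M) = 0" "\<forall>k\<ge>K'. e k (mon_elt M') = 0" using fin M by meson
    then have "s (mon_elt M) = (\<Sum>k<max K K'. e k (mon_elt M))" "s (mon_elt M') = (\<Sum>k<max K K'. e k (mon_elt M'))"
      by (intro sK; use M in simp)+
    then show ?thesis using e by (intro bexI[of _ "\<lambda>x. \<Sum>k<max K K'. e k x"] homs_sum) simp_all
  qed
  have "s \<in> A n"
  proof (rule homsI[OF lin])
    show "s x = 0" if "x \<notin> X" for x using that by (simp add: s_def)
    show "s (mon_elt M) \<in> Y" if "M \<in> mons" for M using agree[OF that that] homsD(2) by fastforce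
    show "shifts gweight {n} s" unfolding shifts_def
    proof (intro ballI)
      fix M m assume M: "M \<in> mons" "m \<in> keys (s (mon_elt M))"
      then obtain E where "E \<in> A n" "s (mon_elt M) = E (mon_elt M)" using agree by blast
      then show "gweight m - gweight M \<in> {n}" using shiftsD[OF homsD(5)] M by metis
    qed
    fix a M assume a: "a \<in> vmons" and M: "M \<in> mons"
    let ?a = "mon_elt a :: ('v, 'k) elt" and ?M = "mon_elt M :: ('v, 'k) elt" and ?c = "koszul deg a M :: 'k"
    show "s (gmul deg ?a ?M) = smul (psgn (n * gweight a)) (gmul deg ?a (s ?M))"
    proof (cases "?c = 0")
      case True
      obtain E where E: "E \<in> A n" "s ?M = E ?M" using agree[OF M M] by blast
      have "gmul deg ?a ?M = 0" using True by (simp add: gmul_mon_elt)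
      then show ?thesis
        using homsD(6)[OF E(1), of ?a ?M "gweight a"] a M by (simp add: E(2) lin_0[OF homsD(1)[OF E(1)]] lin_0[OF lin])
    next
      case False
      then have aM: "a + M \<in> mons" using a M vmons_mons mons_add[where 'k='k] by blast
      obtain E where E: "E \<in> A n" "s ?M = E ?M" "s (mon_elt (a + M)) = E (mon_elt (a + M))" using agree[OF M aM] by blast
      have "s (gmul deg ?a ?M) = E (gmul deg ?a ?M)"
        using aM E by (simp add: gmul_mon_elt lin_smul[OF lin] lin_smul[OF homsD(1)[OF E(1)]])
      then show ?thesis using homsD(6)[OF E(1), of ?a ?M "gweight a"] a M by (simp add: E(2))
    qed
  qed
  then show thesis using sK that by blast
qed

section \<open>Contractions\<close>

definition ksign :: "('v + 'v) set \<Rightarrow> ('v + 'v) set \<Rightarrow> 'k::field_char_0" where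
  "ksign S S' = (if S \<inter> S' \<noteq> {} then 0 else (\<Prod>g\<in>S. \<Prod>h\<in>S'. swap_sign h g))"

text \<open>The sign of moving q to the front, past the smaller elements of S; q itself contributes
  1.\<close>

definition lsign :: "'v + 'v \<Rightarrow> ('v + 'v) set \<Rightarrow> 'k::field_char_0" where
  "lsign q S = (\<Prod>g\<in>S. swap_sign g q)"

lemma koszul_ksign: "m \<in> mons \<Longrightarrow> m' \<in> mons \<Longrightarrow> koszul deg m m' = ksign (odd_keys deg m) (odd_keys deg m')"
  by (simp add: ksign_def koszul_eq mons_def)

lemma lsign_sq: "lsign q S * lsign q S = (1::'k::field_char_0)"
  by (simp add: lsign_def prod_swap_sign_sq)

lemma lsign_sq_left: "lsign q S * (lsign q S * c) = (c::'k::field_char_0)"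
  using lsign_sq[of q S, where 'k='k] by (simp flip: mult.assoc)

lemma lsign_remove:
  assumes "finite S" "q \<in> S"
  shows "lsign q S = lsign q (S - {q})"
  unfolding lsign_def by (simp add: prod.remove[OF assms])

lemma lsign_Un: "finite S \<Longrightarrow> finite S' \<Longrightarrow> S \<inter> S' = {} \<Longrightarrow> lsign q (S \<union> S') = lsign q S * lsign q S'"
  by (simp add: lsign_def prod.union_disjoint)

lemma ksign_remove_left:
  assumes "finite S" "q \<in> S" "q \<notin> S'"
  shows "ksign S S' = ksign (S - {q}) S' * (lsign q S' :: 'k::field_char_0)"
proof -
  have "S \<inter> S' = {} \<longleftrightarrow> (S - {q}) \<inter> S' = {}" using assms by blast
  then show ?thesis unfolding ksign_def lsign_def
    using prod.remove[OF assms(1,2), of "\<lambda>g. \<Prod>h\<in>S'. swap_sign h g :: 'k"] by (simp add: mult.commute)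
qed

lemma ksign_remove_right:
  assumes "finite S'" "q \<in> S'" "q \<notin> S"
  shows "ksign S S' = ksign S (S' - {q}) * (\<Prod>g\<in>S. swap_sign q g)"
proof -
  have "S \<inter> S' = {} \<longleftrightarrow> S \<inter> (S' - {q}) = {}" using assms by blast
  then show ?thesis unfolding ksign_def
    by (simp add: prod.remove[OF assms(1,2)] prod.distrib mult.commute)
qed

text \<open>For g different from q exactly one of the two orders gives - 1, so passing the larger
  instead of the smaller elements costs a sign for every element of S.\<close>

lemma lsign_anti:
  assumes "q \<notin> S"
  shows "(\<Prod>g\<in>S. swap_sign q g) = lsign q S * (\<Prod>g\<in>S. - 1 :: 'k::field_char_0)"
proof -
  have "swap_sign q g = swap_sign g q * (- 1 :: 'k)" if "g \<in> S" for g
    using assms that gen_less_total[of q g] by (auto simp: swap_sign_def)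
  then show ?thesis unfolding lsign_def prod.distrib[symmetric] by (intro prod.cong) auto
qed

text \<open>The derivations sending \<open>p\<close>, respectively \<open>sp\<close>, to 1 and all other generators to 0.\<close>

definition contr :: "'v \<Rightarrow> ('v, 'k::field_char_0) elt \<Rightarrow> ('v, 'k) elt" where
  "contr p = lext (\<lambda>M. if Inl p \<in> keys M then
     smul (lsign (Inl p) (odd_keys deg M)) (mon_elt (M - single (Inl p) 1)) else 0)"

definition sder :: "'v \<Rightarrow> ('v, 'k::field_char_0) elt \<Rightarrow> ('v, 'k) elt" where
  "sder p = lext (\<lambda>M. smul (of_nat (lookup M (Inr p))) (mon_elt (M - single (Inr p) 1)))"

lemma odd_keys_remove:
  assumes "M \<in> mons" "odd (deg p)" "Inl p \<in> keys M"
  shows "odd_keys deg (M - single (Inl p) 1) = odd_keys deg M - {Inl p}" "Inl p \<in> odd_keys deg M"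
    "lookup M (Inl p) = 1"
proof -
  have "lookup M (Inl p) \<le> 1" using assms(1,2) by (simp add: mons_def reduced_def)
  moreover have "lookup M (Inl p) \<noteq> 0" using assms(3) by (simp add: in_keys_iff)
  ultimately show 1: "lookup M (Inl p) = 1" by simp
  show "Inl p \<in> odd_keys deg M" using assms by (simp add: odd_keys_def)
  have "g \<in> keys (M - single (Inl p) 1) \<longleftrightarrow> g \<in> keys M \<and> g \<noteq> Inl p" for g
    using 1 by (cases "g = Inl p") (simp_all add: in_keys_iff lookup_minus lookup_single when_def)
  then show "odd_keys deg (M - single (Inl p) 1) = odd_keys deg M - {Inl p}"
    by (auto simp: odd_keys_def)
qed

lemma contr_mon:
  "contr p (mon_elt M) = (if Inl p \<in> keys M then
     smul (lsign (Inl p) (odd_keys deg M)) (mon_elt (M - single (Inl p) 1)) else 0)"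
  by (simp add: contr_def)

lemma sder_mon: "sder p (mon_elt M) = smul (of_nat (lookup M (Inr p))) (mon_elt (M - single (Inr p) 1))"
  by (simp add: sder_def)

lemma contr_lin: "linear_map_on X (contr p)"
  unfolding contr_def by (rule lin_lext)

lemma sder_lin: "linear_map_on X (sder p)"
  unfolding sder_def by (rule lin_lext)

lemma contr_X: "x \<in> X \<Longrightarrow> contr p x \<in> X"
  by (rule lin_into[OF contr_lin]) (simp add: contr_mon mons_diff)

lemma contr_Y: "y \<in> Y \<Longrightarrow> contr p y \<in> Y"
proof -
  assume y: "y \<in> Y"
  show ?thesis unfolding lin_expand[OF contr_lin Y_X[OF y]]
    using y vmons_diff by (intro Y_sum Y_closed(3)) (auto simp: contr_mon Y_iff[of y])
qed

lemma sder_X: "x \<in> X \<Longrightarrow> sder p x \<in> X"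
  by (rule lin_into[OF sder_lin]) (simp add: sder_mon mons_diff)

lemma contr_shifts:
  assumes "additive W"
  shows "shifts W {- W (single (Inl p) 1)} (contr p :: ('v, 'k::field_char_0) elt \<Rightarrow> _)"
  unfolding shifts_def
proof (intro ballI)
  fix M m assume "M \<in> mons" "m \<in> keys (contr p (mon_elt M) :: ('v, 'k) elt)"
  then have m: "Inl p \<in> keys M" "m = M - single (Inl p) 1"
    by (auto simp: contr_mon dest!: subsetD[OF keys_smul] split: if_splits)
  have "W M = W (single (Inl p) 1) + W m"
    using single_add_diff[OF m(1)] additiveD[OF assms, of "single (Inl p) 1" m] m(2) by simp
  then show "W m - W M \<in> {- W (single (Inl p) 1)}" by simp
qed

lemma sder_shifts:
  assumes "additive W"
  shows "shifts W {- W (single (Inr p) 1)} (sder p :: ('v, 'k::field_char_0) elt \<Rightarrow> _)"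
  unfolding shifts_def
proof (intro ballI)
  fix M m assume "M \<in> mons" "m \<in> keys (sder p (mon_elt M) :: ('v, 'k) elt)"
  then have m: "Inr p \<in> keys M" "m = M - single (Inr p) 1"
    by (auto simp: sder_mon in_keys_iff lookup_mon_elt split: if_splits)
  have "W M = W (single (Inr p) 1) + W m"
    using single_add_diff[OF m(1)] additiveD[OF assms, of "single (Inr p) 1" m] m(2) by simp
  then show "W m - W M \<in> {- W (single (Inr p) 1)}" by simp
qed

lemma gweight_single [simp]: "gweight (single g 1) = int (gdeg deg g)"
  by (simp add: gweight_def mdeg_def)

lemma single_diff_add:
  "g \<in> keys m \<Longrightarrow> m + m' - single g 1 = (m - single g 1) + (m' :: 'a \<Rightarrow>\<^sub>0 nat)"
  "g \<in> keys m' \<Longrightarrow> m + m' - single g 1 = m + (m' - single g (1::nat))"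
  by (rule poly_mapping_eqI, auto simp: lookup_add lookup_minus lookup_single when_def in_keys_iff)+

text \<open>All terms are multiples of the monomial m + m' - p, so the Leibniz rule is an identity
  between signs, proved according to which of m and m' contain p.\<close>

lemma contr_deriv:
  assumes p: "odd (deg p)"
  shows "deriv (- int (deg p)) (contr p :: ('v, 'k::field_char_0) elt \<Rightarrow> ('v, 'k) elt)"
proof -
  have "contr p (gmul deg (mon_elt m) (mon_elt m')) =
      gmul deg (contr p (mon_elt m)) (mon_elt m') +
      smul (psgn (- int (deg p) * gweight m)) (gmul deg (mon_elt m) (contr p (mon_elt m' :: ('v, 'k) elt)))"
    if m: "m \<in> mons" "m' \<in> mons" for m m'
  proof -
    let ?q = "Inl p :: 'v + 'v" and ?S = "odd_keys deg m" and ?S' = "odd_keys deg m'"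
    let ?s = "single ?q (1::nat)" and ?\<epsilon> = "psgn (gweight m) :: 'k"
    have \<epsilon>: "psgn (- int (deg p) * gweight m) = ?\<epsilon>" using p by (auto simp: psgn_def)
    have \<epsilon>S: "?\<epsilon> = (\<Prod>g\<in>?S. - 1)" using psgn_mdeg[of deg m] m(1) by (simp add: gweight_def mons_def)
    have k: "koszul deg m m' = (ksign ?S ?S' :: 'k)" by (rule koszul_ksign[OF m])
    have q: "?q \<in> keys M \<longleftrightarrow> ?q \<in> odd_keys deg M" for M using p by (simp add: odd_keys_def)
    have L: "contr p (gmul deg (mon_elt m) (mon_elt m')) =
       (if ?q \<in> ?S \<union> ?S' then smul (ksign ?S ?S' * lsign ?q (?S \<union> ?S')) (mon_elt (m + m' - ?s)) else (0 :: ('v, 'k) elt))"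
      by (simp add: gmul_mon_elt contr_def lext_smul q odd_keys_add k)
    have R1: "gmul deg (contr p (mon_elt m)) (mon_elt m') = (if ?q \<in> ?S then
        smul (lsign ?q ?S * ksign (?S - {?q}) ?S') (mon_elt (m + m' - ?s)) else (0 :: ('v, 'k) elt))"
      using m p by (auto simp: contr_mon q[symmetric] gmul_smul_left gmul_mon_elt koszul_ksign mons_diff
          odd_keys_remove(1) single_diff_add(1))
    have R2: "gmul deg (mon_elt m) (contr p (mon_elt m')) = (if ?q \<in> ?S' then
        smul (lsign ?q ?S' * ksign ?S (?S' - {?q})) (mon_elt (m + m' - ?s)) else (0 :: ('v, 'k) elt))"
      using m p by (auto simp: contr_mon q[symmetric] gmul_smul_right gmul_mon_elt koszul_ksign mons_diff
          odd_keys_remove(1) single_diff_add(2))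
    have c: "(if ?q \<in> ?S \<union> ?S' then ksign ?S ?S' * lsign ?q (?S \<union> ?S') else 0) =
       (if ?q \<in> ?S then lsign ?q ?S * ksign (?S - {?q}) ?S' else 0) +
       (if ?q \<in> ?S' then ?\<epsilon> * (lsign ?q ?S' * ksign ?S (?S' - {?q})) else (0::'k))"
    proof (cases "?q \<in> ?S"; cases "?q \<in> ?S'")
      assume q: "?q \<in> ?S" "?q \<in> ?S'"
      have S: "ksign (?S - {?q}) ?S' = (ksign (?S - {?q}) (?S' - {?q}) * (\<Prod>g\<in>?S - {?q}. swap_sign ?q g) :: 'k)"
        "ksign ?S (?S' - {?q}) = (ksign (?S - {?q}) (?S' - {?q}) * lsign ?q (?S' - {?q}) :: 'k)"
        by (rule ksign_remove_right ksign_remove_left; use q in simp)+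
      \<comment> \<open>If both monomials contain p the product is 0, and the two terms on the right
        must cancel. The sign between them comes from p itself, which is counted in the degree of
        m.\<close>
      have "?\<epsilon> = - (\<Prod>g\<in>?S - {?q}. - 1)" unfolding \<epsilon>S by (subst prod.remove[OF _ q(1)]) simp_all
      moreover have "ksign ?S ?S' = (0::'k)" using q by (auto simp: ksign_def)
      ultimately show ?thesis using q
        by (simp add: S lsign_anti lsign_remove[of _ ?q] lsign_sq_left mult_ac)
    next
      assume q: "?q \<in> ?S" "?q \<notin> ?S'"
      show ?thesis
      proof (cases "?S \<inter> ?S' = {}")
        case True
        then show ?thesis using q
          by (simp add: ksign_remove_left[OF _ q] lsign_Un lsign_sq_left mult_ac)
      next
        case False
        then have "(?S - {?q}) \<inter> ?S' \<noteq> {}" using q by blast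
        then show ?thesis using q False by (simp add: ksign_def)
      qed
    next
      assume q: "?q \<notin> ?S" "?q \<in> ?S'"
      show ?thesis
      proof (cases "?S \<inter> ?S' = {}")
        case True
        then show ?thesis using q
          by (simp add: ksign_remove_right[OF _ q(2,1)] lsign_Un lsign_anti \<epsilon>S lsign_sq_left mult_ac)
      next
        case False
        then have "?S \<inter> (?S' - {?q}) \<noteq> {}" using q by blast
        then show ?thesis using q False by (simp add: ksign_def)
      qed
    qed simp
    show ?thesis unfolding L R1 R2 \<epsilon>
      using arg_cong[OF c, of "\<lambda>c. smul c (mon_elt (m + m' - ?s) :: ('v, 'k) elt)"]
      by (auto simp: smul.scale_left_distrib split: if_splits)
  qed
  moreover have "shifts gweight {- int (deg p)} (contr p :: ('v, 'k) elt \<Rightarrow> ('v, 'k) elt)"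
    using contr_shifts[OF additive_gweight, of p] by simp
  ultimately show ?thesis using contr_lin contr_X by (auto simp: deriv_def)
qed

lemma odd_keys_minus_even:
  assumes "even (gdeg deg g)"
  shows "odd_keys deg (m - single g 1) = odd_keys deg m"
proof -
  have "h \<in> keys (m - single g 1) \<longleftrightarrow> h \<in> keys m" if "h \<noteq> g" for h
    using that by (simp add: in_keys_iff lookup_minus lookup_single when_def)
  then have "odd (gdeg deg h) \<Longrightarrow> h \<in> keys (m - single g 1) \<longleftrightarrow> h \<in> keys m" for h using assms by metis
  then show ?thesis by (auto simp: odd_keys_def)
qed

text \<open>As sp is even, removing it affects no sign, and the rule is the additivity of
  exponents.\<close>

lemma sder_deriv:
  assumes p: "odd (deg p)"
  shows "deriv (1 - int (deg p)) (sder p :: ('v, 'k::field_char_0) elt \<Rightarrow> ('v, 'k) elt)"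
proof -
  have "sder p (gmul deg (mon_elt m) (mon_elt m')) =
      gmul deg (sder p (mon_elt m)) (mon_elt m') +
      smul (psgn ((1 - int (deg p)) * gweight m)) (gmul deg (mon_elt m) (sder p (mon_elt m' :: ('v, 'k) elt)))"
    if m: "m \<in> mons" "m' \<in> mons" for m m'
  proof -
    let ?q = "Inr p :: 'v + 'v"
    let ?s = "single ?q (1::nat)"
    have o: "odd_keys deg (M - ?s) = odd_keys deg M" for M using p by (intro odd_keys_minus_even) simp
    have k: "koszul deg (m - ?s) m' = (koszul deg m m' :: 'k)" "koszul deg m (m' - ?s) = (koszul deg m m' :: 'k)"
      using m by (simp_all add: koszul_ksign mons_diff o)
    have "psgn ((1 - int (deg p)) * gweight m) = (1::'k)" using p by simp
    moreover have "smul (of_nat (lookup m ?q)) (mon_elt (m - ?s + m')) = (smul (of_nat (lookup m ?q)) (mon_elt (m + m' - ?s)) :: ('v, 'k) elt)"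
      by (cases "?q \<in> keys m") (simp_all add: single_diff_add(1), simp add: in_keys_iff)
    moreover have "smul (of_nat (lookup m' ?q)) (mon_elt (m + (m' - ?s))) = (smul (of_nat (lookup m' ?q)) (mon_elt (m + m' - ?s)) :: ('v, 'k) elt)"
      by (cases "?q \<in> keys m'") (simp_all add: single_diff_add(2), simp add: in_keys_iff)
    moreover have "sder p (gmul deg (mon_elt m) (mon_elt m'))
        = smul (koszul deg m m') (smul (of_nat (lookup (m + m') ?q)) (mon_elt (m + m' - ?s)) :: ('v, 'k) elt)"
      by (simp add: gmul_mon_elt sder_def lext_smul)
    ultimately show ?thesis
      by (simp only: sder_mon gmul_smul_left gmul_smul_right gmul_mon_elt k smul.scale_left_commute[of "of_nat _"])
        (simp add: lookup_add smul.scale_left_distrib algebra_simps)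
  qed
  moreover have "shifts gweight {1 - int (deg p)} (sder p :: ('v, 'k) elt \<Rightarrow> ('v, 'k) elt)"
    using sder_shifts[OF additive_gweight, of p] odd_pos[OF p] by (simp add: of_nat_diff)
  ultimately show ?thesis using sder_lin sder_X by (auto simp: deriv_def)
qed

section \<open>Multiplication of arguments by sp\<close>

lemma single_Inr_mons: "p \<in> B \<Longrightarrow> single (Inr p) 1 \<in> mons"
  by (rule single_mons) simp

lemma koszul_sgen:
  assumes "p \<in> B" "odd (deg p)" "M \<in> mons"
  shows "koszul deg (single (Inr p) 1) M = (1::'k::field_char_0)"
proof -
  have "odd_keys deg (single (Inr p) 1) = {}" using assms by (auto simp: odd_keys_def)
  then show ?thesis using assms by (simp add: koszul_ksign single_Inr_mons ksign_def)
qed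

lemma sgen_mult:
  assumes "p \<in> B" "odd (deg p)" "M \<in> mons"
  shows "gmul deg (sgen p) (mon_elt M) = (mon_elt (single (Inr p) 1 + M) :: ('v, 'k::field_char_0) elt)"
    "(single (Inr p) 1 + M) \<in> mons"
  using assms mons_add[OF single_Inr_mons assms(3), where 'k='k] by (simp_all add: sgen_def gmul_mon_elt koszul_sgen)

definition premult :: "'v \<Rightarrow> (('v, 'k::field_char_0) elt \<Rightarrow> ('v, 'k) elt) \<Rightarrow> ('v, 'k) elt \<Rightarrow> ('v, 'k) elt" where
  "premult p g x = (if x \<in> X then g (gmul deg (sgen p) x) else 0)"

lemma premult_shifts:
  assumes W: "additive W" and p: "p \<in> B" and g: "g \<in> A n" "shifts W J g"
    and L: "\<And>j. j \<in> J \<Longrightarrow> j + W (single (Inr p) 1) \<in> L"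
  shows "shifts W L (premult p g)"
proof -
  have "shifts W L (\<lambda>x. g (gmul deg (sgen p) x))"
    by (rule shifts_comp[OF g(2) shifts_gmul[OF W, of _ "{W (single (Inr p) 1)}"] homsD(1)[OF g(1)]])
      (use L p in \<open>auto simp: sgen_def intro!: gmul_X single_mons\<close>)
  then show ?thesis by (simp add: shifts_def premult_def)
qed

text \<open>For p odd the factor sp is even and passes every monomial a of \<Lambda>V without a
  sign.\<close>

lemma premult_homs:
  assumes p: "p \<in> B" "odd (deg p)" and g: "g \<in> A n"
  shows "premult p g \<in> A (n + int (deg p) - 1)"
proof (rule homsI)
  have sX: "x \<in> X \<Longrightarrow> gmul deg (sgen p) x \<in> X" for x :: "('v, 'a) elt" using p sgen_X by blast
  show lin: "linear_map_on X (premult p g)"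
    using lin_comp[OF homsD(1)[OF g] lin_gmul[of "sgen p"]] sX
    unfolding linear_map_on_def by (simp add: premult_def)
  show "premult p g x = 0" if "x \<notin> X" for x using that by (simp add: premult_def)
  show "premult p g (mon_elt M) \<in> Y" if "M \<in> mons" for M
    using that homsD(2)[OF g] by (simp add: premult_def)
  show "shifts gweight {n + int (deg p) - 1} (premult p g)"
    by (rule premult_shifts[OF additive_gweight p(1) g homsD(5)[OF g]])
      (use odd_pos[OF p(2)] in \<open>simp add: of_nat_diff\<close>)
  fix a M assume a: "a \<in> vmons" and M: "M \<in> mons"
  let ?a = "mon_elt a :: ('v, 'a) elt" and ?M = "mon_elt M :: ('v, 'a) elt" and ?s = "single (Inr p) (1::nat)"
  have s: "psgn ((n + int (deg p) - 1) * gweight a) = (psgn (n * gweight a) :: 'a)" using p by (auto simp: psgn_def)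
  have o: "odd_keys deg (?s + M) = odd_keys deg M" using p by (auto simp: odd_keys_def keys_add_nat)
  have k: "koszul deg a (?s + M) = (koszul deg a M :: 'a)"
    using a M p sgen_mult(2) by (simp add: koszul_ksign vmons_mons o)
  have "gmul deg (sgen p) (gmul deg ?a ?M) = gmul deg ?a (gmul deg (sgen p) ?M)"
  proof (cases "koszul deg a M = (0::'a)")
    case True
    then show ?thesis using p M by (simp add: sgen_mult gmul_mon_elt k)
  next
    case False
    then have "a + M \<in> mons" using a M vmons_mons mons_add[where 'k='a] by blast
    then show ?thesis using p M by (simp add: sgen_mult gmul_mon_elt k gmul_smul_right add.left_commute)
  qed
  then show "premult p g (gmul deg ?a ?M) = smul (psgn ((n + int (deg p) - 1) * gweight a)) (gmul deg ?a (premult p g ?M))"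
    using a M p by (simp add: premult_def gmul_X vmons_mons s homsD(6)[OF g] sX)
qed

lemma premult_diff: "premult p (\<lambda>x. g x - h x) = (\<lambda>x. premult p g x - premult p h x)"
  by (simp add: premult_def fun_eq_iff)

lemma premult_zero: "premult p (\<lambda>x. 0) = (\<lambda>x. 0)"
  by (simp add: premult_def fun_eq_iff)

text \<open>Contracting p and multiplying it back restores the monomial with its sign, since both
  moves use the same \<open>lsign\<close>. Like \<open>sgen_sder\<close>, this produces the diagonal
  part of Dh + hD.\<close>

lemma vgen_contr:
  assumes p: "p \<in> B" "odd (deg p)" and M: "M \<in> mons"
  shows "gmul deg (vgen p) (contr p (mon_elt M)) = (smul (of_nat (lookup M (Inl p))) (mon_elt M) :: ('v, 'k::field_char_0) elt)"
proof (cases "Inl p \<in> keys M")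
  case True
  let ?q = "Inl p :: 'v + 'v"
  have "odd_keys deg (single ?q 1) = {?q}" using p by (auto simp: odd_keys_def)
  then have "koszul deg (single ?q 1) (M - single ?q 1) = (lsign ?q (odd_keys deg M - {?q}) :: 'k)"
    using p M True by (subst koszul_ksign) (auto simp: single_mons mons_diff odd_keys_remove ksign_def lsign_def)
  then show ?thesis using True p M odd_keys_remove[OF M p(2) True]
    by (simp add: contr_mon vgen_def gmul_smul_right gmul_mon_elt single_add_diff[symmetric]
        lsign_remove[of "odd_keys deg M" ?q] lsign_sq)
qed (simp add: contr_mon in_keys_iff)

lemma vgen_contr_lookup:
  assumes p: "p \<in> B" "odd (deg p)" and y: "y \<in> X"
  shows "lookup (gmul deg (vgen p) (contr p y)) m = of_nat (lookup m (Inl p)) * lookup y m"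
proof -
  have "gmul deg (vgen p) (contr p y)
      = (\<Sum>M\<in>keys y. smul (lookup y M) (gmul deg (vgen p) (contr p (mon_elt M))))"
    unfolding lin_expand[OF contr_lin y] by (simp add: gmul_sum_right gmul_smul_right)
  also have "\<dots> = (\<Sum>M\<in>keys y. smul (lookup y M) (smul (of_nat (lookup M (Inl p))) (mon_elt M)))"
    using y by (intro sum.cong refl) (auto simp: vgen_contr[OF p] X_iff)
  finally show ?thesis
    by (simp add: lookup_sum lookup_mon_elt if_distrib sum.delta in_keys_iff mult.commute cong: if_cong)
qed

lemma sgen_sder:
  assumes p: "p \<in> B" "odd (deg p)" and M: "M \<in> mons"
  shows "gmul deg (sgen p) (sder p (mon_elt M)) = (smul (of_nat (lookup M (Inr p))) (mon_elt M) :: ('v, 'k::field_char_0) elt)"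
  using p M by (cases "Inr p \<in> keys M")
    (simp_all add: sder_mon gmul_smul_right sgen_mult mons_diff single_add_diff[symmetric], simp add: in_keys_iff)

section \<open>Acyclicity in low filtration degree\<close>

definition Podd :: "'v set" where "Podd = {v \<in> B. odd (deg v)}"

lemma finite_Podd [simp]: "finite Podd" using finite_B by (simp add: Podd_def)

definition cmax :: int where "cmax = 3 + (\<Sum>v\<in>B. int (deg v))"

text \<open>The weights are chosen such that the values of \<open>d\<close> on \<open>V\<close> have weight at least \<open>2 cmax\<close>, that
  \<open>omega \<le> degree\<close> on \<open>\<Lambda>sV\<close> and \<open>degree \<le> omega\<close> on \<open>\<Lambda>V\<close> (which bounds the shift of a
  map from below by its degree), and that the lowest shift occurring in \<open>\<delta>\<close> is attained only by the
  terms \<open>sp \<mapsto> p\<close> with \<open>p\<close> odd.\<close>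

abbreviation gen_omega :: "'v + 'v \<Rightarrow> nat" where
  "gen_omega \<equiv> (\<lambda>g. case g of Inl v \<Rightarrow> nat cmax | Inr v \<Rightarrow> if odd (deg v) then 2 else 1)"

definition omega :: "'v mon \<Rightarrow> int" where
  "omega m = int (weight gen_omega m)"

definition tau :: "'v mon \<Rightarrow> int" where
  "tau m = int (mdeg deg m) + int (rdeg deg m)"

text \<open>The Euler degree in the variables p and sp for p odd. It is additive, so the eigenvalue,
  a function of its shift, acts by a \<open>rescale\<close> and hence \<Lambda>V-linearly.\<close>

definition podd :: "'v mon \<Rightarrow> int" where
  "podd m = int (weight (\<lambda>g. case g of Inl v \<Rightarrow> of_bool (odd (deg v)) | Inr v \<Rightarrow> of_bool (odd (deg v))) m)"

lemma additive_omega: "additive omega" unfolding omega_def by (rule additive_weight)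

lemma additive_podd: "additive podd" unfolding podd_def by (rule additive_weight)

lemma additive_tau: "additive tau"
  by (simp add: additive_def tau_def mdeg_def rdeg_def weight_add)

lemma cmax_ge: "cmax \<ge> 3" "v \<in> B \<Longrightarrow> int (deg v) \<le> cmax"
proof -
  show "cmax \<ge> 3" unfolding cmax_def by (simp add: sum_nonneg)
  assume "v \<in> B"
  then have "int (deg v) \<le> (\<Sum>v\<in>B. int (deg v))" using finite_B by (intro member_le_sum) auto
  then show "int (deg v) \<le> cmax" by (simp add: cmax_def)
qed

lemma omega_single [simp]:
  "omega (single (Inl v) 1) = cmax"
  "omega (single (Inr v) 1) = (if odd (deg v) then 2 else 1)"
  using cmax_ge(1) by (simp_all add: omega_def)

lemma tau_single [simp]:
  "tau (single (Inl v) 1) = int (deg v) + (if odd (deg v) then 1 else 0)"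
  "tau (single (Inr v) 1) = int (deg v - 1) + (if odd (deg v) then 2 else 1)"
  by (simp_all add: tau_def mdeg_def rdeg_def)

lemma smons_keys: "M \<in> smons \<Longrightarrow> keys M \<subseteq> Inr ` B" by (simp add: smons_def)
lemma vmons_keys: "M \<in> vmons \<Longrightarrow> keys M \<subseteq> Inl ` B" by (simp add: vmons_def)

lemma omega_smons: "M \<in> smons \<Longrightarrow> omega M \<le> gweight M"
proof -
  assume M: "M \<in> smons"
  have "weight gen_omega M \<le> weight (gdeg deg) M"
  proof (rule weight_mono)
    fix g assume "g \<in> keys M"
    then obtain v where v: "g = Inr v" "v \<in> B" using smons_keys[OF M] by blast
    have "odd (deg v) \<Longrightarrow> deg v \<noteq> 2" by auto
    then show "(case g of Inl v \<Rightarrow> nat cmax | Inr v \<Rightarrow> if odd (deg v) then 2 else 1) \<le> gdeg deg g"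
      using deg_ge[OF v(2)] v(1) by auto
  qed
  then show ?thesis by (simp add: omega_def gweight_def mdeg_def)
qed

lemma omega_vmons:
  assumes M: "M \<in> vmons"
  shows "gweight M \<le> omega M" "omega M \<le> cmax * gweight M"
proof -
  have "weight (gdeg deg) M \<le> weight gen_omega M"
    using vmons_keys[OF M] cmax_ge by (intro weight_mono) force
  then show "gweight M \<le> omega M" by (simp add: omega_def gweight_def mdeg_def)
  have "weight gen_omega M
    \<le> weight (\<lambda>g. nat cmax * gdeg deg g) M"
  proof (rule weight_mono)
    fix g assume "g \<in> keys M"
    then obtain v where v: "g = Inl v" "v \<in> B" using vmons_keys[OF M] by blast
    have "nat cmax * 1 \<le> nat cmax * deg v" using deg_ge[OF v(2)] by (intro mult_le_mono2) simp
    then show "(case g of Inl v \<Rightarrow> nat cmax | Inr v \<Rightarrow> if odd (deg v) then 2 else 1) \<le> nat cmax * gdeg deg g"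
      using v(1) by simp
  qed
  then have "int (weight gen_omega M)
     \<le> int (nat cmax * weight (gdeg deg) M)" unfolding weight_fun_mult by linarith
  then show "omega M \<le> cmax * gweight M" using cmax_ge(1) by (simp add: omega_def gweight_def mdeg_def)
qed

lemma homs_keys:
  assumes "g \<in> A n" "M \<in> mons" "m \<in> keys (g (mon_elt M))"
  shows "m \<in> vmons" "gweight m = n + gweight M"
  using homsD(2)[OF assms(1), of "mon_elt M"] shiftsD[OF homsD(5)[OF assms(1)] assms(2,3)] assms(3)
  by (auto simp: Y_iff)

lemma omega_lower:
  assumes g: "g \<in> A n"
  shows "shifts omega {n..} g"
proof (rule homs_shiftsI[OF g additive_omega])
  fix M m assume M: "M \<in> smons" "m \<in> keys (g (mon_elt M))"
  have "gweight m \<le> omega m" "gweight m = n + gweight M"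
    using homs_keys[OF g smons_mons[OF M(1)] M(2)] omega_vmons(1)[of m] by auto
  then show "omega m - omega M \<in> {n..}" using omega_smons[OF M(1)] by simp
qed

text \<open>The degree of the value is fixed by that of M, and on \<Lambda>V the weight
  \<open>omega\<close> is at most \<open>cmax\<close> times the degree. The bound depends on M, so
  completeness for \<open>omega\<close> is pointwise.\<close>

lemma omega_upper:
  assumes g: "g \<in> A n" and s: "shifts omega {j..} g" and M: "M \<in> mons"
    and j: "j > cmax * (n + gweight M) - omega M"
  shows "g (mon_elt M) = 0"
proof (rule ccontr)
  assume "g (mon_elt M) \<noteq> 0"
  then obtain m where m: "m \<in> keys (g (mon_elt M))" by (metis keys_eq_empty ex_in_conv)
  have "omega m \<le> cmax * (n + gweight M)"
    using homs_keys[OF g M m] omega_vmons(2)[of m] by simp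
  moreover have "j \<le> omega m - omega M" using shiftsD[OF s M m] by simp
  ultimately show False using j by simp
qed

lemma omega_all_zero:
  assumes g: "g \<in> A n" and s: "\<And>k. shifts omega {n + int k..} g"
  shows "g = (\<lambda>x. 0)"
proof (rule homs_eqI[OF g homs_zero])
  fix M assume M: "M \<in> mons"
  show "g (mon_elt M) = 0"
    by (rule omega_upper[OF g s M, of "nat (cmax * (n + gweight M) - omega M - n + 1)"]) linarith
qed

lemma podd_eq:
  assumes "M \<in> mons"
  shows "podd M = (\<Sum>p\<in>Podd. int (lookup M (Inl p)) + int (lookup M (Inr p)))"
proof -
  let ?w = "\<lambda>g :: 'v + 'v. case g of Inl v \<Rightarrow> of_bool (odd (deg v)) | Inr v \<Rightarrow> of_bool (odd (deg v))"
  have "weight ?w M = (\<Sum>g\<in>Inl ` B \<union> Inr ` B. lookup M g * ?w g)"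
    using assms finite_B by (intro weight_superset) (auto simp: mons_def)
  also have "\<dots> = (\<Sum>g\<in>Inl ` B. lookup M g * ?w g) + (\<Sum>g\<in>Inr ` B. lookup M g * ?w g)"
    using finite_B by (intro sum.union_disjoint) auto
  also have "\<dots> = (\<Sum>p\<in>B. lookup M (Inl p) * of_bool (odd (deg p))) + (\<Sum>p\<in>B. lookup M (Inr p) * of_bool (odd (deg p)))"
    by (simp add: sum.reindex)
  also have "\<dots> = (\<Sum>p\<in>B. if odd (deg p) then lookup M (Inl p) + lookup M (Inr p) else 0)"
    by (simp add: sum.distrib[symmetric]) (rule sum.cong, auto)
  also have "\<dots> = (\<Sum>p\<in>Podd. lookup M (Inl p) + lookup M (Inr p))"
    using finite_B by (simp add: Podd_def sum.inter_filter)
  finally show ?thesis by (simp add: podd_def)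
qed

lemma podd_vmons:
  assumes m: "m \<in> vmons"
  shows "podd m = (\<Sum>p\<in>Podd. int (lookup m (Inl p)))" "podd m \<le> int (card Podd)"
    "rdeg deg m = podd m" "plen deg m = podd m"
proof -
  have "lookup m (Inr p) = 0" for p using vmons_keys[OF m] by (metis Inl_Inr_False image_iff in_keys_iff subsetD)
  then show 1: "podd m = (\<Sum>p\<in>Podd. int (lookup m (Inl p)))" using podd_eq[OF vmons_mons[OF m]] by simp
  have "lookup m (Inl p) \<le> 1" if "p \<in> Podd" for p
    using m that by (auto simp: vmons_def mons_def reduced_def Podd_def)
  then have "(\<Sum>p\<in>Podd. int (lookup m (Inl p))) \<le> (\<Sum>p\<in>Podd. 1)" by (intro sum_mono) force
  then show "podd m \<le> int (card Podd)" using 1 by simp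
  show "rdeg deg m = podd m" "plen deg m = podd m"
    unfolding podd_def rdeg_def plen_def of_nat_eq_iff using vmons_keys[OF m] by (auto intro!: weight_cong)
qed

lemma tau_vmons: "m \<in> vmons \<Longrightarrow> tau m = gweight m + podd m"
  by (simp add: tau_def gweight_def podd_vmons)

text \<open>The generators sq with q even are odd, hence occur at most once each. All other
  contributions to \<open>rdeg\<close> come from p and sp with p odd, and are at most 2 per
  factor.\<close>

lemma rdeg_bound:
  assumes M: "M \<in> mons"
  shows "int (rdeg deg M) \<le> 2 * podd M + int (card B)"
proof -
  let ?q = "\<lambda>g :: 'v + 'v. case g of Inl v \<Rightarrow> 0 | Inr v \<Rightarrow> (of_bool (even (deg v)) :: nat)"
  let ?w = "\<lambda>g :: 'v + 'v. case g of Inl v \<Rightarrow> of_bool (odd (deg v)) | Inr v \<Rightarrow> (of_bool (odd (deg v)) :: nat)"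
  have "rdeg deg M \<le> weight (\<lambda>g. 2 * ?w g + ?q g) M"
    unfolding rdeg_def by (rule weight_mono) (auto split: sum.split)
  also have "\<dots> = 2 * weight ?w M + weight ?q M" by (simp add: weight_fun_add weight_fun_mult)
  finally have 1: "rdeg deg M \<le> 2 * weight ?w M + weight ?q M" .
  have "weight ?q M = (\<Sum>g\<in>Inl ` B \<union> Inr ` B. lookup M g * ?q g)"
    using M finite_B by (intro weight_superset) (auto simp: mons_def)
  also have "\<dots> = (\<Sum>g\<in>Inl ` B. lookup M g * ?q g) + (\<Sum>g\<in>Inr ` B. lookup M g * ?q g)"
    using finite_B by (intro sum.union_disjoint) auto
  also have "\<dots> = (\<Sum>v\<in>B. lookup M (Inr v) * of_bool (even (deg v)))"
    by (simp add: sum.reindex)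
  also have "\<dots> \<le> (\<Sum>v\<in>B. 1)"
  proof (rule sum_mono)
    fix v assume v: "v \<in> B"
    have "odd (deg v - 1) \<Longrightarrow> lookup M (Inr v) \<le> 1" using M by (auto simp: mons_def reduced_def)
    then show "lookup M (Inr v) * of_bool (even (deg v)) \<le> 1" using deg_ge[OF v] by auto
  qed
  finally show ?thesis using 1 by (simp add: podd_def)
qed

text \<open>\<open>card Podd - (podd m - podd M)\<close> is, up to sign, the eigenvalue of the leading term of \<open>Phi\<close> below.\<close>

lemma eigenvalue_nonzero:
  assumes g: "g \<in> A n" and M: "M \<in> mons" "m \<in> keys (g (mon_elt M))"
    and t: "tau m - tau M < n - int (card B)"
  shows "podd m - podd M \<noteq> int (card Podd)"
proof
  assume e: "podd m - podd M = int (card Podd)"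
  note k = homs_keys[OF g M]
  have "podd M \<ge> 0" by (simp add: podd_def)
  \<comment> \<open>The value contains each odd generator of V at most once, so the difference
    \<open>card Podd\<close> is attained only at the two extremes.\<close>
  then have "podd M = 0" "podd m = int (card Podd)" using e podd_vmons(2)[OF k(1)] by linarith+
  then have "tau m - tau M \<ge> n - int (card B)"
    using tau_vmons[OF k(1)] k(2) rdeg_bound[OF M(1)] by (simp add: tau_def gweight_def)
  then show False using t by simp
qed

text \<open>On \<Lambda>V the weight \<open>tau\<close> exceeds the degree by the number of odd
  factors, which is at most \<open>card B\<close>; on arguments it is at least the degree.\<close>

lemma tau_upper:
  assumes g: "g \<in> A n" and s: "shifts tau {w..} g" and w: "w > n + int (card B)"
  shows "g = (\<lambda>x. 0)"
proof (rule homs_eqI[OF g homs_zero])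
  fix M assume M: "M \<in> mons"
  show "g (mon_elt M) = 0"
  proof (rule ccontr)
    assume "g (mon_elt M) \<noteq> 0"
    then obtain m where m: "m \<in> keys (g (mon_elt M))" by (metis keys_eq_empty ex_in_conv)
    note k = homs_keys[OF g M m]
    have "card Podd \<le> card B" using finite_B by (intro card_mono) (auto simp: Podd_def)
    then have "tau m - tau M \<le> n + int (card B)"
      using tau_vmons[OF k(1)] k(2) podd_vmons(2)[OF k(1)] by (simp add: tau_def gweight_def)
    then show False using shiftsD[OF s M m] w by simp
  qed
qed

end

text \<open>The bound in \<open>\<delta>_vgen\<close> expresses decomposability, as
  \<open>omega\<close> is \<open>cmax\<close> times the word length on \<Lambda>V. In
  \<open>\<delta>_sgen\<close> the element is s(dv), where one factor of weight \<open>cmax\<close>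
  has been replaced by a suspended one of weight at least 1.\<close>

locale koszul_complex = gca B deg for B :: "'v::linorder set" and deg :: "'v \<Rightarrow> nat" +
  fixes \<delta> :: "('v, 'k::field_char_0) elt \<Rightarrow> ('v, 'k) elt"
  assumes deriv_\<delta>: "deriv 1 \<delta>" and \<delta>_Y: "y \<in> Y \<Longrightarrow> \<delta> y \<in> Y" and \<delta>_\<delta>: "x \<in> X \<Longrightarrow> \<delta> (\<delta> x) = 0"
    and \<delta>_vgen: "v \<in> B \<Longrightarrow> m \<in> keys (\<delta> (vgen v)) \<Longrightarrow> omega m \<ge> 2 * cmax"
    and \<delta>_sgen: "v \<in> B \<Longrightarrow> m \<in> keys (vgen v - \<delta> (sgen v)) \<Longrightarrow> omega m \<ge> cmax + 1"
    and tau_\<delta>: "shifts tau {0..} \<delta>"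
begin

section \<open>The homotopies and the leading term of their commutator with D\<close>

lemmas lin_\<delta> = derivD(1)[OF deriv_\<delta>] and \<delta>_X = derivD(2)[OF deriv_\<delta>]

text \<open>The graded commutator of \<delta> with the contraction, as in Cartan's formula for the
  Lie derivative.\<close>

definition theta :: "'v \<Rightarrow> ('v, 'k) elt \<Rightarrow> ('v, 'k) elt" where
  "theta p x = \<delta> (contr p x) + contr p (\<delta> x)"

definition htpy :: "'v \<Rightarrow> int \<Rightarrow> (('v, 'k) elt \<Rightarrow> ('v, 'k) elt) \<Rightarrow> ('v, 'k) elt \<Rightarrow> ('v, 'k) elt" where
  "htpy p n g = D (contr p) n (premult p g)"

lemma PoddD: "p \<in> Podd \<Longrightarrow> p \<in> B" "p \<in> Podd \<Longrightarrow> odd (deg p)" by (simp_all add: Podd_def)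

lemma theta_sder_deriv: "p \<in> Podd \<Longrightarrow> deriv (1 - int (deg p)) (\<lambda>x. theta p x - sder p x)"
  using anticommutator_deriv[OF deriv_\<delta> contr_deriv, of p] sder_deriv[of p]
  by (intro deriv_minus) (simp_all add: PoddD theta_def)

lemma contr_vgen: "contr p (vgen v) = (if v = p then mon_elt 0 else (0 :: ('v, 'k) elt))"
  if "odd (deg p)"
proof -
  have "odd_keys deg (single (Inl p) 1) = {Inl p}" using that by (auto simp: odd_keys_def)
  then show ?thesis by (auto simp: vgen_def contr_mon lsign_def)
qed

lemma contr_sgen: "contr p (sgen v) = (0 :: ('v, 'k) elt)"
  by (simp add: sgen_def contr_mon)

text \<open>Contraction removes one \<open>cmax\<close>. Thus v goes to a contraction of dv, of
  weight at least \<open>cmax\<close>, and sv to a contraction of v - s(dv), where s(dv) contributes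
  weight at least 1 against \<open>omega\<close> at most 2 for sv. The remaining term sp \<mapsto>
  1, of shift - 2, is exactly the one that \<open>sder p\<close> takes away.\<close>

lemma theta_sder_omega: "p \<in> Podd \<Longrightarrow> shifts omega {-1..} (\<lambda>x. theta p x - sder p x)"
proof (rule deriv_shifts[OF theta_sder_deriv additive_omega], assumption)
  fix g m assume p: "p \<in> Podd" and g: "g \<in> Inl ` B \<union> Inr ` B"
    and m: "m \<in> keys (theta p (mon_elt (single g 1)) - sder p (mon_elt (single g 1)))"
  have c: "\<exists>n\<in>keys y. omega m = omega n - cmax" if "m \<in> keys (contr p y :: ('v, 'k) elt)" "y \<in> X" for y
    using shifts_elt[OF contr_shifts[OF additive_omega] contr_lin that(2,1)] by force
  from g show "omega m - omega (single g 1) \<in> {-1..}"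
  proof
    assume "g \<in> Inl ` B"
    then obtain v where v: "g = Inl v" "v \<in> B" by blast
    have "sder p (mon_elt (single g 1)) = (0 :: ('v, 'k) elt)" using v by (simp add: sder_mon lookup_single)
    moreover have "\<delta> (contr p (vgen v)) = 0"
      using p by (simp add: contr_vgen PoddD deriv_1[OF deriv_\<delta>] lin_0[OF lin_\<delta>])
    ultimately have "m \<in> keys (contr p (\<delta> (vgen v)))" using m v by (simp add: theta_def vgen_def)
    then obtain n where "n \<in> keys (\<delta> (vgen v))" "omega m = omega n - cmax"
      using c \<delta>_X Y_X[OF vgen_Y[OF v(2)]] by blast
    then show ?thesis using \<delta>_vgen[OF v(2)] v by fastforce
  next
    assume "g \<in> Inr ` B"
    then obtain v where v: "g = Inr v" "v \<in> B" by blast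
    let ?z = "vgen v - \<delta> (sgen v) :: ('v, 'k) elt"
    have X: "(vgen v :: ('v, 'k) elt) \<in> X" "\<delta> (sgen v) \<in> X" "?z \<in> X" using Y_X[OF vgen_Y[OF v(2)]] \<delta>_X[OF sgen_X[OF v(2)]] by auto
    have "theta p (sgen v) = contr p (\<delta> (sgen v))"
      by (simp add: theta_def contr_sgen lin_0[OF lin_\<delta>])
    also have "\<dots> = contr p (vgen v) - contr p ?z" using X by (simp add: lin_diff[OF contr_lin])
    finally have "theta p (sgen v) - sder p (sgen v) = - contr p ?z"
      using p by (auto simp: contr_vgen PoddD sgen_def sder_mon lookup_single when_def)
    then have "m \<in> keys (contr p ?z)" using m v by (simp add: sgen_def keys_minus)
    then obtain n where "n \<in> keys ?z" "omega m = omega n - cmax" using c X by blast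
    then show ?thesis using \<delta>_sgen[OF v(2)] v by fastforce
  qed
qed

lemma htpy_homs:
  assumes p: "p \<in> Podd" and g: "g \<in> A n"
  shows "htpy p n g \<in> A (n - 1)"
proof -
  note pB = PoddD[OF p]
  have ev: "even (n - (n + int (deg p) - 1))" using pB(2) by simp
  have o: "odd (- int (deg p))" using pB(2) by simp
  have "D (contr p) (n + int (deg p) - 1) (premult p g) \<in> A (n + int (deg p) - 1 + - int (deg p))"
    by (rule D_homs[OF contr_deriv[OF pB(2)] _ o premult_homs[OF pB g]]) (rule contr_Y)
  then show ?thesis unfolding htpy_def D_parity[OF ev] by simp
qed

text \<open>The gain in \<open>tau\<close> from multiplying by sp equals the loss from contracting
  p.\<close>

lemma htpy_tau:
  assumes p: "p \<in> Podd" and g: "g \<in> A n" "shifts tau {w..} g"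
  shows "shifts tau {w..} (htpy p n g)"
proof -
  note pB = PoddD[OF p]
  let ?t = "tau (single (Inr p) 1)"
  have t: "tau (single (Inl p) 1) = ?t" using pB odd_pos[of "deg p"] by (simp add: of_nat_diff)
  have s: "shifts tau {w + ?t..} (premult p g)"
    by (rule premult_shifts[OF additive_tau pB(1) g]) simp
  show ?thesis unfolding htpy_def
    by (rule D_shifts[OF contr_deriv[OF pB(2)] contr_shifts[OF additive_tau] premult_homs[OF pB g(1)] s])
      (simp add: t del: tau_single)
qed

definition Phi :: "int \<Rightarrow> (('v, 'k) elt \<Rightarrow> ('v, 'k) elt) \<Rightarrow> ('v, 'k) elt \<Rightarrow> ('v, 'k) elt" where
  "Phi n g x = (\<Sum>p\<in>Podd. D \<delta> (n - 1) (htpy p n g) x + htpy p (n + 1) (D \<delta> n g) x)"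

lemma D_\<delta>_homs: "g \<in> A n \<Longrightarrow> D \<delta> n g \<in> A (n + 1)"
  using D_homs[OF deriv_\<delta> \<delta>_Y] by simp

lemma D_htpy_homs:
  assumes "p \<in> Podd" "g \<in> A n"
  shows "D \<delta> (n - 1) (htpy p n g) \<in> A n" "htpy p (n + 1) (D \<delta> n g) \<in> A n"
  using D_\<delta>_homs[OF htpy_homs[OF assms]] htpy_homs[OF assms(1) D_\<delta>_homs[OF assms(2)]] by simp_all

lemma Phi_homs:
  assumes "g \<in> A n"
  shows "Phi n g \<in> A n"
proof -
  have "(\<lambda>x. \<Sum>p\<in>Podd. D \<delta> (n - 1) (htpy p n g) x + htpy p (n + 1) (D \<delta> n g) x) \<in> A n"
    by (rule homs_sum[where g = "\<lambda>p x. D \<delta> (n - 1) (htpy p n g) x + htpy p (n + 1) (D \<delta> n g) x"])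
      (rule homs_add[OF D_htpy_homs(1)[OF _ assms] D_htpy_homs(2)[OF _ assms]])
  then show ?thesis by (simp add: Phi_def[abs_def])
qed

lemma Phi_tau:
  assumes g: "g \<in> A n" "shifts tau {w..} g"
  shows "shifts tau {w..} (Phi n g)"
proof -
  have "shifts tau {w..} (\<lambda>x. D \<delta> (n - 1) (htpy p n g) x + htpy p (n + 1) (D \<delta> n g) x)" if p: "p \<in> Podd" for p
  proof (rule shifts_plus)
    show "shifts tau {w..} (D \<delta> (n - 1) (htpy p n g))"
      by (rule D_shifts[OF deriv_\<delta> tau_\<delta> htpy_homs[OF p g(1)] htpy_tau[OF p g]]) auto
    have "shifts tau {w..} (D \<delta> n g)" by (rule D_shifts[OF deriv_\<delta> tau_\<delta> g]) auto
    then show "shifts tau {w..} (htpy p (n + 1) (D \<delta> n g))"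
      by (rule htpy_tau[OF p D_\<delta>_homs[OF g(1)]])
  qed
  then have "shifts tau {w..} (\<lambda>x. \<Sum>p\<in>Podd. D \<delta> (n - 1) (htpy p n g) x + htpy p (n + 1) (D \<delta> n g) x)"
    by (rule shifts_Sum)
  then show ?thesis by (simp add: Phi_def[abs_def])
qed

lemma htpy_diff:
  assumes p: "p \<in> Podd" and g: "g \<in> A n" and h: "h \<in> A n"
  shows "htpy p k (\<lambda>x. g x - h x) = (\<lambda>x. htpy p k g x - htpy p k h x)"
  unfolding htpy_def premult_diff
  by (rule D_diff[OF contr_deriv[OF PoddD(2)[OF p]] premult_homs[OF PoddD[OF p] g] premult_homs[OF PoddD[OF p] h]])

lemma htpy_zero: "p \<in> Podd \<Longrightarrow> htpy p n (\<lambda>x. 0) = (\<lambda>x. 0)"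
  unfolding htpy_def premult_zero by (rule D_zero[OF contr_deriv[OF PoddD(2)]])

lemma Phi_diff:
  assumes g: "g \<in> A n" and h: "h \<in> A n"
  shows "Phi n (\<lambda>x. g x - h x) = (\<lambda>x. Phi n g x - Phi n h x)"
proof
  fix x
  show "Phi n (\<lambda>x. g x - h x) x = Phi n g x - Phi n h x"
    unfolding Phi_def sum_subtractf[symmetric]
    by (rule sum.cong[OF refl])
      (simp add: htpy_diff[OF _ g h] D_diff[OF deriv_\<delta> htpy_homs[OF _ g] htpy_homs[OF _ h]]
        D_diff[OF deriv_\<delta> g h] htpy_diff[OF _ D_\<delta>_homs[OF g] D_\<delta>_homs[OF h]])
qed

lemma D_sum: "(\<And>i. i \<in> I \<Longrightarrow> g i \<in> A k) \<Longrightarrow> D \<delta> n (\<lambda>x. \<Sum>i\<in>I. g i x) = (\<lambda>x. \<Sum>i\<in>I. D \<delta> n (g i) x)"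
proof (induct I rule: infinite_finite_induct)
  case (insert i I)
  have "D \<delta> n (\<lambda>x. g i x + (\<Sum>i\<in>I. g i x)) = (\<lambda>x. D \<delta> n (g i) x + D \<delta> n (\<lambda>x. \<Sum>i\<in>I. g i x) x)"
    by (rule D_add[OF deriv_\<delta>]) (use insert in \<open>auto intro: homs_sum\<close>)
  then show ?case using insert by simp
qed (simp_all add: D_zero[OF deriv_\<delta>])

lemma D_D_\<delta>: "g \<in> A n \<Longrightarrow> D \<delta> (n + 1) (D \<delta> n g) = (\<lambda>x. 0)"
  by (rule D_D[OF deriv_\<delta> \<delta>_\<delta>])

lemma D_D_\<delta>': "g \<in> A (n - 1) \<Longrightarrow> D \<delta> n (D \<delta> (n - 1) g) = (\<lambda>x. 0)"
  using D_D_\<delta>[of g "n - 1"] by simp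

text \<open>Since D squares to zero, both sides reduce to D h D, the usual argument for
  null-homotopic maps.\<close>

lemma Phi_D:
  assumes g: "g \<in> A n"
  shows "Phi (n + 1) (D \<delta> n g) = D \<delta> n (Phi n g)"
proof -
  have "D \<delta> n (Phi n g) = (\<lambda>x. \<Sum>p\<in>Podd. D \<delta> n (\<lambda>x. D \<delta> (n - 1) (htpy p n g) x + htpy p (n + 1) (D \<delta> n g) x) x)"
    unfolding Phi_def using D_\<delta>_homs[OF htpy_homs[OF _ g]] htpy_homs[OF _ D_\<delta>_homs[OF g]]
    by (intro D_sum) (auto intro!: homs_add)
  also have "\<dots> = (\<lambda>x. \<Sum>p\<in>Podd. D \<delta> n (htpy p (n + 1) (D \<delta> n g)) x)"
  proof (intro ext sum.cong refl)
    fix p x assume p: "p \<in> Podd"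
    have "D \<delta> (n - 1) (htpy p n g) \<in> A n" "htpy p (n + 1) (D \<delta> n g) \<in> A n"
      using D_\<delta>_homs[OF htpy_homs[OF p g]] htpy_homs[OF p D_\<delta>_homs[OF g]] by simp_all
    then show "D \<delta> n (\<lambda>x. D \<delta> (n - 1) (htpy p n g) x + htpy p (n + 1) (D \<delta> n g) x) x = D \<delta> n (htpy p (n + 1) (D \<delta> n g)) x"
      by (simp add: D_add[OF deriv_\<delta>] D_D_\<delta>'[OF htpy_homs[OF p g]])
  qed
  also have "\<dots> = Phi (n + 1) (D \<delta> n g)"
    by (simp add: Phi_def fun_eq_iff D_D_\<delta>[OF g] htpy_zero)
  finally show ?thesis ..
qed

lemma Phi_cohomologous:
  assumes g: "g \<in> A n" and w: "shifts tau {w..} (D \<delta> n g)"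
  obtains b where "b \<in> A (n - 1)" "shifts tau {w..} (\<lambda>x. Phi n g x - D \<delta> (n - 1) b x)"
proof
  let ?b = "\<lambda>x. \<Sum>p\<in>Podd. htpy p n g x"
  show "?b \<in> A (n - 1)" using htpy_homs[OF _ g] by (rule homs_sum)
  have "D \<delta> (n - 1) ?b = (\<lambda>x. \<Sum>p\<in>Podd. D \<delta> (n - 1) (htpy p n g) x)"
    using htpy_homs[OF _ g] by (rule D_sum)
  then have "(\<lambda>x. Phi n g x - D \<delta> (n - 1) ?b x) = (\<lambda>x. \<Sum>p\<in>Podd. htpy p (n + 1) (D \<delta> n g) x)"
    by (simp add: Phi_def sum.distrib)
  then show "shifts tau {w..} (\<lambda>x. Phi n g x - D \<delta> (n - 1) ?b x)"
    using htpy_tau[OF _ D_\<delta>_homs[OF g] w] by (simp add: shifts_Sum)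
qed

text \<open>Write h for the homotopy of p. In Dh + hD the terms containing
  \<open>contr p (g (sp * \<delta> x))\<close> or \<open>\<delta> (g (sp * contr p x))\<close>
  cancel. What remains is a commutator with \<open>theta p\<close> and the terms with \<delta>(sp) =
  p - \<zeta>. There p, and the part \<open>sder p\<close> of \<open>theta p\<close>, count
  exponents; the last bracket collects the rest.\<close>

lemma Phi_summand:
  assumes p: "p \<in> Podd" and g: "g \<in> A n" and M: "M \<in> mons"
  defines "x \<equiv> mon_elt M :: ('v, 'k) elt" and "\<zeta> \<equiv> vgen p - \<delta> (sgen p)"
  shows "D \<delta> (n - 1) (htpy p n g) x + htpy p (n + 1) (D \<delta> n g) x =
    gmul deg (vgen p) (contr p (g x)) - smul (of_nat (lookup M (Inl p) + lookup M (Inr p) + 1)) (g x)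
    + ((theta p (premult p g x) - sder p (premult p g x)) - premult p g (theta p x - sder p x)
       + (smul (psgn n) (contr p (g (gmul deg \<zeta> x))) + g (gmul deg \<zeta> (contr p x))))"
proof -
  let ?s = "gmul deg (sgen p) :: ('v, 'k) elt \<Rightarrow> ('v, 'k) elt" and ?\<eta> = "\<delta> (sgen p)"
  note pB = PoddD[OF p] and lg = homsD(1)[OF g]
  have X [simp]: "x \<in> X" "\<And>y. y \<in> X \<Longrightarrow> \<delta> y \<in> X" "\<And>y. y \<in> X \<Longrightarrow> contr p y \<in> X" "\<And>y. y \<in> X \<Longrightarrow> g y \<in> X"
      "\<And>y. y \<in> X \<Longrightarrow> ?s y \<in> X" "\<And>y. y \<in> X \<Longrightarrow> gmul deg ?\<eta> y \<in> X" "vgen p \<in> X" "vgen p \<in> Y"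
      "\<And>y. y \<in> X \<Longrightarrow> gmul deg (vgen p) y \<in> X"
      "\<And>y. y \<in> X \<Longrightarrow> sder p y \<in> X" "\<And>y. y \<in> X \<Longrightarrow> theta p y \<in> X"
    using M \<delta>_X contr_X homsD(3)[OF g] sgen_X[OF pB(1)] vgen_Y[OF pB(1)] Y_X[OF vgen_Y[OF pB(1)]] sder_X
    by (auto simp: x_def theta_def)
  have hs: "homog deg (int (deg p - 1)) (sgen p :: ('v, 'k) elt)" by (simp add: sgen_def)
  have ev: "even (int (deg p - 1))" using pB by simp
  have \<delta>s: "\<delta> (?s y) = gmul deg ?\<eta> y + ?s (\<delta> y)" if "y \<in> X" for y
    using deriv_gmul[OF deriv_\<delta> sgen_X[OF pB(1)] hs that] ev by simp
  have sg: "psgn (n - 1 + 1) = (psgn n :: 'k)" "psgn (n + 1) = (- psgn n :: 'k)" "psgn (2 + n) = (psgn n :: 'k)"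
    by (auto simp: psgn_def)
  note lin = lin_add[OF lin_\<delta>] lin_add[OF contr_lin] lin_add[OF lg] lin_diff[OF lin_\<delta>] lin_diff[OF contr_lin] lin_diff[OF lg]
    lin_smul[OF lin_\<delta>] lin_smul[OF contr_lin] lin_smul[OF lg] lin_uminus[OF lin_\<delta>] lin_uminus[OF contr_lin] lin_uminus[OF lg]
  have htpy: "htpy p k h y = contr p (h (?s y)) + smul (psgn (k + 1)) (h (?s (contr p y)))" if "y \<in> X" for k h y
    using that by (simp add: htpy_def D_apply premult_def)
  have 1: "D \<delta> (n - 1) (htpy p n g) x = \<delta> (contr p (g (?s x))) - smul (psgn n) (\<delta> (g (?s (contr p x))))
     + smul (psgn n) (contr p (g (?s (\<delta> x)))) - g (?s (contr p (\<delta> x)))"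
    by (simp add: D_apply htpy sg lin smul.scale_right_diff_distrib)
  have 2: "htpy p (n + 1) (D \<delta> n g) x = contr p (\<delta> (g (?s x))) - smul (psgn n) (contr p (g (gmul deg ?\<eta> x)))
     - smul (psgn n) (contr p (g (?s (\<delta> x)))) + smul (psgn n) (\<delta> (g (?s (contr p x))))
     - g (gmul deg ?\<eta> (contr p x)) - g (?s (\<delta> (contr p x)))"
    by (simp add: D_apply htpy sg lin \<delta>s smul.scale_right_diff_distrib smul.scale_right_distrib)
  have \<eta>: "gmul deg ?\<eta> y = gmul deg (vgen p) y - gmul deg \<zeta> y" for y
    by (simp add: \<zeta>_def gmul_diff_left)
  have \<zeta>X: "gmul deg \<zeta> y \<in> X" if "y \<in> X" for y
    using that by (auto simp: \<zeta>_def gmul_diff_left)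
  have hv: "homog deg (int (deg p)) (vgen p :: ('v, 'k) elt)" by (simp add: vgen_def)
  have pn: "psgn (n * int (deg p)) = (psgn n :: 'k)" using pB by (auto simp: psgn_def)
  have "contr p (gmul deg (vgen p) (g x)) = g x - gmul deg (vgen p) (contr p (g x))"
    using deriv_gmul[OF contr_deriv[OF pB(2)] X(7) hv, of "g x"] pB
    by (simp add: contr_vgen gmul_1_left)
  then have 3: "smul (psgn n) (contr p (g (gmul deg (vgen p) x))) = g x - gmul deg (vgen p) (contr p (g x))"
    using homsD(6)[OF g X(8,1) hv] by (simp add: pn lin)
  have 4: "g (gmul deg (vgen p) (contr p x)) = smul (of_nat (lookup M (Inl p))) (g x)"
    using vgen_contr[OF pB M, where 'k='k] M by (simp add: x_def lin)
  have 5: "g (?s (sder p x)) = smul (of_nat (lookup M (Inr p))) (g x)"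
    using sgen_sder[OF pB M, where 'k='k] M by (simp add: x_def lin)
  \<comment> \<open>Values of maps contain no sp, so \<open>sder p\<close> may be subtracted from
    \<open>theta p\<close> on the side of the values as well, which brings the better estimate for
    the difference into play.\<close>
  have 6: "sder p y = 0" if "y \<in> Y" for y :: "('v, 'k) elt"
  proof -
    have "sder p (mon_elt m) = (0 :: ('v, 'k) elt)" if "m \<in> keys y" for m
    proof -
      have "Inr p \<notin> keys m" using that \<open>y \<in> Y\<close> by (auto simp: Y_iff vmons_def)
      then show ?thesis by (simp add: sder_mon in_keys_iff)
    qed
    then show ?thesis unfolding lin_expand[OF sder_lin Y_X[OF that]] by simp
  qed
  have 7: "premult p g y = g (?s y)" if "y \<in> X" for y using that by (simp add: premult_def)
  have 8: "g (?s (theta p x - sder p x)) = g (?s (\<delta> (contr p x))) + g (?s (contr p (\<delta> x))) - g (?s (sder p x))"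
    by (simp add: theta_def gmul_add_right gmul_diff_right lin)
  have t: "theta p (g (?s x)) = \<delta> (contr p (g (?s x))) + contr p (\<delta> (g (?s x)))" by (simp add: theta_def)
  have "D \<delta> (n - 1) (htpy p n g) x + htpy p (n + 1) (D \<delta> n g) x
    = theta p (g (?s x)) - g (?s (contr p (\<delta> x))) - g (?s (\<delta> (contr p x)))
      - smul (psgn n) (contr p (g (gmul deg ?\<eta> x))) - g (gmul deg ?\<eta> (contr p x))"
    unfolding 1 2 t by simp
  also have "\<dots> = theta p (g (?s x)) - g (?s (contr p (\<delta> x))) - g (?s (\<delta> (contr p x)))
      - (g x - gmul deg (vgen p) (contr p (g x)) - smul (psgn n) (contr p (g (gmul deg \<zeta> x))))
      - (smul (of_nat (lookup M (Inl p))) (g x) - g (gmul deg \<zeta> (contr p x)))"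
    unfolding \<eta> by (simp add: lin \<zeta>X smul.scale_right_diff_distrib 3 4)
  also have "\<dots> = theta p (g (?s x)) - g (?s (theta p x - sder p x))
      + gmul deg (vgen p) (contr p (g x)) + smul (psgn n) (contr p (g (gmul deg \<zeta> x))) + g (gmul deg \<zeta> (contr p x))
      - (g x + smul (of_nat (lookup M (Inl p))) (g x) + smul (of_nat (lookup M (Inr p))) (g x))"
    unfolding 8 5 by simp
  finally show ?thesis
    by (simp add: 7 6 homsD(2)[OF g] smul.scale_left_distrib)
qed

text \<open>Every error term of \<open>Phi_summand\<close> gains 1 in \<open>omega\<close>: sp
  contributes 2 and \<open>theta p - sder p\<close> loses at most 1; \<zeta> contributes at least
  \<open>cmax + 1\<close> and the contraction loses \<open>cmax\<close>.\<close>

lemma Phi_leading: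
  assumes g: "g \<in> A n" and j: "shifts omega {j..} g"
  shows "shifts omega {j + 1..} (\<lambda>x. Phi n g x + rescale podd (\<lambda>z. of_int (int (card Podd) - z)) g x)"
proof -
  define \<zeta> where "\<zeta> p = (vgen p - \<delta> (sgen p) :: ('v, 'k) elt)" for p
  define \<Psi> where "\<Psi> p x = (theta p (premult p g x) - sder p (premult p g x)) - premult p g (theta p x - sder p x)
       + (smul (psgn n) (contr p (g (gmul deg (\<zeta> p) x))) + g (gmul deg (\<zeta> p) (contr p x)))" for p x
  have "shifts omega {j + 1..} (\<Psi> p)" if p: "p \<in> Podd" for p
  proof -
    note pB = PoddD[OF p] and lg = homsD(1)[OF g]
    have pm: "premult p g \<in> A (n + int (deg p) - 1)" by (rule premult_homs[OF pB g])
    have s2: "shifts omega {j + 2..} (premult p g)"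
      by (rule premult_shifts[OF additive_omega pB(1) g j]) (use pB in auto)
    have \<zeta>: "\<zeta> p \<in> X" unfolding \<zeta>_def using Y_X[OF vgen_Y] \<delta>_X[OF sgen_X] pB by auto
    note E = theta_sder_omega[OF p] derivD[OF theta_sder_deriv[OF p]]
    have c: "shifts omega {- cmax} (contr p :: ('v, 'k) elt \<Rightarrow> _)"
      using contr_shifts[OF additive_omega, of p] by simp
    have z: "shifts omega {cmax + 1..} (gmul deg (\<zeta> p))"
      by (rule shifts_gmul[OF additive_omega]) (use \<delta>_sgen[OF pB(1)] in \<open>auto simp: \<zeta>_def\<close>)
    have zX: "gmul deg (\<zeta> p) x \<in> X" if "x \<in> X" for x using that \<zeta> by blast
    have gz: "shifts omega {j + cmax + 1..} (\<lambda>x. g (gmul deg (\<zeta> p) x))"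
      by (rule shifts_comp[OF j z lg zX]) auto
    have t1: "shifts omega {j + 1..} (\<lambda>x. theta p (premult p g x) - sder p (premult p g x))"
      by (rule shifts_comp[OF E(1) s2 E(2) homsD(3)[OF pm]]) auto
    have t2: "shifts omega {j + 1..} (\<lambda>x. premult p g (theta p x - sder p x))"
      by (rule shifts_comp[OF s2 E(1) homsD(1)[OF pm] E(3)]) auto
    have t3: "shifts omega {j + 1..} (\<lambda>x. contr p (g (gmul deg (\<zeta> p) x)))"
      by (rule shifts_comp[OF c gz contr_lin homsD(3)[OF g]]) auto
    have zl: "linear_map_on X (\<lambda>x. g (gmul deg (\<zeta> p) x))" by (rule lin_comp[OF lg lin_gmul zX])
    have t4: "shifts omega {j + 1..} (\<lambda>x. g (gmul deg (\<zeta> p) (contr p x)))"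
      by (rule shifts_comp[OF gz c zl contr_X]) auto
    have "shifts omega {j + 1..} (\<lambda>x. (theta p (premult p g x) - sder p (premult p g x)) - premult p g (theta p x - sder p x)
       + (smul (psgn n) (contr p (g (gmul deg (\<zeta> p) x))) + g (gmul deg (\<zeta> p) (contr p x))))"
      by (rule shifts_plus[OF shifts_minus[OF t1 t2] shifts_plus[OF shifts_scale[OF t3] t4]])
    then show ?thesis unfolding \<Psi>_def .
  qed
  then have S: "shifts omega {j + 1..} (\<lambda>x. \<Sum>p\<in>Podd. \<Psi> p x)" by (rule shifts_Sum)
  have "Phi n g (mon_elt M) + rescale podd (\<lambda>z. of_int (int (card Podd) - z)) g (mon_elt M) = (\<Sum>p\<in>Podd. \<Psi> p (mon_elt M))"
    if M: "M \<in> mons" for M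
  proof -
    let ?y = "g (mon_elt M)"
    define N where "N p = gmul deg (vgen p) (contr p ?y) - smul (of_nat (lookup M (Inl p) + lookup M (Inr p) + 1)) ?y" for p
    have "Phi n g (mon_elt M) = (\<Sum>p\<in>Podd. N p + \<Psi> p (mon_elt M))"
      unfolding Phi_def N_def \<Psi>_def \<zeta>_def by (intro sum.cong refl Phi_summand[OF _ g M])
    \<comment> \<open>Over all odd p the diagonal coefficients add up to
      \<open>podd m - podd M - int (card Podd)\<close>, the summands 1 giving the
      cardinality.\<close>
    moreover have "(\<Sum>p\<in>Podd. N p) = - rescale podd (\<lambda>z. of_int (int (card Podd) - z)) g (mon_elt M)"
    proof (rule poly_mapping_eqI)
      fix m
      show "lookup (\<Sum>p\<in>Podd. N p) m = lookup (- rescale podd (\<lambda>z. of_int (int (card Podd) - z)) g (mon_elt M)) m"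
      proof (cases "m \<in> keys ?y")
        case True
        then have m: "m \<in> vmons" using homs_keys(1)[OF g M] by blast
        have "lookup (\<Sum>p\<in>Podd. N p) m = (\<Sum>p\<in>Podd. (of_nat (lookup m (Inl p)) - of_nat (lookup M (Inl p) + lookup M (Inr p) + 1)) * lookup ?y m)"
          unfolding lookup_sum N_def
          by (intro sum.cong refl) (simp add: lookup_minus vgen_contr_lookup[OF PoddD] homsD(3)[OF g] left_diff_distrib)
        also have "\<dots> = of_int (podd m - podd M - int (card Podd)) * lookup ?y m"
          unfolding podd_vmons(1)[OF m] podd_eq[OF M] by (simp add: sum_distrib_right[symmetric] sum_subtractf sum.distrib)
        finally show ?thesis using M by (simp add: rescale_mon algebra_simps)
      next
        case False
        have "lookup (\<Sum>p\<in>Podd. N p) m = 0"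
          unfolding lookup_sum N_def using False
          by (intro sum.neutral ballI) (simp add: lookup_minus vgen_contr_lookup[OF PoddD] homsD(3)[OF g] in_keys_iff)
        then show ?thesis using M False by (simp add: rescale_mon in_keys_iff)
      qed
    qed
    ultimately show ?thesis by (simp add: sum.distrib)
  qed
  then show ?thesis using S by (simp add: shifts_def)
qed

section \<open>Inversion of \<open>Phi\<close> in low filtration degree\<close>

abbreviation eig :: "int \<Rightarrow> 'k" where "eig z \<equiv> of_int (int (card Podd) - z)"

lemma low_part_zero: "g \<in> A n \<Longrightarrow> shifts tau {w..} g \<Longrightarrow> part tau {..<w} g = (\<lambda>x. 0)"
  by (rule part_disjoint[OF _ additive_tau]) auto

lemma low_part_complement:
  assumes "g \<in> A n"
  shows "(\<lambda>x. g x - part tau {..<w} g x) = part tau {w..} g"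
proof
  fix x
  have "g = (\<lambda>x. part tau {..<w} g x + part tau {w..} g x)"
    by (rule part_split[OF assms additive_tau]) (auto simp: shifts_def)
  from fun_cong[OF this, of x] show "g x - part tau {..<w} g x = part tau {w..} g x"
    unfolding diff_eq_eq by (simp only: add.commute)
qed

text \<open>Below the threshold the eigenvalues are nonzero integers by
  \<open>eigenvalue_nonzero\<close>, hence invertible in characteristic zero.\<close>

lemma rescale_eig_inverse:
  assumes e: "e \<in> A n" "shifts tau {..<w} e" and w: "w \<le> n - int (card B)"
  shows "rescale podd eig (rescale podd (\<lambda>z. inverse (eig z)) e) = e"
    "rescale podd (\<lambda>z. inverse (eig z)) (rescale podd eig e) = e"
proof -
  have s: "shifts podd {z. z \<noteq> int (card Podd)} e"
    unfolding shifts_def using eigenvalue_nonzero[OF e(1)] shiftsD[OF e(2)] w by fastforce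
  have nz: "eig z \<noteq> 0" if "z \<in> {z. z \<noteq> int (card Podd)}" for z
    using that unfolding of_int_eq_0_iff by simp
  have "rescale podd (\<lambda>z. eig z * inverse (eig z)) e = rescale podd (\<lambda>z. 1) e"
    by (rule rescale_eqI[OF e(1) additive_podd s]) (use nz in simp)
  then show "rescale podd eig (rescale podd (\<lambda>z. inverse (eig z)) e) = e"
    "rescale podd (\<lambda>z. inverse (eig z)) (rescale podd eig e) = e"
    by (simp_all add: rescale_rescale[OF e(1) additive_podd] rescale_1[OF e(1) additive_podd] mult.commute)
qed

lemma Phi_omega:
  assumes g: "g \<in> A n" and j: "shifts omega {j..} g"
  shows "shifts omega {j..} (Phi n g)"
proof -
  have "shifts omega {j..} (\<lambda>x. Phi n g x + rescale podd eig g x)"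
    by (rule shifts_mono[OF Phi_leading[OF g j]]) auto
  from shifts_minus[OF this rescale_shifts[OF j, of podd eig]] show ?thesis by simp
qed

text \<open>Inverse of the leading term of \<open>Phi\<close>, which is minus the rescaling by
  \<open>eig\<close>. At eigenvalue 0 the factor is \<open>inverse 0 = 0\<close>; maps of low
  filtration degree have no such component.\<close>

definition Phi_inv :: "(('v, 'k) elt \<Rightarrow> ('v, 'k) elt) \<Rightarrow> ('v, 'k) elt \<Rightarrow> ('v, 'k) elt" where
  "Phi_inv e x = - rescale podd (\<lambda>z. inverse (eig z)) e x"

lemma Phi_inv_homs: "e \<in> A n \<Longrightarrow> Phi_inv e \<in> A n"
  unfolding Phi_inv_def[abs_def] by (rule homs_uminus[OF rescale_homs[OF additive_podd]])

lemma Phi_inv_omega: "shifts omega {j..} e \<Longrightarrow> shifts omega {j..} (Phi_inv e)"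
  using shifts_scale[OF rescale_shifts, of omega "{j..}" e "- 1"] by (simp add: Phi_inv_def[abs_def])

lemma Phi_Phi_inv:
  assumes e: "e \<in> A n" "shifts tau {..<w} e" and w: "w \<le> n - int (card B)" and j: "shifts omega {j..} e"
  shows "shifts omega {j + 1..} (\<lambda>x. e x - Phi n (Phi_inv e) x)"
proof -
  have q: "rescale podd (\<lambda>z. inverse (eig z)) e \<in> A n" by (rule rescale_homs[OF additive_podd e(1)])
  have "rescale podd eig (Phi_inv e) = (\<lambda>x. - e x)"
    using rescale_smul[OF q additive_podd, of eig "- 1"] rescale_eig_inverse(1)[OF e w]
    by (simp add: Phi_inv_def[abs_def])
  then have "shifts omega {j + 1..} (\<lambda>x. smul (- 1) (Phi n (Phi_inv e) x - e x))"
    using shifts_scale[OF Phi_leading[OF Phi_inv_homs[OF e(1)] Phi_inv_omega[OF j]], of "- 1"] by simp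
  then show ?thesis by simp
qed

text \<open>If the low part x of g is killed modulo the filtration step, then so is its leading term
  for \<open>omega\<close>. Inverting the eigenvalues gains one step of \<open>omega\<close>, and
  repeating this forces x to be zero.\<close>

lemma Phi_inj_low:
  assumes g: "g \<in> A n" and w: "w \<le> n - int (card B)" and P: "shifts tau {w..} (Phi n g)"
  shows "shifts tau {w..} g"
proof -
  let ?x = "part tau {..<w} g" and ?y = "part tau {w..} g"
  note T = additive_tau
  have x: "?x \<in> A n" and y: "?y \<in> A n" by (rule rescale_homs[OF T g])+
  have split: "g = (\<lambda>z. ?x z + ?y z)"
    by (rule part_split[OF g T]) (auto simp: shifts_def)
  have "?x = (\<lambda>z. g z - ?y z)" by (subst (2) split) simp
  then have "Phi n ?x = (\<lambda>z. Phi n g z - Phi n ?y z)" using Phi_diff[OF g y] by simp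
  then have Px: "shifts tau {w..} (Phi n ?x)"
    using shifts_minus[OF P Phi_tau[OF y part_shifts]] by simp
  have "shifts omega {n + int k..} ?x" for k
  proof (induct k)
    case 0
    then show ?case using omega_lower[OF x] by simp
  next
    case (Suc k)
    let ?E = "rescale podd eig ?x"
    have E: "?E \<in> A n" by (rule rescale_homs[OF additive_podd x])
    have "part tau {..<w} (\<lambda>z. Phi n ?x z + ?E z) = ?E"
      unfolding rescale_add[OF Phi_homs[OF x] E T] low_part_zero[OF Phi_homs[OF x] Px]
        part_id[OF E T rescale_shifts[OF part_shifts]] by simp
    then have "shifts omega {n + int k + 1..} ?E"
      using rescale_shifts[OF Phi_leading[OF x Suc], of tau "\<lambda>z. if z \<in> {..<w} then 1 else 0"] by simp
    moreover have "n + int (Suc k) = n + int k + 1" by simp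
    ultimately show ?case
      using rescale_shifts[of omega _ ?E podd "\<lambda>z. inverse (eig z)"]
      unfolding rescale_eig_inverse(2)[OF x part_shifts w] by metis
  qed
  then have "?x = (\<lambda>z. 0)" by (rule omega_all_zero[OF x])
  moreover have "- {w..} = {..<w}" by auto
  ultimately show ?thesis by (intro shifts_by_part[OF g T]) simp
qed

text \<open>A geometric series: \<open>e k\<close> is the error after k terms and
  \<open>Phi_inv (e k)\<close> the next term. Each error is cut down to its low part, where the
  eigenvalues are invertible; what is cut off lies in the filtration step and may be
  ignored.\<close>

lemma Phi_surj_low:
  assumes c: "c \<in> A n" and w: "w \<le> n - int (card B)"
  obtains g where "g \<in> A n" "shifts tau {w..} (\<lambda>x. c x - Phi n g x)"
proof -
  note T = additive_tau
  let ?low = "part tau {..<w}"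
  define e where "e = rec_nat (?low c) (\<lambda>_ e. ?low (\<lambda>x. e x - Phi n (Phi_inv e) x))"
  have e0: "e 0 = ?low c" and eS: "e (Suc k) = ?low (\<lambda>x. e k x - Phi n (Phi_inv (e k)) x)" for k
    by (simp_all add: e_def)
  have e: "e k \<in> A n \<and> shifts tau {..<w} (e k) \<and> shifts omega {n + int k..} (e k)" for k
  proof (induct k)
    case 0
    show ?case unfolding e0
      by (intro conjI rescale_homs[OF T c] part_shifts) (simp add: omega_lower[OF rescale_homs[OF T c]])
  next
    case (Suc k)
    then have r: "shifts omega {n + int k + 1..} (\<lambda>x. e k x - Phi n (Phi_inv (e k)) x)"
      using Phi_Phi_inv[OF _ _ w] by blast
    have d: "(\<lambda>x. e k x - Phi n (Phi_inv (e k)) x) \<in> A n"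
      using Suc by (intro homs_diff Phi_homs Phi_inv_homs) simp_all
    have k: "n + int (Suc k) = n + int k + 1" by simp
    show ?case unfolding eS k using rescale_homs[OF T d] part_shifts rescale_shifts[OF r] by blast
  qed
  have r: "Phi_inv (e k) \<in> A n" "shifts omega {n + int k..} (Phi_inv (e k))" for k
    using Phi_inv_homs Phi_inv_omega e by blast+
  \<comment> \<open>From this index on \<open>n + int k\<close> exceeds the bound of
    \<open>omega_upper\<close> at M.\<close>
  have fin: "\<exists>K. \<forall>k\<ge>K. Phi_inv (e k) (mon_elt M) = 0" if M: "M \<in> mons" for M
    by (rule exI[of _ "nat (cmax * (n + gweight M) - omega M - n + 1)"])
      (intro allI impI omega_upper[OF r M], linarith)
  obtain s where s: "s \<in> A n"
    "\<And>M K. M \<in> mons \<Longrightarrow> (\<And>k. k \<ge> K \<Longrightarrow> Phi_inv (e k) (mon_elt M) = 0) \<Longrightarrow> s (mon_elt M) = (\<Sum>k<K. Phi_inv (e k) (mon_elt M))"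
  proof (rule homs_infinite_sum[OF r(1) fin], assumption)
    fix s assume "s \<in> A n" "\<And>M K. M \<in> mons \<Longrightarrow> (\<And>k. k \<ge> K \<Longrightarrow> Phi_inv (e k) (mon_elt M) = 0) \<Longrightarrow>
      s (mon_elt M) = (\<Sum>k<K. Phi_inv (e k) (mon_elt M))"
    then show thesis by (rule that)
  qed
  define S where "S K = (\<lambda>x. \<Sum>k<K. Phi_inv (e k) x)" for K
  have S: "S K \<in> A n" for K unfolding S_def by (rule homs_sum) (rule r)
  have tail: "shifts omega {n + int K..} (\<lambda>x. s x - S K x)" for K
    unfolding shifts_def
  proof (intro ballI)
    fix M m assume M: "M \<in> mons" and m: "m \<in> keys (s (mon_elt M) - S K (mon_elt M))"
    obtain L where L: "\<forall>k\<ge>L. Phi_inv (e k) (mon_elt M) = 0" using fin[OF M] by blast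
    have "s (mon_elt M) = (\<Sum>k<max K L. Phi_inv (e k) (mon_elt M))" using L by (intro s(2)[OF M]) simp
    also have "\<dots> = S K (mon_elt M) + (\<Sum>k\<in>{K..<max K L}. Phi_inv (e k) (mon_elt M))"
      unfolding S_def lessThan_atLeast0 by (rule sum.atLeastLessThan_concat[symmetric]) auto
    finally have "m \<in> keys (\<Sum>k\<in>{K..<max K L}. Phi_inv (e k) (mon_elt M))" using m by simp
    then obtain k where "k \<ge> K" "m \<in> keys (Phi_inv (e k) (mon_elt M))" by (auto dest!: subsetD[OF keys_sum])
    then show "omega m - omega M \<in> {n + int K..}" using shiftsD[OF r(2) M] by fastforce
  qed
  have approx: "shifts tau {w..} (\<lambda>x. c x - Phi n (S K) x - e K x)" for K
  proof (induct K)
    case 0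
    have "Phi n (S 0) = (\<lambda>x. 0)" using Phi_diff[OF homs_zero homs_zero] by (simp add: S_def)
    then have "(\<lambda>x. c x - Phi n (S 0) x - e 0 x) = part tau {w..} c"
      using low_part_complement[OF c, of w] by (simp only: e0 diff_0_right)
    then show ?case using part_shifts[of tau "{w..}" c] by (simp only:)
  next
    case (Suc K)
    let ?d = "\<lambda>x. e K x - Phi n (Phi_inv (e K)) x"
    have d: "?d \<in> A n" using e Phi_homs[OF r(1)] by (intro homs_diff) simp_all
    have 1: "shifts tau {w..} (\<lambda>x. ?d x - e (Suc K) x)"
      unfolding eS low_part_complement[OF d] by (rule part_shifts)
    have "S K = (\<lambda>x. S (Suc K) x - Phi_inv (e K) x)" by (simp add: S_def)
    then have "Phi n (S K) = (\<lambda>x. Phi n (S (Suc K)) x - Phi n (Phi_inv (e K)) x)"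
      using Phi_diff[OF S[of "Suc K"] r(1)[of K]] by simp
    then have "(\<lambda>x. c x - Phi n (S (Suc K)) x - e (Suc K) x)
        = (\<lambda>x. (c x - Phi n (S K) x - e K x) + (?d x - e (Suc K) x))"
      by (simp only: fun_eq_iff) simp
    then show ?case using shifts_plus[OF Suc 1] by (simp only:)
  qed
  let ?y = "?low (\<lambda>x. c x - Phi n s x)"
  have cs: "(\<lambda>x. c x - Phi n s x) \<in> A n" by (rule homs_diff[OF c Phi_homs[OF s(1)]])
  have "shifts omega {n + int K..} ?y" for K
  proof -
    \<comment> \<open>The first summand lies in the filtration step and has no low part, the second
      has \<open>omega\<close> shift at least \<open>n + int K\<close>. As K is arbitrary, the low
      part of c - \<open>Phi n s\<close> vanishes.\<close>
    let ?u = "\<lambda>x. c x - Phi n (S K) x - e K x" and ?v = "\<lambda>x. e K x - Phi n (\<lambda>x. s x - S K x) x"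
    have sS: "(\<lambda>x. s x - S K x) \<in> A n" by (rule homs_diff[OF s(1) S])
    have eK: "e K \<in> A n" using e by blast
    have u: "?u \<in> A n" by (rule homs_diff[OF homs_diff[OF c Phi_homs[OF S]] eK])
    have v: "?v \<in> A n" by (rule homs_diff[OF eK Phi_homs[OF sS]])
    have "(\<lambda>x. c x - Phi n s x) = (\<lambda>x. ?u x + ?v x)" using Phi_diff[OF s(1) S, of K] by simp
    then have "?y = (\<lambda>x. ?low ?u x + ?low ?v x)" using rescale_add[OF u v T] by (simp only:)
    also have "\<dots> = ?low ?v" by (simp only: low_part_zero[OF u approx] add_0)
    finally have "?y = ?low ?v" .
    moreover have "shifts omega {n + int K..} ?v"
      using shifts_minus[OF _ Phi_omega[OF sS tail]] e by blast
    ultimately show ?thesis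
      using rescale_shifts[of omega "{n + int K..}" ?v tau "\<lambda>z. if z \<in> {..<w} then 1 else 0"] by (simp only:)
  qed
  then have "?y = (\<lambda>x. 0)" by (rule omega_all_zero[OF rescale_homs[OF T cs]])
  moreover have "- {w..} = {..<w}" by auto
  ultimately have "shifts tau {w..} (\<lambda>x. c x - Phi n s x)" by (intro shifts_by_part[OF cs T]) simp
  then show thesis using s(1) that by blast
qed

text \<open>Modulo the filtration step c is \<open>Phi n g\<close> for some g. Then
  \<open>Phi (n + 1) (D \<delta> n g)\<close> is zero there, hence so is
  \<open>D \<delta> n g\<close> by injectivity, and \<open>Phi n g\<close> becomes a boundary
  because the other half of the homotopy formula disappears.\<close>

lemma low_acyclic:
  assumes c: "c \<in> A n" and w: "w \<le> n - int (card B)" and Dc: "shifts tau {w..} (D \<delta> n c)"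
  obtains b where "b \<in> A (n - 1)" "shifts tau {w..} (\<lambda>x. c x - D \<delta> (n - 1) b x)"
proof -
  obtain g where g: "g \<in> A n" "shifts tau {w..} (\<lambda>x. c x - Phi n g x)" using Phi_surj_low[OF c w] .
  have "D \<delta> n (\<lambda>x. c x - Phi n g x) = (\<lambda>x. D \<delta> n c x - D \<delta> n (Phi n g) x)"
    by (rule D_diff[OF deriv_\<delta> c Phi_homs[OF g(1)]])
  then have "D \<delta> n (Phi n g) = (\<lambda>x. D \<delta> n c x - D \<delta> n (\<lambda>x. c x - Phi n g x) x)" by simp
  moreover have "shifts tau {w..} (D \<delta> n (\<lambda>x. c x - Phi n g x))"
    by (rule D_shifts[OF deriv_\<delta> tau_\<delta> homs_diff[OF c Phi_homs[OF g(1)]] g(2)]) auto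
  ultimately have "shifts tau {w..} (Phi (n + 1) (D \<delta> n g))"
    using shifts_minus[OF Dc] Phi_D[OF g(1)] by simp
  then have "shifts tau {w..} (D \<delta> n g)" using w by (intro Phi_inj_low[OF D_\<delta>_homs[OF g(1)]]) simp_all
  then obtain b where b: "b \<in> A (n - 1)" "shifts tau {w..} (\<lambda>x. Phi n g x - D \<delta> (n - 1) b x)"
    by (rule Phi_cohomologous[OF g(1)])
  then show thesis using shifts_plus[OF g(2) b(2)] that[OF b(1)] by simp
qed

end

section \<open>Comparison with the pure complex\<close>

text \<open>\<open>vanishing\<close> says that the first page of the spectral sequence is
  concentrated in one bidegree; it concerns homogeneous maps. The representative f itself may have
  components of higher filtration degree.\<close>

locale filtered_koszul_complex = koszul_complex B deg \<delta>
  for B :: "'v::linorder set" and deg :: "'v \<Rightarrow> nat" and \<delta> :: "('v, 'k::field_char_0) elt \<Rightarrow> ('v, 'k) elt" +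
  fixes \<delta>s f :: "('v, 'k) elt \<Rightarrow> ('v, 'k) elt" and w0 N :: int
  assumes deriv_\<delta>s: "deriv 1 \<delta>s" and \<delta>s_Y: "y \<in> Y \<Longrightarrow> \<delta>s y \<in> Y" and \<delta>s_\<delta>s: "x \<in> X \<Longrightarrow> \<delta>s (\<delta>s x) = 0"
    and tau_\<delta>s: "shifts tau {0} \<delta>s" and tau_diff: "shifts tau {1..} (\<lambda>x. \<delta> x - \<delta>s x)"
    and vanishing: "c \<in> A k \<Longrightarrow> shifts tau {w} c \<Longrightarrow> D \<delta>s k c = (\<lambda>x. 0) \<Longrightarrow> (w, k) \<noteq> (w0, N) \<Longrightarrow>
      \<exists>b\<in>A (k - 1). c = D \<delta>s (k - 1) b"
    and f: "f \<in> A N" "shifts tau {w0..} f" "D \<delta>s N f = (\<lambda>x. 0)" "f \<notin> D \<delta>s (N - 1) ` A (N - 1)"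
    and generates: "c \<in> A N \<Longrightarrow> D \<delta>s N c = (\<lambda>x. 0) \<Longrightarrow>
      \<exists>a. \<exists>b\<in>A (N - 1). c = (\<lambda>x. smul a (f x) + D \<delta>s (N - 1) b x)"
begin

lemma Ds_homs: "g \<in> A n \<Longrightarrow> D \<delta>s n g \<in> A (n + 1)"
  using D_homs[OF deriv_\<delta>s \<delta>s_Y] by simp

lemma Ds_homs': "g \<in> A (n - 1) \<Longrightarrow> D \<delta>s (n - 1) g \<in> A n"
  using Ds_homs[of g "n - 1"] by simp

lemma D_\<delta>_homs': "g \<in> A (n - 1) \<Longrightarrow> D \<delta> (n - 1) g \<in> A n"
  using D_\<delta>_homs[of g "n - 1"] by simp

lemma Ds_Ds: "g \<in> A (n - 1) \<Longrightarrow> D \<delta>s n (D \<delta>s (n - 1) g) = (\<lambda>x. 0)"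
  using D_D[OF deriv_\<delta>s \<delta>s_\<delta>s, of g "n - 1"] by simp

lemma part_Ds: "g \<in> A n \<Longrightarrow> part tau J (D \<delta>s n g) = D \<delta>s n (part tau J g)"
  by (rule part_D[OF deriv_\<delta>s tau_\<delta>s \<delta>s_Y _ additive_tau]) simp_all

text \<open>The difference is the commutator with the derivation \<delta> - \<delta>s, which raises
  \<open>tau\<close>.\<close>

lemma D_minus_Ds:
  assumes g: "g \<in> A n" "shifts tau {w..} g"
  shows "shifts tau {w + 1..} (\<lambda>x. D \<delta> k g x - D \<delta>s k g x)"
proof -
  have "shifts tau {w + 1..} (D (\<lambda>x. \<delta> x - \<delta>s x) k g)"
    by (rule D_shifts[OF deriv_minus[OF deriv_\<delta> deriv_\<delta>s] tau_diff g]) auto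
  moreover have "D (\<lambda>x. \<delta> x - \<delta>s x) k g = (\<lambda>x. D \<delta> k g x - D \<delta>s k g x)"
    using \<delta>_X derivD(2)[OF deriv_\<delta>s]
    by (auto simp: hom_diff_def fun_eq_iff lin_diff[OF homsD(1)[OF g(1)]] smul.scale_right_diff_distrib)
  ultimately show ?thesis by simp
qed

lemma Ds_shift_if_D:
  assumes g: "g \<in> A n" "shifts tau {w..} g" and d: "shifts tau {w + 1..} (D \<delta> k g)"
  shows "shifts tau {w + 1..} (D \<delta>s k g)"
  using shifts_minus[OF d D_minus_Ds[OF g, of k]] by simp

lemma part_tau_above: "g \<in> A n \<Longrightarrow> shifts tau {w + 1..} g \<Longrightarrow> part tau {w} g = (\<lambda>x. 0)"
  by (rule part_disjoint[OF _ additive_tau]) auto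

lemma part_homs: "g \<in> A n \<Longrightarrow> part tau J g \<in> A n"
  by (rule rescale_homs[OF additive_tau])

lemma part_remainder:
  assumes g: "g \<in> A n" "shifts tau {w..} g"
  shows "shifts tau {w + 1..} (\<lambda>x. g x - part tau {w} g x)"
proof -
  have "g = (\<lambda>x. part tau {w} g x + part tau {w + 1..} g x)"
    by (rule part_split[OF g(1) additive_tau shifts_mono[OF g(2)]]) auto
  then have "g x - part tau {w} g x = part tau {w + 1..} g x" for x
    unfolding diff_eq_eq by (subst add.commute) (rule fun_cong)
  then show ?thesis using part_shifts[of tau "{w + 1..}" g] by (simp only:)
qed

lemma shifts_single: "shifts tau {w} g \<Longrightarrow> shifts tau {w..} g"
  by (rule shifts_mono) auto

text \<open>\<open>D \<delta>s\<close> preserves shifts of \<open>tau\<close>, so a primitive of a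
  homogeneous cocycle may be replaced by its component of the same shift.\<close>

lemma vanishing':
  assumes c: "c \<in> A k" "shifts tau {w} c" "D \<delta>s k c = (\<lambda>x. 0)" "(w, k) \<noteq> (w0, N)"
  obtains b where "b \<in> A (k - 1)" "shifts tau {w} b" "D \<delta>s (k - 1) b = c"
proof -
  obtain b where b: "b \<in> A (k - 1)" "c = D \<delta>s (k - 1) b" using vanishing[OF c] by blast
  have "D \<delta>s (k - 1) (part tau {w} b) = part tau {w} c" unfolding b(2) by (rule part_Ds[OF b(1), symmetric])
  also have "\<dots> = c" by (rule part_id[OF c(1) additive_tau c(2)])
  finally show thesis using that[OF part_homs[OF b(1)] part_shifts] by blast
qed

lemma leading_cocycle:
  assumes c: "c \<in> A k" and d: "shifts tau {w + 1..} (D \<delta>s k c)"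
  shows "D \<delta>s k (part tau {w} c) = (\<lambda>x. 0)"
  using part_Ds[OF c, of "{w}"] part_tau_above[OF Ds_homs[OF c] d] by simp

text \<open>The leading component is a cocycle for \<open>D \<delta>s\<close>, hence a boundary.
  Subtracting \<open>D \<delta>\<close> of its primitive instead of \<open>D \<delta>s\<close>
  changes only higher components.\<close>

lemma kill_leading:
  assumes c: "c \<in> A k" "shifts tau {w..} c" and d: "shifts tau {w + 1..} (D \<delta>s k c)" and ne: "(w, k) \<noteq> (w0, N)"
  obtains b where "b \<in> A (k - 1)" "shifts tau {w..} b" "D \<delta>s (k - 1) b = part tau {w} c"
    "shifts tau {w + 1..} (\<lambda>x. c x - D \<delta> (k - 1) b x)"
proof -
  obtain b where b: "b \<in> A (k - 1)" "shifts tau {w} b" "D \<delta>s (k - 1) b = part tau {w} c"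
    using vanishing'[OF part_homs[OF c(1)] part_shifts leading_cocycle[OF c(1) d] ne] .
  have "shifts tau {w + 1..} (\<lambda>x. (c x - part tau {w} c x) - (D \<delta> (k - 1) b x - D \<delta>s (k - 1) b x))"
    by (rule shifts_minus[OF part_remainder[OF c] D_minus_Ds[OF b(1) shifts_single[OF b(2)]]])
  then have "shifts tau {w + 1..} (\<lambda>x. c x - D \<delta> (k - 1) b x)" by (simp add: b(3))
  then show thesis using that[OF b(1) shifts_single[OF b(2)] b(3)] by blast
qed

text \<open>Cocycles are removed component by component; \<open>tau_upper\<close> ends the
  process.\<close>

lemma boundary_above:
  assumes "c \<in> A N" "shifts tau {w..} c" "D \<delta>s N c = (\<lambda>x. 0)" "w > w0"
  shows "c \<in> D \<delta>s (N - 1) ` A (N - 1)"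
  using assms
proof (induct "nat (N + int (card B) + 1 - w)" arbitrary: c w rule: less_induct)
  case less
  show ?case
  proof (cases "w > N + int (card B)")
    case True
    then have "c = (\<lambda>x. 0)" using tau_upper less(2,3) by blast
    then show ?thesis using homs_zero D_zero[OF deriv_\<delta>s] by (intro image_eqI[of _ _ "\<lambda>x. 0"]) auto
  next
    case False
    have "shifts tau {w + 1..} (D \<delta>s N c)" using less(4) by (simp add: shifts_zero)
    then have co: "D \<delta>s N (part tau {w} c) = (\<lambda>x. 0)" by (rule leading_cocycle[OF less(2)])
    obtain b where b: "b \<in> A (N - 1)" "D \<delta>s (N - 1) b = part tau {w} c"
      using vanishing'[OF part_homs[OF less(2)] part_shifts co] less(5) by auto
    let ?c = "\<lambda>x. c x - part tau {w} c x"
    have "D \<delta>s N ?c = (\<lambda>x. 0)"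
      unfolding D_diff[OF deriv_\<delta>s less(2) part_homs[OF less(2)]] co less(4) by simp
    then have "?c \<in> D \<delta>s (N - 1) ` A (N - 1)"
      using False less(5) by (intro less(1)[OF _ homs_diff[OF less(2) part_homs[OF less(2)]] part_remainder[OF less(2,3)]]) simp_all
    then obtain b' where b': "b' \<in> A (N - 1)" "?c = D \<delta>s (N - 1) b'" by blast
    have "c = (\<lambda>x. D \<delta>s (N - 1) b x + D \<delta>s (N - 1) b' x)" unfolding b'(2)[symmetric] b(2) by simp
    also have "\<dots> = D \<delta>s (N - 1) (\<lambda>x. b x + b' x)" by (rule D_add[OF deriv_\<delta>s b(1) b'(1), symmetric])
    finally show ?thesis using homs_add[OF b(1) b'(1)] by blast
  qed
qed

text \<open>A primitive of g might start arbitrarily low. Boundaries move it up to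
  \<open>w0\<close>, first by \<open>low_acyclic\<close>, then because the pure cohomology vanishes
  in degree N - 1. Its leading component then makes f a boundary for \<open>D \<delta>s\<close> up
  to a cocycle above \<open>w0\<close>, which is a boundary too.\<close>

lemma deformation_not_boundary:
  assumes g: "g \<in> A N" "shifts tau {w0 + 1..} (\<lambda>x. g x - f x)"
  shows "g \<notin> D \<delta> (N - 1) ` A (N - 1)"
proof
  assume "g \<in> D \<delta> (N - 1) ` A (N - 1)"
  then obtain b where b: "b \<in> A (N - 1)" "g = D \<delta> (N - 1) b" by blast
  have "shifts tau {w0..} (\<lambda>x. (g x - f x) + f x)"
    by (rule shifts_plus[OF shifts_mono[OF g(2)] f(2)]) auto
  then have gw: "shifts tau {w0..} g" by simp
  \<comment> \<open>The second bound is the threshold of \<open>low_acyclic\<close> in degree N - 1;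
    the first ensures that g lies in the chosen filtration step.\<close>
  define w where "w = min w0 (N - 1 - int (card B))"
  have w: "w \<le> N - 1 - int (card B)" by (simp add: w_def)
  have "shifts tau {w..} (D \<delta> (N - 1) b)" using shifts_mono[OF gw, of "{w..}"] b(2) by (simp add: w_def)
  then obtain e where e: "e \<in> A (N - 1 - 1)" "shifts tau {w..} (\<lambda>x. b x - D \<delta> (N - 1 - 1) e x)"
    by (rule low_acyclic[OF b(1) w])
  have corr: "(\<lambda>x. b x - D \<delta> (N - 1 - 1) e x) \<in> A (N - 1) \<and> D \<delta> (N - 1) (\<lambda>x. b x - D \<delta> (N - 1 - 1) e x) = g"
    if "b \<in> A (N - 1)" "D \<delta> (N - 1) b = g" "e \<in> A (N - 1 - 1)" for b e
    using that D_diff[OF deriv_\<delta> that(1) D_\<delta>_homs'[OF that(3)], of "N - 1"] D_D_\<delta>'[OF that(3)]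
      homs_diff[OF that(1) D_\<delta>_homs'[OF that(3)]] by simp
  have "\<exists>b\<in>A (N - 1). shifts tau {w + int i..} b \<and> D \<delta> (N - 1) b = g" if "w + int i \<le> w0" for i
    using that
  proof (induct i)
    case 0
    then show ?case using corr[OF b(1) b(2)[symmetric] e(1)] e(2) by auto
  next
    case (Suc i)
    then obtain b where b: "b \<in> A (N - 1)" "shifts tau {w + int i..} b" "D \<delta> (N - 1) b = g" by auto
    have "shifts tau {w + int i + 1..} (D \<delta> (N - 1) b)"
      using shifts_mono[OF gw, of "{w + int i + 1..}"] Suc(2) by (simp add: b(3))
    then have "shifts tau {w + int i + 1..} (D \<delta>s (N - 1) b)" by (rule Ds_shift_if_D[OF b(1,2)])
    then obtain e where e: "e \<in> A (N - 1 - 1)" "shifts tau {w + int i + 1..} (\<lambda>x. b x - D \<delta> (N - 1 - 1) e x)"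
      using kill_leading[OF b(1,2), of thesis] by auto
    have "w + int (Suc i) = w + int i + 1" by simp
    then show ?case using corr[OF b(1) b(3) e(1)] e(2) by metis
  qed
  from this[of "nat (w0 - w)"] obtain b where b: "b \<in> A (N - 1)" "shifts tau {w0..} b" "D \<delta> (N - 1) b = g"
    by (auto simp: w_def)
  let ?b = "part tau {w0} b"
  have fb: "(\<lambda>x. f x - D \<delta>s (N - 1) ?b x) \<in> A N"
    by (rule homs_diff[OF f(1) Ds_homs'[OF part_homs[OF b(1)]]])
  have "shifts tau {w0 + 1..} (\<lambda>x. (D \<delta> (N - 1) b x - D \<delta>s (N - 1) b x) - (g x - f x))"
    by (rule shifts_minus[OF D_minus_Ds[OF b(1,2)] g(2)])
  then have "shifts tau {w0 + 1..} (\<lambda>x. f x - D \<delta>s (N - 1) b x)" by (simp add: b(3))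
  moreover have "shifts tau {w0 + 1..} (D \<delta>s (N - 1) (\<lambda>x. b x - ?b x))"
    by (rule D_shifts[OF deriv_\<delta>s tau_\<delta>s homs_diff[OF b(1) part_homs[OF b(1)]] part_remainder[OF b(1,2)]]) auto
  ultimately have "shifts tau {w0 + 1..} (\<lambda>x. (f x - D \<delta>s (N - 1) b x) + D \<delta>s (N - 1) (\<lambda>x. b x - ?b x) x)"
    by (rule shifts_plus)
  then have "shifts tau {w0 + 1..} (\<lambda>x. f x - D \<delta>s (N - 1) ?b x)"
    unfolding D_diff[OF deriv_\<delta>s b(1) part_homs[OF b(1)]] by simp
  moreover have "D \<delta>s N (\<lambda>x. f x - D \<delta>s (N - 1) ?b x) = (\<lambda>x. 0)"
    unfolding D_diff[OF deriv_\<delta>s f(1) Ds_homs'[OF part_homs[OF b(1)]]] f(3) Ds_Ds[OF part_homs[OF b(1)]] by simp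
  ultimately have "(\<lambda>x. f x - D \<delta>s (N - 1) ?b x) \<in> D \<delta>s (N - 1) ` A (N - 1)"
    using boundary_above[OF fb, of "w0 + 1"] by simp
  then obtain b' where b': "b' \<in> A (N - 1)" "(\<lambda>x. f x - D \<delta>s (N - 1) ?b x) = D \<delta>s (N - 1) b'" by blast
  have "f = (\<lambda>x. D \<delta>s (N - 1) ?b x + D \<delta>s (N - 1) b' x)" unfolding b'(2)[symmetric] by simp
  also have "\<dots> = D \<delta>s (N - 1) (\<lambda>x. ?b x + b' x)" by (rule D_add[OF deriv_\<delta>s part_homs[OF b(1)] b'(1), symmetric])
  finally show False using homs_add[OF part_homs[OF b(1)] b'(1)] f(4) by blast
qed

text \<open>Lets degree N, where multiples of g occur, be treated together with the other degrees,
  where the coefficient is 0.\<close>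

lemma homs_zero_smul: "g \<in> A n \<Longrightarrow> k \<noteq> n \<longrightarrow> a = 0 \<Longrightarrow> (\<lambda>x. smul a (g x)) \<in> A k"
  by (cases "k = n") (simp_all add: homs_smul homs_zero)

lemma D_zero_smul: "g \<in> A n \<Longrightarrow> D \<delta> n g = (\<lambda>x. 0) \<Longrightarrow> k \<noteq> n \<longrightarrow> a = 0 \<Longrightarrow> D \<delta> k (\<lambda>x. smul a (g x)) = (\<lambda>x. 0)"
  by (cases "k = n") (simp_all add: D_smul[OF deriv_\<delta>] D_zero[OF deriv_\<delta>])

text \<open>Outside the bidegree of f the leading component of u is a boundary for
  \<open>D \<delta>s\<close>. In it a multiple of f is left over, and g may replace f since they
  agree up to higher components.\<close>

lemma deformation_step:
  assumes g: "g \<in> A N" "shifts tau {w0 + 1..} (\<lambda>x. g x - f x)"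
    and u: "u \<in> A k" "shifts tau {w..} u" "D \<delta> k u = (\<lambda>x. 0)"
  obtains a b where "k \<noteq> N \<longrightarrow> a = 0" "b \<in> A (k - 1)"
    "shifts tau {w + 1..} (\<lambda>x. u x - (smul a (g x) + D \<delta> (k - 1) b x))"
proof -
  have d: "shifts tau {w + 1..} (D \<delta>s k u)"
    by (rule Ds_shift_if_D[OF u(1,2)]) (simp add: u(3) shifts_zero)
  show thesis
  proof (cases "(w, k) = (w0, N)")
    case False
    then obtain b where b: "b \<in> A (k - 1)" "shifts tau {w + 1..} (\<lambda>x. u x - D \<delta> (k - 1) b x)"
      by (rule kill_leading[OF u(1,2) d])
    show thesis by (rule that[of 0 b]) (simp_all add: b)
  next
    case True
    then have k: "k = N" "w = w0" by simp_all
    have uN: "u \<in> A N" "shifts tau {w0..} u" using u k by simp_all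
    let ?u = "part tau {w0} u"
    have "D \<delta>s N ?u = (\<lambda>x. 0)" by (rule leading_cocycle[OF uN(1)]) (use d k in simp)
    from generates[OF part_homs[OF uN(1)] this]
    obtain a b where b: "b \<in> A (N - 1)" "?u = (\<lambda>x. smul a (f x) + D \<delta>s (N - 1) b x)" by blast
    let ?b = "part tau {w0} b"
    note pb = part_homs[OF b(1), of "{w0}"]
    have "part tau {w0} ?u = ?u" by (rule part_id[OF part_homs[OF uN(1)] additive_tau part_shifts])
    \<comment> \<open>Taking components on both sides makes the primitive homogeneous, so that
      \<open>D_minus_Ds\<close> applies to it; of f only the leading component is kept.\<close>
    then have lead: "?u = (\<lambda>x. smul a (part tau {w0} f x) + D \<delta>s (N - 1) ?b x)"
      unfolding b(2) rescale_add[OF homs_smul[OF f(1)] Ds_homs'[OF b(1)] additive_tau]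
        rescale_smul[OF f(1) additive_tau] part_Ds[OF b(1)] by (rule sym)
    have 1: "shifts tau {w0 + 1..} (\<lambda>x. u x - ?u x)" by (rule part_remainder[OF uN])
    have 2: "shifts tau {w0 + 1..} (\<lambda>x. smul a ((g x - f x) + (f x - part tau {w0} f x)))"
      by (rule shifts_scale[OF shifts_plus[OF g(2) part_remainder[OF f(1,2)]]])
    have 3: "shifts tau {w0 + 1..} (\<lambda>x. D \<delta> (N - 1) ?b x - D \<delta>s (N - 1) ?b x)"
      by (rule D_minus_Ds[OF pb shifts_single[OF part_shifts]])
    have "shifts tau {w0 + 1..} (\<lambda>x. (u x - ?u x) - (smul a ((g x - f x) + (f x - part tau {w0} f x))
        + (D \<delta> (N - 1) ?b x - D \<delta>s (N - 1) ?b x)))"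
      by (rule shifts_minus[OF 1 shifts_plus[OF 2 3]])
    moreover have "(u x - ?u x) - (smul a ((g x - f x) + (f x - part tau {w0} f x))
        + (D \<delta> (N - 1) ?b x - D \<delta>s (N - 1) ?b x)) = u x - (smul a (g x) + D \<delta> (N - 1) ?b x)" for x
      unfolding fun_cong[OF lead, of x] by (simp add: smul.scale_right_diff_distrib smul.scale_right_distrib)
    ultimately have "shifts tau {w0 + 1..} (\<lambda>x. u x - (smul a (g x) + D \<delta> (N - 1) ?b x))" by (simp only:)
    then show thesis by (intro that[of a ?b]) (use pb k in simp_all)
  qed
qed

text \<open>After the start given by \<open>low_acyclic\<close>, the coefficients and primitives of
  the single steps are added up until the remainder vanishes for filtration reasons.\<close>

lemma deformation_generates:
  assumes g: "g \<in> A N" "shifts tau {w0 + 1..} (\<lambda>x. g x - f x)" "D \<delta> N g = (\<lambda>x. 0)"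
    and c: "c \<in> A k" "D \<delta> k c = (\<lambda>x. 0)"
  shows "\<exists>a. \<exists>b\<in>A (k - 1). c = (\<lambda>x. smul a (g x) + D \<delta> (k - 1) b x)"
proof -
  define w where "w = k - int (card B)"
  obtain b0 where b0: "b0 \<in> A (k - 1)" "shifts tau {w..} (\<lambda>x. c x - D \<delta> (k - 1) b0 x)"
  proof (rule low_acyclic[OF c(1), of w])
    show "w \<le> k - int (card B)" by (simp add: w_def)
    show "shifts tau {w..} (D \<delta> k c)" by (simp add: c(2) shifts_zero)
  qed
  have "\<exists>a. \<exists>b\<in>A (k - 1). (k \<noteq> N \<longrightarrow> a = 0) \<and>
      shifts tau {w + int i..} (\<lambda>x. c x - (smul a (g x) + D \<delta> (k - 1) b x))" for i
  proof (induct i)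
    case 0
    show ?case using b0 by (intro exI[of _ 0] bexI[of _ b0]) simp_all
  next
    case (Suc i)
    then obtain a b where b: "b \<in> A (k - 1)" "k \<noteq> N \<longrightarrow> a = 0"
      "shifts tau {w + int i..} (\<lambda>x. c x - (smul a (g x) + D \<delta> (k - 1) b x))" by blast
    let ?v = "\<lambda>x. smul a (g x) + D \<delta> (k - 1) b x"
    note sm = homs_zero_smul[OF g(1) b(2)]
    have v: "?v \<in> A k" by (rule homs_add[OF sm D_\<delta>_homs'[OF b(1)]])
    have "D \<delta> k ?v = (\<lambda>x. 0)"
      using D_add[OF deriv_\<delta> sm D_\<delta>_homs'[OF b(1)], of k] D_D_\<delta>'[OF b(1)] D_zero_smul[OF g(1,3) b(2)] by simp
    then have "D \<delta> k (\<lambda>x. c x - ?v x) = (\<lambda>x. 0)" using D_diff[OF deriv_\<delta> c(1) v, of k] c(2) by simp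
    then obtain a' b' where b': "k \<noteq> N \<longrightarrow> a' = 0" "b' \<in> A (k - 1)"
      "shifts tau {w + int i + 1..} (\<lambda>x. (c x - ?v x) - (smul a' (g x) + D \<delta> (k - 1) b' x))"
      by (rule deformation_step[OF g(1,2) homs_diff[OF c(1) v] b(3)])
    have "(\<lambda>x. (c x - ?v x) - (smul a' (g x) + D \<delta> (k - 1) b' x))
       = (\<lambda>x. c x - (smul (a + a') (g x) + D \<delta> (k - 1) (\<lambda>x. b x + b' x) x))"
      unfolding D_add[OF deriv_\<delta> b(1) b'(2)] by (simp add: smul.scale_left_distrib algebra_simps)
    moreover have "w + int i + 1 = w + int (Suc i)" by simp
    ultimately have "shifts tau {w + int (Suc i)..} (\<lambda>x. c x - (smul (a + a') (g x) + D \<delta> (k - 1) (\<lambda>x. b x + b' x) x))"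
      using b'(3) by (simp only:)
    then show ?case
      using b'(1) b(2) by (intro exI[of _ "a + a'"] bexI[of _ "\<lambda>x. b x + b' x"] conjI homs_add[OF b(1) b'(2)]) simp_all
  qed
  \<comment> \<open>This many steps lead from \<open>k - int (card B)\<close> to
    \<open>k + int (card B) + 1\<close>, just beyond the bound of \<open>tau_upper\<close>.\<close>
  from this[of "2 * card B + 1"] obtain a b where b: "b \<in> A (k - 1)" "k \<noteq> N \<longrightarrow> a = 0"
    "shifts tau {k + int (card B) + 1..} (\<lambda>x. c x - (smul a (g x) + D \<delta> (k - 1) b x))"
    by (auto simp: w_def algebra_simps)
  have "(\<lambda>x. c x - (smul a (g x) + D \<delta> (k - 1) b x)) \<in> A k"
    by (rule homs_diff[OF c(1) homs_add[OF homs_zero_smul[OF g(1) b(2)] D_\<delta>_homs'[OF b(1)]]])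
  from tau_upper[OF this b(3)] have "c x - (smul a (g x) + D \<delta> (k - 1) b x) = 0" for x by (simp add: fun_eq_iff)
  then have "c = (\<lambda>x. smul a (g x) + D \<delta> (k - 1) b x)" by (auto simp: fun_eq_iff)
  then show ?thesis using b(1) by blast
qed

subsection \<open>The corrections\<close>

lemma D_\<delta>_f: "shifts tau {w0 + 1..} (D \<delta> N f)"
  using D_minus_Ds[OF f(1,2), of N] by (simp add: f(3))

text \<open>As a cocycle for D, the map Dg has a leading component that is a cocycle for
  \<open>D \<delta>s\<close>. Its degree is N + 1, where the pure cohomology vanishes.\<close>

lemma correction_exists:
  assumes g: "g \<in> A N" "shifts tau {v..} (D \<delta> N g)"
  obtains \<beta> where "\<beta> \<in> A N" "shifts tau {v..} \<beta>" "D \<delta>s N \<beta> = part tau {v} (D \<delta> N g)"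
proof -
  note Dg = D_\<delta>_homs[OF g(1)]
  have "shifts tau {v + 1..} (D \<delta>s (N + 1) (D \<delta> N g))"
    by (rule Ds_shift_if_D[OF Dg g(2)]) (simp add: D_D_\<delta>[OF g(1)] shifts_zero)
  then have "D \<delta>s (N + 1) (part tau {v} (D \<delta> N g)) = (\<lambda>x. 0)" by (rule leading_cocycle[OF Dg])
  then obtain \<beta> where \<beta>: "\<beta> \<in> A (N + 1 - 1)" "shifts tau {v} \<beta>" "D \<delta>s (N + 1 - 1) \<beta> = part tau {v} (D \<delta> N g)"
    by (rule vanishing'[OF part_homs[OF Dg] part_shifts]) simp
  have "N + 1 - 1 = N" by simp
  with \<beta> show thesis using that shifts_single[OF \<beta>(2)] by (simp only:)
qed

text \<open>Both admissible equations for \<beta> cancel the component of shift v, and passing from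
  \<open>D \<delta>s\<close> to D affects only higher ones.\<close>

lemma correction_improves:
  assumes g: "g \<in> A N" "shifts tau {v..} (D \<delta> N g)" and \<beta>: "\<beta> \<in> A N" "shifts tau {v..} \<beta>"
    and e: "D \<delta>s N \<beta> = part tau {v} (D \<delta> N g) \<or> D \<delta>s N \<beta> = D \<delta> N g"
  shows "shifts tau {v + 1..} (D \<delta> N (\<lambda>x. g x - \<beta> x))"
proof -
  have "shifts tau {v + 1..} (\<lambda>x. D \<delta> N g x - D \<delta>s N \<beta> x)"
    using e part_remainder[OF D_\<delta>_homs[OF g(1)] g(2)] by (auto simp: shifts_zero)
  from shifts_minus[OF this D_minus_Ds[OF \<beta>, of N]] show ?thesis
    by (simp add: D_diff[OF deriv_\<delta> g(1) \<beta>(1)])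
qed

lemma part_expansion:
  assumes g: "g \<in> A n" "shifts tau {v..} g"
  shows "g = (\<lambda>x. (\<Sum>i<m. part tau {v + int i} g x) + part tau {v + int m..} g x)"
proof (induct m)
  case 0
  then show ?case using part_id[OF g(1) additive_tau g(2)] by simp
next
  case (Suc m)
  have "{v + int m..} = {v + int m} \<union> {v + int (Suc m)..}" by auto
  then have "part tau {v + int m..} g = (\<lambda>x. part tau {v + int m} g x + part tau {v + int (Suc m)..} g x)"
    using part_Un_disjoint[OF g(1) additive_tau, of "{v + int m}" "{v + int (Suc m)..}"] by simp
  then show ?case using Suc by (simp add: add.assoc)
qed

text \<open>Supplies the index l of the construction; \<open>tau_upper\<close> leaves only finitely
  many components.\<close>

lemma last_component:
  assumes g: "g \<in> A n" "shifts tau {v..} g" "g \<noteq> (\<lambda>x. 0)"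
  obtains l where "g = (\<lambda>x. \<Sum>i\<le>l. part tau {v + int i} g x)" "part tau {v + int l} g \<noteq> (\<lambda>x. 0)"
proof -
  define m where "m = nat (n + int (card B) + 1 - v)"
  have "part tau {v + int m..} g = (\<lambda>x. 0)"
    by (rule tau_upper[OF part_homs[OF g(1)] part_shifts]) (simp add: m_def)
  then have eq: "g = (\<lambda>x. \<Sum>i<m. part tau {v + int i} g x)" using part_expansion[OF g(1,2), of m] by simp
  define I where "I = {i. i < m \<and> part tau {v + int i} g \<noteq> (\<lambda>x. 0)}"
  have "I \<noteq> {}"
  proof
    assume "I = {}"
    then have "(\<lambda>x. \<Sum>i<m. part tau {v + int i} g x) = (\<lambda>x. 0)" by (auto simp: I_def fun_eq_iff intro!: sum.neutral)
    then show False using eq g(3) by simp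
  qed
  moreover have fin: "finite I" by (simp add: I_def)
  ultimately have "Max I \<in> I" by (intro Max_in)
  have "(\<Sum>i<m. part tau {v + int i} g x) = (\<Sum>i\<le>Max I. part tau {v + int i} g x)" for x
  proof (rule sum.mono_neutral_right)
    show "{..Max I} \<subseteq> {..<m}" using \<open>Max I \<in> I\<close> by (auto simp: I_def)
    show "\<forall>i\<in>{..<m} - {..Max I}. part tau {v + int i} g x = 0"
    proof
      fix i assume "i \<in> {..<m} - {..Max I}"
      then have "i < m" "i \<notin> I" using Max_ge[OF fin, of i] by auto
      then show "part tau {v + int i} g x = 0" by (simp add: I_def)
    qed
  qed simp
  then have "g = (\<lambda>x. \<Sum>i\<le>Max I. part tau {v + int i} g x)" using eq by simp
  then show thesis using that[of "Max I"] \<open>Max I \<in> I\<close> by (simp add: I_def)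
qed

text \<open>The corrections are continued without stopping; the construction ends at a suitable
  member of the sequence.\<close>

lemma corrections_exist:
  "\<exists>F. F 0 = f \<and> (\<forall>j. F j \<in> A N \<and> shifts tau {w0 + 1 + int j..} (D \<delta> N (F j)) \<and>
     (\<exists>\<beta>\<in>A N. shifts tau {w0 + 1 + int j..} \<beta> \<and> D \<delta>s N \<beta> = part tau {w0 + 1 + int j} (D \<delta> N (F j)) \<and>
       F (Suc j) = (\<lambda>x. F j x - \<beta> x)))"
proof -
  let ?P = "\<lambda>j g. g \<in> A N \<and> shifts tau {w0 + 1 + int j..} (D \<delta> N g)"
  let ?Q = "\<lambda>j g g'. \<exists>\<beta>\<in>A N. shifts tau {w0 + 1 + int j..} \<beta> \<and> D \<delta>s N \<beta> = part tau {w0 + 1 + int j} (D \<delta> N g) \<and>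
       g' = (\<lambda>x. g x - \<beta> x)"
  have step: "\<exists>g'. ?P (Suc j) g' \<and> ?Q j g g'" if P: "?P j g" for j g
  proof -
    obtain \<beta> where \<beta>: "\<beta> \<in> A N" "shifts tau {w0 + 1 + int j..} \<beta>" "D \<delta>s N \<beta> = part tau {w0 + 1 + int j} (D \<delta> N g)"
      by (rule correction_exists[OF conjunct1[OF P] conjunct2[OF P]])
    have "w0 + 1 + int (Suc j) = w0 + 1 + int j + 1" by simp
    moreover have "shifts tau {w0 + 1 + int j + 1..} (D \<delta> N (\<lambda>x. g x - \<beta> x))"
      by (rule correction_improves[OF conjunct1[OF P] conjunct2[OF P] \<beta>(1,2) disjI1[OF \<beta>(3)]])
    ultimately have "?P (Suc j) (\<lambda>x. g x - \<beta> x)"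
      using homs_diff[OF conjunct1[OF P] \<beta>(1)] by (simp only: simp_thms)
    moreover have "?Q j g (\<lambda>x. g x - \<beta> x)" by (intro bexI[of _ \<beta>] conjI \<beta> refl)
    ultimately show ?thesis by blast
  qed
  have "\<exists>F. \<forall>j. (?P j (F j) \<and> (j = 0 \<longrightarrow> F j = f)) \<and> ?Q j (F j) (F (Suc j))"
  proof (rule dependent_nat_choice)
    have "w0 + 1 + int 0 = w0 + 1" by simp
    then have "?P 0 f" using f(1) D_\<delta>_f by (simp only: simp_thms)
    then show "\<exists>g. ?P 0 g \<and> (0 = (0::nat) \<longrightarrow> g = f)" by blast
    fix g j assume "?P j g \<and> (j = 0 \<longrightarrow> g = f)"
    then obtain g' where "?P (Suc j) g'" "?Q j g g'" using step by blast
    then show "\<exists>g'. (?P (Suc j) g' \<and> (Suc j = 0 \<longrightarrow> g' = f)) \<and> ?Q j g g'" by blast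
  qed
  then obtain F where F: "\<And>j. (?P j (F j) \<and> (j = 0 \<longrightarrow> F j = f)) \<and> ?Q j (F j) (F (Suc j))" by blast
  show ?thesis by (rule exI[of _ F]) (use F in blast)
qed

end

section \<open>Sullivan algebras and acyclic closures\<close>

context gca begin

section \<open>Bidegrees and filtrations as shifts of \<open>tau\<close>\<close>

lemma tau_plen: "m \<in> vmons \<Longrightarrow> int (mdeg deg m + plen deg m) = tau m"
  by (simp add: tau_def podd_vmons(3,4))

text \<open>On arguments r + s is \<open>tau\<close>, and on \<Lambda>V the first degree is
  \<open>tau\<close>, so the step p of the filtration in degree n means a shift of at least p +
  n.\<close>

lemma hom_fil_iff: "g \<in> hom_fil B deg p n \<longleftrightarrow> g \<in> A n \<and> shifts tau {p + n..} g"
proof (intro iffI conjI)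
  assume g: "g \<in> hom_fil B deg p n"
  then show A: "g \<in> A n" by (simp add: hom_fil_def)
  show "shifts tau {p + n..} g" unfolding shifts_def
  proof (intro ballI)
    fix M m assume M: "M \<in> mons" and m: "m \<in> keys (g (mon_elt M))"
    have "(mon_elt M :: ('v, 'a) elt) \<in> LVsV_bi B deg (rdeg deg M) (mdeg deg M)" using M by (simp add: LVsV_bi_def)
    then have "g (mon_elt M) \<in> LV_fil B deg (p + n + int (mdeg deg M) + int (rdeg deg M))"
      using g by (auto simp: hom_fil_def)
    then have "int (mdeg deg m + plen deg m) \<ge> p + n + int (mdeg deg M) + int (rdeg deg M)"
      using m unfolding LV_fil_def by blast
    then show "tau m - tau M \<in> {p + n..}" unfolding tau_plen[OF homs_keys(1)[OF A M m]] by (simp add: tau_def[of M])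
  qed
next
  assume g: "g \<in> A n \<and> shifts tau {p + n..} g"
  then have A: "g \<in> A n" by blast
  have "g x \<in> LV_fil B deg (p + n + int s + int r)" if x: "x \<in> LVsV_bi B deg r s" for r s x
  proof -
    have xX: "x \<in> X" using x by (simp add: LVsV_bi_def)
    have "int (mdeg deg m + plen deg m) \<ge> p + n + int s + int r" if m: "m \<in> keys (g x)" for m
    proof -
      obtain M where M: "M \<in> keys x" "tau m - tau M \<ge> p + n" 
        using shifts_elt[OF conjunct2[OF g] homsD(1)[OF A] xX m] by auto
      have "m \<in> vmons" using homsD(2)[OF A, of x] m by (auto simp: Y_iff)
      then show ?thesis using M x unfolding tau_plen[OF \<open>m \<in> vmons\<close>] by (auto simp: LVsV_bi_def tau_def[of M])
    qed
    then show ?thesis using homsD(2)[OF A] by (simp add: LV_fil_def)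
  qed
  then show "g \<in> hom_fil B deg p n" using A by (auto simp: hom_fil_def)
qed

lemma hom_biI:
  assumes A: "g \<in> A n" and s: "shifts tau {p + n} g"
  shows "g \<in> hom_bi B deg p n"
proof -
  have "g x \<in> LV_bi B deg (p + n + int s + int r)" if x: "x \<in> LVsV_bi B deg r s" for r s x
  proof -
    have xX: "x \<in> X" using x by (simp add: LVsV_bi_def)
    have "int (mdeg deg m + plen deg m) = p + n + int s + int r" if m: "m \<in> keys (g x)" for m
    proof -
      obtain M where M: "M \<in> keys x" "tau m - tau M = p + n"
        using shifts_elt[OF s homsD(1)[OF A] xX m] by auto
      have "m \<in> vmons" using homsD(2)[OF A, of x] m by (auto simp: Y_iff)
      then show ?thesis using M x unfolding tau_plen[OF \<open>m \<in> vmons\<close>] by (auto simp: LVsV_bi_def tau_def[of M])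
    qed
    then show ?thesis using homsD(2)[OF A] by (simp add: LV_bi_def)
  qed
  then show ?thesis using A by (auto simp: hom_bi_def)
qed

lemma hom_comp_part:
  assumes A: "g \<in> A n"
  shows "hom_comp B deg k g = part tau {k} g"
proof
  fix x
  have "LV_proj deg (k + int (mdeg deg M) + int (rdeg deg M)) (g (single M (lookup x M)))
     = smul (lookup x M) (scale (\<lambda>m. if tau m - tau M \<in> {k} then 1 else 0) (g (mon_elt M)))"
    if M: "M \<in> mons" for M
  proof (rule poly_mapping_eqI)
    fix m
    have y: "g (single M (lookup x M)) = smul (lookup x M) (g (mon_elt M))"
      using M by (simp add: single_eq_smul lin_smul[OF homsD(1)[OF A]])
    have "lookup (LV_proj deg K y) m = (if int (mdeg deg m + plen deg m) = K then lookup y m else 0)"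
      for K and y :: "('v, 'a) elt"
      unfolding LV_proj_def lookup_sum by (auto simp: lookup_single when_def in_keys_iff sum.delta' intro!: sum.neutral)
    moreover have "(int (mdeg deg m + plen deg m) = k + int (mdeg deg M) + int (rdeg deg M)) = (tau m - tau M \<in> {k})"
      if "m \<in> keys (g (mon_elt M))"
      unfolding tau_plen[OF homs_keys(1)[OF A M that]] by (auto simp: tau_def[of M])
    ultimately show "lookup (LV_proj deg (k + int (mdeg deg M) + int (rdeg deg M)) (g (single M (lookup x M)))) m
       = lookup (smul (lookup x M) (scale (\<lambda>m. if tau m - tau M \<in> {k} then 1 else 0) (g (mon_elt M)))) m"
      unfolding y by (cases "m \<in> keys (g (mon_elt M))") (simp_all add: in_keys_iff)
  qed
  then show "hom_comp B deg k g x = part tau {k} g x"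
    by (auto simp: hom_comp_def rescale_def lext_def X_iff intro!: sum.cong)
qed

lemma hom_diff_eq:
  assumes "\<And>y. y \<in> Y \<Longrightarrow> T y = d y" and "g \<in> A n"
  shows "hom_diff B deg d T k g = D T k g"
  using assms(1) homsD(2)[OF assms(2)] by (simp add: hom_diff_def fun_eq_iff)

section \<open>Weights of the differentials of the acyclic closures\<close>

lemma suspension_keys:
  assumes S: "suspension B deg S" and x: "x \<in> Y" "0 \<notin> keys x" and m: "m \<in> keys (S x)"
  obtains M v where "M \<in> keys x" "Inl v \<in> keys M" "m = M - single (Inl v) 1 + single (Inr v) 1"
proof -
  have lin: "linear_map_on Y S" using S by (simp add: suspension_def)
  have S0: "S 0 = 0" using lin unfolding linear_map_on_def by (metis Y_closed(1) smul.scale_zero_left)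
  have sum: "S (\<Sum>i\<in>I. smul (c i) (mon_elt (h i))) = (\<Sum>i\<in>I. smul (c i) (S (mon_elt (h i))))"
    if "finite I" "\<And>i. i \<in> I \<Longrightarrow> h i \<in> vmons" for I :: "'v mon set" and c h
    using that
  proof (induct I rule: finite_induct)
    case (insert i I)
    have "(\<Sum>i\<in>I. smul (c i) (mon_elt (h i))) \<in> Y" using insert by (intro Y_sum Y_closed(3)) simp
    moreover have "smul (c i) (mon_elt (h i)) \<in> Y" using insert by (intro Y_closed(3)) simp
    ultimately show ?case using insert lin unfolding linear_map_on_def by simp
  qed (simp add: S0)
  have v: "M \<in> vmons" if "M \<in> keys x" for M using x that by (auto simp: Y_iff)
  have "S x = (\<Sum>M\<in>keys x. smul (lookup x M) (S (mon_elt M)))"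
    by (subst expand[of x], rule sum) (use v in auto)
  then obtain M where M: "M \<in> keys x" "m \<in> keys (smul (lookup x M) (S (mon_elt M)))"
    using m by (auto dest!: subsetD[OF keys_sum])
  then have mS: "m \<in> keys (S (mon_elt M))" using keys_smul by blast
  have "M \<noteq> 0" using M x by auto
  then obtain c where "S (mon_elt M) = (\<Sum>v | Inl v \<in> keys M.
             smul (c v) (gmul deg (mon_elt (M - single (Inl v) 1)) (sgen v)))"
    using S v[OF M(1)] mon_elt_Y[of M] unfolding suspension_def by blast
  then obtain v where v: "Inl v \<in> keys M" "m \<in> keys (smul (c v) (gmul deg (mon_elt (M - single (Inl v) 1)) (sgen v)))"
    using mS by (auto dest!: subsetD[OF keys_sum])
  then have "m = M - single (Inl v) 1 + single (Inr v) 1"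
    using subsetD[OF keys_gmul subsetD[OF keys_smul v(2)]] by (auto simp: sgen_def)
  then show thesis using that M(1) v(1) by blast
qed

text \<open>The coefficients in r = a1 + a2 + 2 a3 make up for the drop in degree, so v and sv have
  the same \<open>tau\<close> in either parity. For \<open>omega\<close> a weight
  \<open>cmax\<close> is exchanged for at least 1.\<close>

lemma tau_suspend:
  assumes M: "M \<in> mons" "Inl v \<in> keys M"
  shows "tau (M - single (Inl v) 1 + single (Inr v) 1) = tau M"
    "omega (M - single (Inl v) 1 + single (Inr v) 1) \<ge> omega M - cmax + 1"
proof -
  have v: "v \<in> B" using M by (auto simp: mons_def)
  have W: "W M = W (single (Inl v) 1) + W (M - single (Inl v) 1)" if "additive W" for W
    using single_add_diff[OF M(2)] additiveD[OF that] by metis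
  have "tau (single (Inl v) 1) = tau (single (Inr v) 1)" using deg_ge[OF v] by (simp add: of_nat_diff)
  then show "tau (M - single (Inl v) 1 + single (Inr v) 1) = tau M"
    using W[OF additive_tau] additiveD[OF additive_tau] by simp
  have "omega (single (Inl v) 1) = cmax" "omega (single (Inr v) 1) \<ge> 1" by simp_all
  then show "omega (M - single (Inl v) 1 + single (Inr v) 1) \<ge> omega M - cmax + 1"
    using W[OF additive_omega] additiveD[OF additive_omega] by simp
qed

lemma tau_sgen: "v \<in> B \<Longrightarrow> tau (single (Inr v) 1) = tau (single (Inl v) 1)"
  using deg_ge[of v] by (simp add: of_nat_diff)

lemma suspension_tau:
  assumes "suspension B deg S" "x \<in> Y" "0 \<notin> keys x" "m \<in> keys (S x)"
  shows "\<exists>M\<in>keys x. tau m = tau M \<and> omega m \<ge> omega M - cmax + 1"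
proof -
  obtain M v where M: "M \<in> keys x" "Inl v \<in> keys M" "m = M - single (Inl v) 1 + single (Inr v) 1"
    using suspension_keys[OF assms] .
  have "M \<in> mons" using M(1) assms(2) by (auto simp: Y_iff vmons_def)
  then show ?thesis using tau_suspend[OF _ M(2)] M(1,3) by metis
qed

lemma omega_wlen: "m \<in> vmons \<Longrightarrow> omega m = cmax * int (wlen m)"
proof -
  assume m: "m \<in> vmons"
  have "weight gen_omega m = weight (\<lambda>g. nat cmax * 1) m"
    using vmons_keys[OF m] by (intro weight_cong) auto
  then have "omega m = int (nat cmax * wlen m)" unfolding omega_def wlen_def weight_fun_mult by simp
  then show ?thesis using cmax_ge(1) by simp
qed

lemma closure_deriv:
  assumes "acyclic_closure B deg S d \<delta>" and "differential_on deg Y d"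
  shows "deriv 1 \<delta>" "\<And>y. y \<in> Y \<Longrightarrow> \<delta> y = d y" "\<And>y. y \<in> Y \<Longrightarrow> \<delta> y \<in> Y" "\<And>x. x \<in> X \<Longrightarrow> \<delta> (\<delta> x) = 0"
    "\<And>v. v \<in> B \<Longrightarrow> \<delta> (sgen v) = vgen v - S (d (vgen v))"
  using assms differential_deriv[of \<delta>] by (auto simp: acyclic_closure_def differential_on_def)

lemma differential_vgen:
  assumes "differential_on deg Y d" "v \<in> B"
  shows "d (vgen v) \<in> Y" "m \<in> keys (d (vgen v)) \<Longrightarrow> gweight m = int (deg v) + 1"
proof -
  show "d (vgen v) \<in> Y" using assms vgen_Y by (auto simp: differential_on_def)
  have "homog deg (int (deg v)) (vgen v)" by (simp add: vgen_def)
  then have "homog deg (int (deg v) + 1) (d (vgen v))" using assms vgen_Y by (auto simp: differential_on_def)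
  then show "m \<in> keys (d (vgen v)) \<Longrightarrow> gweight m = int (deg v) + 1" by (simp add: homog_iff)
qed

text \<open>For v odd the pure differential lands in \<Lambda>Q in degree deg v + 1, which is
  \<open>tau\<close> of v; for v even it is zero. Suspension preserves \<open>tau\<close>, so sv
  behaves alike.\<close>

lemma tau_pure_closure:
  assumes pure: "pure_part B deg d ds" and S: "suspension B deg S" and cl: "acyclic_closure B deg S ds \<delta>s"
  shows "shifts tau {0} \<delta>s"
proof -
  have dds: "differential_on deg Y ds" using pure by (simp add: pure_part_def)
  note c = closure_deriv[OF cl dds]
  have g: "tau m = tau (single (Inl v) 1)" if v: "v \<in> B" and m: "m \<in> keys (ds (vgen v))" for v m
  proof -
    have o: "odd (deg v)" using pure m v by (auto simp: pure_part_def)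
    then have "plen deg m = 0" using pure v m by (simp add: pure_part_def)
    moreover have "m \<in> vmons" using differential_vgen(1)[OF dds v] m by (auto simp: Y_iff)
    ultimately have "tau m = gweight m" using tau_plen[of m] by (simp add: gweight_def)
    then show ?thesis using differential_vgen(2)[OF dds v m] o by simp
  qed
  show ?thesis
  proof (rule deriv_shifts[OF c(1) additive_tau])
    fix h m assume "h \<in> Inl ` B \<union> Inr ` B" and m: "m \<in> keys (\<delta>s (mon_elt (single h 1)))"
    then consider v where "h = Inl v" "v \<in> B" | v where "h = Inr v" "v \<in> B" by blast
    then show "tau m - tau (single h 1) \<in> {0}"
    proof cases
      case 1
      then have "\<delta>s (mon_elt (single h 1)) = ds (vgen v)" using c(2)[OF vgen_Y] by (simp add: vgen_def)
      then show ?thesis using g[OF 1(2)] m 1(1) by (simp del: tau_single)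
    next
      case 2
      then have "\<delta>s (mon_elt (single h 1)) = vgen v - S (ds (vgen v))" using c(5) by (simp add: sgen_def)
      then have "m \<in> keys (vgen v :: ('v, 'a) elt) \<or> m \<in> keys (S (ds (vgen v)))" using m by (auto dest: subsetD[OF keys_diff])
      then have "tau m = tau (single (Inl v) 1)"
      proof
        assume "m \<in> keys (S (ds (vgen v)))"
        moreover have "0 \<notin> keys (ds (vgen v))"
          using differential_vgen(2)[OF dds 2(2), of 0] by (auto simp: additive_0[OF additive_gweight])
        ultimately show ?thesis using suspension_tau[OF S differential_vgen(1)[OF dds 2(2)]] g[OF 2(2)] by metis
      qed (simp add: vgen_def)
      then show ?thesis using tau_sgen[OF 2(2)] 2(1) by (simp del: tau_single)
    qed
  qed
qed

text \<open>A monomial of degree deg v + 1 with at least one odd factor has \<open>tau\<close> at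
  least deg v + 2, whereas \<open>tau\<close> of v is at most deg v + 1.\<close>

lemma tau_closure_diff:
  assumes d: "differential_on deg Y d" and pure: "pure_part B deg d ds" and S: "suspension B deg S"
    and cl: "acyclic_closure B deg S d \<delta>" "acyclic_closure B deg S ds \<delta>s"
  shows "shifts tau {1..} (\<lambda>x. \<delta> x - \<delta>s x)"
proof -
  have dds: "differential_on deg Y ds" using pure by (simp add: pure_part_def)
  note c = closure_deriv[OF cl(1) d] and cs = closure_deriv[OF cl(2) dds]
  let ?e = "\<lambda>v. d (vgen v) - ds (vgen v)"
  have eY: "?e v \<in> Y" if "v \<in> B" for v using differential_vgen(1)[OF d that] differential_vgen(1)[OF dds that] by blast
  have p: "plen deg m \<ge> 1" if "v \<in> B" "m \<in> keys (?e v)" for v m using pure that by (simp add: pure_part_def)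
  have g: "tau m \<ge> tau (single (Inl v) 1) + 1" if v: "v \<in> B" and m: "m \<in> keys (?e v)" for v m
  proof -
    have "m \<in> vmons" using eY[OF v] m by (auto simp: Y_iff)
    then have "tau m = gweight m + int (plen deg m)" using tau_plen[of m] by (simp add: gweight_def)
    moreover have "gweight m = int (deg v) + 1"
      using m keys_diff[of "d (vgen v)" "ds (vgen v)"] differential_vgen(2)[OF d v] differential_vgen(2)[OF dds v] by blast
    ultimately show ?thesis using p[OF v m] by simp
  qed
  show ?thesis
  proof (rule deriv_shifts[OF deriv_minus[OF c(1) cs(1)] additive_tau])
    fix h m assume "h \<in> Inl ` B \<union> Inr ` B" and m: "m \<in> keys (\<delta> (mon_elt (single h 1)) - \<delta>s (mon_elt (single h 1)))"
    then consider v where "h = Inl v" "v \<in> B" | v where "h = Inr v" "v \<in> B" by blast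
    then show "tau m - tau (single h 1) \<in> {1..}"
    proof cases
      case 1
      then have "\<delta> (mon_elt (single h 1)) - \<delta>s (mon_elt (single h 1)) = ?e v"
        using c(2)[OF vgen_Y] cs(2)[OF vgen_Y] by (simp add: vgen_def)
      then show ?thesis using g[OF 1(2), of m] m 1(1) by (simp del: tau_single)
    next
      case 2
      have lin: "linear_map_on Y S" using S by (simp add: suspension_def)
      have "S (ds (vgen v) + ?e v) = S (ds (vgen v)) + S (?e v)"
        using lin differential_vgen(1)[OF dds 2(2)] eY[OF 2(2)] unfolding linear_map_on_def by blast
      then have "S (?e v) = S (d (vgen v)) - S (ds (vgen v))" by simp
      then have "\<delta> (mon_elt (single h 1)) - \<delta>s (mon_elt (single h 1)) = - S (?e v)"
        using c(5)[OF 2(2)] cs(5)[OF 2(2)] 2(1) by (simp add: sgen_def)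
      then have "m \<in> keys (S (?e v))" using m by (simp add: keys_minus)
      moreover have "0 \<notin> keys (?e v)" using p[OF 2(2), of 0] by (auto simp: plen_def)
      ultimately obtain M where "M \<in> keys (?e v)" "tau m = tau M" using suspension_tau[OF S eY[OF 2(2)]] by blast
      then show ?thesis using g[OF 2(2)] tau_sgen[OF 2(2)] 2(1) by (fastforce simp del: tau_single)
    qed
  qed
qed

lemma closure_koszul_complex:
  assumes d: "minimal_sullivan B deg d" and pure: "pure_part B deg d ds" and S: "suspension B deg S"
    and cl: "acyclic_closure B deg S d \<delta>" "acyclic_closure B deg S ds \<delta>s"
  shows "koszul_complex B deg \<delta>"
proof -
  have dd: "differential_on deg Y d" using d by (simp add: minimal_sullivan_def)
  note c = closure_deriv[OF cl(1) dd]
  have w: "omega m \<ge> 2 * cmax" if v: "v \<in> B" and m: "m \<in> keys (d (vgen v))" for v m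
  proof -
    have "wlen m \<ge> 2" using d v m by (simp add: minimal_sullivan_def)
    moreover have "m \<in> vmons" using differential_vgen(1)[OF dd v] m by (auto simp: Y_iff)
    ultimately show ?thesis using cmax_ge(1) by (simp add: omega_wlen)
  qed
  show ?thesis
  proof unfold_locales
    show "deriv 1 \<delta>" "\<And>y. y \<in> Y \<Longrightarrow> \<delta> y \<in> Y" "\<And>x. x \<in> X \<Longrightarrow> \<delta> (\<delta> x) = 0" by (fact c)+
    show "omega m \<ge> 2 * cmax" if "v \<in> B" "m \<in> keys (\<delta> (vgen v))" for v m
      using that w c(2)[OF vgen_Y] by simp
    show "omega m \<ge> cmax + 1" if v: "v \<in> B" and m: "m \<in> keys (vgen v - \<delta> (sgen v))" for v m
    proof -
      have "m \<in> keys (S (d (vgen v)))" using m c(5)[OF v] by simp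
      moreover have "0 \<notin> keys (d (vgen v))"
        using differential_vgen(2)[OF dd v, of 0] by (auto simp: additive_0[OF additive_gweight])
      ultimately obtain M where "M \<in> keys (d (vgen v))" "omega m \<ge> omega M - cmax + 1"
        using suspension_tau[OF S differential_vgen(1)[OF dd v]] by blast
      then show ?thesis using w[OF v] by fastforce
    qed
    have "shifts tau {0..} (\<lambda>x. \<delta>s x + (\<delta> x - \<delta>s x))"
      using shifts_mono[OF tau_pure_closure[OF pure S cl(2)], of "{0..}"]
        shifts_mono[OF tau_closure_diff[OF dd pure S cl], of "{0..}"] by (intro shifts_plus) auto
    then show "shifts tau {0..} \<delta>" by simp
  qed
qed

end

theorem theorem5p1:
  fixes B :: "'v::linorder set" and deg :: "'v \<Rightarrow> nat"
    and d ds S \<delta> \<delta>s f :: "('v, 'k::field_char_0) elt \<Rightarrow> ('v, 'k) elt"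
    and p N :: int
  assumes "finite B"
    and "minimal_sullivan B deg d"
    and "pure_part B deg d ds"
    and "suspension B deg S"
    and "acyclic_closure B deg S d \<delta>"
    and "acyclic_closure B deg S ds \<delta>s"
    and "\<forall>p' n. ext_nonzero_at B deg ds \<delta>s p' n \<longleftrightarrow> p' = p \<and> n = N"
    and "generating_class B deg ds \<delta>s N f"
    and "f \<in> hom_fil B deg p N"
  shows "(\<exists>fl. constructed B deg d \<delta> ds \<delta>s p N f fl) \<and>
         (\<forall>fl. constructed B deg d \<delta> ds \<delta>s p N f fl \<longrightarrow> generating_class B deg d \<delta> N fl)"
proof -
  have d: "differential_on deg (LV B deg) d" and ds: "differential_on deg (LV B deg) ds"
    using assms(2,3) by (simp_all add: minimal_sullivan_def pure_part_def)
  interpret gca B deg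
    using assms(1,2) by unfold_locales (simp_all add: minimal_sullivan_def)
  note c = closure_deriv[OF assms(5) d] and cs = closure_deriv[OF assms(6) ds]
  have hd: "hom_diff B deg d \<delta> k g = D \<delta> k g" if "g \<in> A n" for g k n
    by (rule hom_diff_eq[OF _ that]) (rule c(2))
  have hds: "hom_diff B deg ds \<delta>s k g = D \<delta>s k g" if "g \<in> A n" for g k n
    by (rule hom_diff_eq[OF _ that]) (rule cs(2))
  interpret koszul_complex B deg \<delta>
    by (rule closure_koszul_complex[OF assms(2-6)])
  have gen: "f \<in> A N" "hom_diff B deg ds \<delta>s N f = (\<lambda>_. 0)"
      "f \<notin> hom_diff B deg ds \<delta>s (N - 1) ` A (N - 1)"
      "\<And>k c. c \<in> A k \<Longrightarrow> hom_diff B deg ds \<delta>s k c = (\<lambda>_. 0) \<Longrightarrow>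
       \<exists>a. \<exists>b\<in>A (k - 1). c = (\<lambda>x. smul a (f x) + hom_diff B deg ds \<delta>s (k - 1) b x)"
    using assms(8) by (simp_all add: generating_class_def)
  have f_fil: "shifts tau {p + N..} f" using assms(9) by (simp add: hom_fil_iff)
  interpret filtered_koszul_complex B deg \<delta> \<delta>s f "p + N" N
  proof unfold_locales
    show "deriv 1 \<delta>s" "\<And>y. y \<in> Y \<Longrightarrow> \<delta>s y \<in> Y" "\<And>x. x \<in> X \<Longrightarrow> \<delta>s (\<delta>s x) = 0" by (fact cs)+
    show "shifts tau {0} \<delta>s" by (rule tau_pure_closure[OF assms(3,4,6)])
    show "shifts tau {1..} (\<lambda>x. \<delta> x - \<delta>s x)" by (rule tau_closure_diff[OF d assms(3-6)])
    show "f \<in> A N" by (fact gen(1))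
    show "shifts tau {p + N..} f" by (fact f_fil)
    show "D \<delta>s N f = (\<lambda>x. 0)" using gen(2) by (simp add: hds[OF gen(1)])
    show "f \<notin> D \<delta>s (N - 1) ` A (N - 1)" using gen(3) by (simp add: hds image_def)
    show "\<exists>a. \<exists>b\<in>A (N - 1). c = (\<lambda>x. smul a (f x) + D \<delta>s (N - 1) b x)"
      if "c \<in> A N" "D \<delta>s N c = (\<lambda>x. 0)" for c
      using gen(4)[of c N] that hds by (auto simp: hds)
    show "\<exists>b\<in>A (k - 1). c = D \<delta>s (k - 1) b"
      if "c \<in> A k" "shifts tau {w} c" "D \<delta>s k c = (\<lambda>x. 0)" "(w, k) \<noteq> (p + N, N)" for c k w
    proof -
      \<comment> \<open>A shift w in degree k is the bidegree with first entry w - k.\<close>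
      have "c \<in> hom_bi B deg (w - k) k" using that by (intro hom_biI) simp_all
      moreover have "\<not> ext_nonzero_at B deg ds \<delta>s (w - k) k" using assms(7) that(4) by auto
      ultimately have "c \<in> hom_diff B deg ds \<delta>s (k - 1) ` A (k - 1)"
        using that(1,3) unfolding ext_nonzero_at_def by (auto simp: hds)
      then show ?thesis by (auto simp: hds)
    qed
  qed
  \<comment> \<open>Both outcomes of the construction reduce to this: a cocycle that agrees with f
    up to higher filtration generates.\<close>
  have generating: "generating_class B deg d \<delta> N g"
    if g: "g \<in> A N" "shifts tau {p + N + 1..} (\<lambda>x. g x - f x)" "D \<delta> N g = (\<lambda>x. 0)" for g
    unfolding generating_class_def
  proof (intro conjI allI ballI impI)
    show "g \<in> A N" "hom_diff B deg d \<delta> N g = (\<lambda>_. 0)" using g by (simp_all add: hd)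
    show "g \<notin> hom_diff B deg d \<delta> (N - 1) ` A (N - 1)"
      using deformation_not_boundary[OF g(1,2)] by (simp add: hd image_def)
    fix k c assume c: "c \<in> A k" and "hom_diff B deg d \<delta> k c = (\<lambda>_. 0)"
    then have "D \<delta> k c = (\<lambda>x. 0)" by (simp add: hd)
    from deformation_generates[OF g c this]
    obtain a b where b: "b \<in> A (k - 1)" "c = (\<lambda>x. smul a (g x) + D \<delta> (k - 1) b x)" by blast
    then show "\<exists>a. \<exists>b\<in>A (k - 1). c = (\<lambda>x. smul a (g x) + hom_diff B deg d \<delta> (k - 1) b x)"
      unfolding hd[OF b(1), symmetric] by blast
  qed
  have comp: "hom_comp B deg (p + N + int j + 1) (hom_diff B deg d \<delta> N g) = part tau {p + N + 1 + int j} (D \<delta> N g)"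
    if "g \<in> A N" for g j
    unfolding hd[OF that] hom_comp_part[OF D_\<delta>_homs[OF that]] by (simp add: add.commute add.left_commute)
  have corr: "correction B deg ds \<delta>s p N j h g g' \<longleftrightarrow>
      (\<exists>\<beta>\<in>A N. shifts tau {p + N + 1 + int j..} \<beta> \<and> D \<delta>s N \<beta> = h \<and> g' = (\<lambda>x. g x - \<beta> x))" for j h g g'
  proof -
    have "p + int j + 1 + N = p + N + 1 + int j" by simp
    then have hf: "\<beta> \<in> hom_fil B deg (p + int j + 1) N \<longleftrightarrow> \<beta> \<in> A N \<and> shifts tau {p + N + 1 + int j..} \<beta>" for \<beta>
      by (simp only: hom_fil_iff)
    show ?thesis unfolding correction_def Bex_def hf by (rule iff_exI) (auto simp: hds)
  qed
  have step: "g' \<in> A N" "shifts tau {p + N + 1 + int (Suc j)..} (D \<delta> N g')" "shifts tau {p + N + 1..} (\<lambda>x. g' x - f x)"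
    if g: "g \<in> A N" "shifts tau {p + N + 1 + int j..} (D \<delta> N g)" "shifts tau {p + N + 1..} (\<lambda>x. g x - f x)"
      and c: "correction B deg ds \<delta>s p N j h g g'"
      and h: "h = part tau {p + N + 1 + int j} (D \<delta> N g) \<or> h = D \<delta> N g" for j g g' h
  proof -
    obtain \<beta> where \<beta>: "\<beta> \<in> A N" "shifts tau {p + N + 1 + int j..} \<beta>" "D \<delta>s N \<beta> = h" "g' = (\<lambda>x. g x - \<beta> x)"
      using c unfolding corr by blast
    show "g' \<in> A N" unfolding \<beta>(4) by (rule homs_diff[OF g(1) \<beta>(1)])
    have "p + N + 1 + int (Suc j) = p + N + 1 + int j + 1" by simp
    then show "shifts tau {p + N + 1 + int (Suc j)..} (D \<delta> N g')"
      using correction_improves[OF g(1,2) \<beta>(1,2)] h unfolding \<beta>(3,4) by (simp only:)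
    have "shifts tau {p + N + 1..} \<beta>" by (rule shifts_mono[OF \<beta>(2)]) auto
    from shifts_minus[OF g(3) this] show "shifts tau {p + N + 1..} (\<lambda>x. g' x - f x)"
      unfolding \<beta>(4) by (simp add: algebra_simps)
  qed
  have ff: "shifts tau {p + N + 1..} (\<lambda>x. f x - f x)" by (simp add: shifts_zero)
  let ?D = "hom_diff B deg d \<delta> N" and ?h = "\<lambda>j. hom_comp B deg (p + N + int j + 1)"
  let ?c = "\<lambda>F j h. correction B deg ds \<delta>s p N j h (F j) (F (Suc j))"
  \<comment> \<open>Only expressions in f are rewritten; for the members of the sequence
    \<open>F\<close> membership in \<open>A N\<close> has yet to be proved.\<close>
  have con: "constructed B deg d \<delta> ds \<delta>s p N f fl \<longleftrightarrow>
    D \<delta> N f = (\<lambda>_. 0) \<and> fl = f \<or>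
    (\<exists>l L F. D \<delta> N f = (\<lambda>x. \<Sum>i\<le>l. part tau {p + N + 1 + int i} (D \<delta> N f) x) \<and>
       part tau {p + N + 1 + int l} (D \<delta> N f) \<noteq> (\<lambda>_. 0) \<and> l \<le> L \<and> F 0 = f \<and> F L = fl \<and>
       (\<forall>j<l. ?c F j (?h j (?D (F j)))) \<and>
       (\<forall>j. l \<le> j \<and> j < L \<longrightarrow> ?D (F j) \<noteq> (\<lambda>_. 0) \<and> (?c F j (?h j (?D (F j))) \<or> ?c F j (?D (F j)))) \<and>
       ?D (F L) = (\<lambda>_. 0))" for fl
    unfolding constructed_def Let_def hd[OF gen(1)] comp[OF gen(1), unfolded hd[OF gen(1)]] by (rule refl)
  show ?thesis
  proof (intro conjI allI impI)
    show "\<exists>fl. constructed B deg d \<delta> ds \<delta>s p N f fl"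
    proof (cases "D \<delta> N f = (\<lambda>x. 0)")
      case True
      then show ?thesis unfolding con by blast
    next
      case False
      obtain l where l: "D \<delta> N f = (\<lambda>x. \<Sum>i\<le>l. part tau {p + N + 1 + int i} (D \<delta> N f) x)"
        "part tau {p + N + 1 + int l} (D \<delta> N f) \<noteq> (\<lambda>x. 0)"
        by (rule last_component[OF D_\<delta>_homs[OF gen(1)] D_\<delta>_f False])
      obtain F where F0: "F 0 = f" and FP: "\<forall>j. F j \<in> A N \<and> shifts tau {p + N + 1 + int j..} (D \<delta> N (F j)) \<and>
        (\<exists>\<beta>\<in>A N. shifts tau {p + N + 1 + int j..} \<beta> \<and> D \<delta>s N \<beta> = part tau {p + N + 1 + int j} (D \<delta> N (F j)) \<and>
           F (Suc j) = (\<lambda>x. F j x - \<beta> x))"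
        using corrections_exist by (elim exE conjE)
      have F: "F j \<in> A N" "shifts tau {p + N + 1 + int j..} (D \<delta> N (F j))" for j using FP by blast+
      have cF: "?c F j (?h j (?D (F j)))" for j
        unfolding corr comp[OF F(1)] using FP by blast
      \<comment> \<open>The sequence must not meet a cocycle between l and its end, so it is cut at
        the first cocycle from l on.\<close>
      define Z where "Z j \<longleftrightarrow> l \<le> j \<and> D \<delta> N (F j) = (\<lambda>x. 0)" for j
      \<comment> \<open>At this index the filtration degree of the coboundary exceeds the bound of
        \<open>tau_upper\<close> in degree N + 1.\<close>
      have "D \<delta> N (F (l + nat (N + 1 + int (card B) - p - N))) = (\<lambda>x. 0)"
        by (rule tau_upper[OF D_\<delta>_homs[OF F(1)] F(2)]) simp
      then have "Z (l + nat (N + 1 + int (card B) - p - N))" by (simp add: Z_def)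
      then have L: "Z (LEAST j. Z j)" by (rule LeastI)
      have Z: "D \<delta> N (F j) \<noteq> (\<lambda>x. 0)" if "l \<le> j \<and> j < (LEAST j. Z j)" for j
        using not_less_Least[of j Z] that unfolding Z_def by blast
      have "constructed B deg d \<delta> ds \<delta>s p N f (F (LEAST j. Z j))"
        unfolding con
      proof (rule disjI2, rule exI[of _ l], rule exI[of _ "LEAST j. Z j"], rule exI[of _ F], intro conjI allI impI)
        show "l \<le> (LEAST j. Z j)" "hom_diff B deg d \<delta> N (F (LEAST j. Z j)) = (\<lambda>_. 0)"
          using L unfolding Z_def hd[OF F(1)] by blast+
      qed (use l F0 cF Z in \<open>simp_all only: hd[OF F(1)] simp_thms not_False_eq_True\<close>)
      then show ?thesis by blast
    qed
  next
    fix fl assume "constructed B deg d \<delta> ds \<delta>s p N f fl"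
    then show "generating_class B deg d \<delta> N fl"
      unfolding con
    proof (elim disjE exE conjE)
      assume "D \<delta> N f = (\<lambda>x. 0)" "fl = f"
      then show ?thesis using generating gen(1) ff by simp
    next
      fix l L F
      assume F: "F 0 = f" "F L = fl" "?D (F L) = (\<lambda>_. 0)"
        and s1: "\<forall>j<l. ?c F j (?h j (?D (F j)))"
        and s2: "\<forall>j. l \<le> j \<and> j < L \<longrightarrow> ?D (F j) \<noteq> (\<lambda>_. 0) \<and> (?c F j (?h j (?D (F j))) \<or> ?c F j (?D (F j)))"
      have st: "?c F j (?h j (?D (F j))) \<or> ?c F j (?D (F j))" if "j < L" for j
      proof (cases "j < l")
        case True
        then show ?thesis using s1 by blast
      next
        case False
        then show ?thesis using s2 that by (simp only: not_less)
      qed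
      \<comment> \<open>The restriction on the filtration degree of \<beta> enters in the last
        conjunct: no correction touches the leading component of f.\<close>
      have "F j \<in> A N \<and> shifts tau {p + N + 1 + int j..} (D \<delta> N (F j)) \<and> shifts tau {p + N + 1..} (\<lambda>x. F j x - f x)"
        if "j \<le> L" for j
        using that
      proof (induct j)
        case 0
        then show ?case using gen(1) D_\<delta>_f ff by (simp add: F(1))
      next
        case (Suc j)
        then have IH: "F j \<in> A N" "shifts tau {p + N + 1 + int j..} (D \<delta> N (F j))" "shifts tau {p + N + 1..} (\<lambda>x. F j x - f x)"
          by simp_all
        obtain h where h: "correction B deg ds \<delta>s p N j h (F j) (F (Suc j))"
          "h = part tau {p + N + 1 + int j} (D \<delta> N (F j)) \<or> h = D \<delta> N (F j)"
          using st[OF Suc_le_lessD[OF Suc(2)]] unfolding hd[OF IH(1)] comp[OF IH(1), unfolded hd[OF IH(1)]] by blast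
        from step[OF IH h] show ?case by blast
      qed
      from this[of L] have L: "fl \<in> A N" "shifts tau {p + N + 1..} (\<lambda>x. fl x - f x)" using F(2) by simp_all
      show ?thesis using generating[OF L] F(2,3) by (simp add: hd[OF L(1)])
    qed
  qed
qed

end
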